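(* Let $(g_m)_{m\in\mathbb{N}}$ and $(G_m)_{m\in\mathbb{N}}$ be sequences of functions from $C(E)$ such that $g_m\uparrow g$ as $m\to\infty$ with $g_0(\cdot)\geq c_0$ for some constant $c_0>0$, and $G_m\to G$ uniformly as $m\to\infty$ with $G_m(\cdot)\geq 0$ for all $m$. Let $$w(x):=\inf_{\tau\in\mathcal{T}} \mathbb{E}_x\left[e^{\int_0^{\tau} g(X_s)ds+G(X_\tau)}\right],\qquad w_m(x):=\inf_{\tau\in \mathcal{T}_m}\mathbb{E}_x \left[ e^{\int_0^\tau g_m(X_s)ds +G_m(X_\tau)}\right],\quad x\in E,\ m\in\mathbb{N}.$$ Then $w_m\to w$ as $m\to \infty$, uniformly on compact subsets of $E$.
   Context: Setting: $(\Omega,\mathcal{F},(\mathcal{F}_t)_{t\geq 0},\mathbb{P})$ is a filtered probability space satisfying the usual conditions, with $\mathcal{F}_0$ trivial. $X=(X_t)_{t\ge 0}$ is a time-homogeneous standard Markov process (right-continuous, strong Markov, quasi-left-continuous: if stopping times $\sigma_n\uparrow\sigma$, then $X_{\sigma_n}\to X_\sigma$ a.s. on $\{\sigma<\infty\}$) with values in a locally compact separable metric space $(E,\rho)$ with its Borel $\sigma$-field; $\mathbb{P}_x,\mathbb{E}_x$ denote probability and expectation when $X_0=x$. The transition semigroup $P_tf(x)=\mathbb{E}_x[f(X_t)]$ is $C_0$-Feller: $P_tC_0(E)\subset C_0(E)$ for each $t\ge 0$, where $C_0(E)$ is the set of continuous bounded functions vanishing at infinity. $C(E)$ is the set of continuous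 bounded real functions on $E$. The functions $g,G:E\to\mathbb{R}$ are continuous, bounded and non-negative, and $g(\cdot)\geq c$ for some constant $c>0$. $\mathbb{N}=\{0,1,2,\dots\}$. $\mathcal{T}$ is the family of almost surely finite $(\mathcal{F}_t)$-stopping times with values in $[0,\infty)$, and $\mathcal{T}_m\subset\mathcal{T}$ is the family of those taking values in the dyadic grid $\{0,\delta_m,2\delta_m,\ldots\}$, where $\delta_m:=(1/2)^m$. Convention: for a process $(Z_t)$ and $\tau\in\mathcal{T}$, $\mathbb{E}_x[Z_\tau]:=\liminf_{n\to\infty}\mathbb{E}_x[Z_{\tau\wedge n}]$. *)

theory Defs
  imports "HOL-Probability.Probability"
begin

section \<open>Filtered probability spaces\<close>

text \<open>
  Time is the half-line \<open>[0,\<infinity>)\<close>, a subset of the index type \<^typ>\<open>real\<close> of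
  \<^const>\<open>stopping_time\<close> and \<^locale>\<open>filtration\<close>.  The \<open>\<sigma>\<close>-fields at negative indices play no
  role: for nonnegative \<open>\<tau>\<close> the sets \<open>{\<tau> \<le> t}\<close> with \<open>t < 0\<close> are empty, and every filtration on
  \<open>[0,\<infinity>)\<close> extends by \<open>F t = F 0\<close> for \<open>t < 0\<close>.
\<close>

locale usual_filtered_prob_space = prob_space M + filtration "space M" F
  for M :: "'a measure" and F :: "real \<Rightarrow> 'a measure" +
  assumes sets_F_subset: "\<And>t. 0 \<le> t \<Longrightarrow> sets (F t) \<subseteq> sets M"
    and F_complete: "\<And>N A. N \<in> null_sets M \<Longrightarrow> A \<subseteq> N \<Longrightarrow> A \<in> sets (F 0)"
    and F_right_continuous: "\<And>t. 0 \<le> t \<Longrightarrow> sets (F t) = (\<Inter>s\<in>{t<..}. sets (F s))"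

definition stopping_times :: "'a measure \<Rightarrow> (real \<Rightarrow> 'a measure) \<Rightarrow> ('a \<Rightarrow> real) set"
  where "stopping_times M F = {\<tau>. stopping_time F \<tau> \<and> (\<forall>\<omega>\<in>space M. 0 \<le> \<tau> \<omega>)}"

definition dyadic_stopping_times ::
    "nat \<Rightarrow> 'a measure \<Rightarrow> (real \<Rightarrow> 'a measure) \<Rightarrow> ('a \<Rightarrow> real) set"
  where "dyadic_stopping_times m M F =
    {\<tau> \<in> stopping_times M F. \<forall>\<omega>\<in>space M. \<exists>k::nat. \<tau> \<omega> = real k * (1/2) ^ m}"

text \<open>Stopping times with values in \<open>[0,\<infinity>]\<close>, needed for quasi-left-continuity.\<close>

definition extended_stopping_time :: "(real \<Rightarrow> 'a measure) \<Rightarrow> ('a \<Rightarrow> ennreal) \<Rightarrow> bool"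
  where "extended_stopping_time F \<sigma> \<longleftrightarrow>
    (\<forall>t\<ge>0. Measurable.pred (F t) (\<lambda>\<omega>. \<sigma> \<omega> \<le> ennreal t))"

section \<open>Standard Markov processes with the Feller property\<close>

definition C0 :: "('e::metric_space \<Rightarrow> real) set"
  where "C0 = {f \<in> bcontfun. \<forall>\<epsilon>>0. \<exists>K. compact K \<and> (\<forall>x. x \<notin> K \<longrightarrow> \<bar>f x\<bar> < \<epsilon>)}"

definition transition ::
    "('e \<Rightarrow> 'a measure) \<Rightarrow> (real \<Rightarrow> 'a \<Rightarrow> 'e) \<Rightarrow> real \<Rightarrow> ('e \<Rightarrow> real) \<Rightarrow> 'e \<Rightarrow> real"
  where "transition P X t f x = (\<integral>\<omega>. f (X t \<omega>) \<partial>P x)"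

text \<open>
  The process \<open>X\<close> lives on one sample space; \<open>P x\<close> is the law under which it starts at \<open>x\<close>.
  The usual conditions and the triviality of the initial \<open>\<sigma>\<close>-field refer to a probability
  measure, so the \<open>\<sigma>\<close>-field \<open>sets (P x)\<close> and the filtration \<open>F x\<close> carry the starting point
  \<open>x\<close> (think of the \<open>P x\<close>-augmentation of a common filtration).  A single filtration containing
  the null sets of every \<open>P x\<close> would contain all subsets of the sample space as soon as there are
  two different starting points.

  For a metric space, separability is the class \<^class>\<open>second_countable_topology\<close>.
\<close>

locale standard_markov_process =
  fixes P :: "'e::{metric_space, second_countable_topology} \<Rightarrow> 'a measure"
    and F :: "'e \<Rightarrow> real \<Rightarrow> 'a measure"
    and X :: "real \<Rightarrow> 'a \<Rightarrow> 'e"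
  assumes same_space: "\<And>x y. space (P x) = space (P y)"
    and usual_conditions: "\<And>x. usual_filtered_prob_space (P x) (F x)"
    and F0_trivial: "\<And>x A. A \<in> sets (F x 0) \<Longrightarrow> measure (P x) A = 0 \<or> measure (P x) A = 1"
    and adapted: "\<And>x t. 0 \<le> t \<Longrightarrow> X t \<in> borel_measurable (F x t)"
    and start: "\<And>x. AE \<omega> in P x. X 0 \<omega> = x"
    and right_continuous:
      "\<And>x \<omega> t. \<omega> \<in> space (P x) \<Longrightarrow> 0 \<le> t \<Longrightarrow> continuous (at_right t) (\<lambda>s. X s \<omega>)"
    and strong_markov:
      "\<And>x \<tau> s f. \<tau> \<in> stopping_times (P x) (F x) \<Longrightarrow> 0 \<le> s \<Longrightarrow>
        f \<in> borel_measurable borel \<Longrightarrow> bounded (range f) \<Longrightarrow>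
        AE \<omega> in P x.
          real_cond_exp (P x) (filtration.pre_sigma (space (P x)) (F x) \<tau>)
            (\<lambda>\<omega>. f (X (\<tau> \<omega> + s) \<omega>)) \<omega> = transition P X s f (X (\<tau> \<omega>) \<omega>)"
    and quasi_left_continuous:
      "\<And>x \<sigma>n \<sigma>. (\<And>n::nat. extended_stopping_time (F x) (\<sigma>n n)) \<Longrightarrow>
        extended_stopping_time (F x) \<sigma> \<Longrightarrow>
        (\<And>\<omega>. \<omega> \<in> space (P x) \<Longrightarrow> incseq (\<lambda>n. \<sigma>n n \<omega>) \<and> (\<lambda>n. \<sigma>n n \<omega>) \<longlonglongrightarrow> \<sigma> \<omega>) \<Longrightarrow>
        AE \<omega> in P x. \<sigma> \<omega> < \<infinity> \<longrightarrow>
          (\<lambda>n. X (enn2real (\<sigma>n n \<omega>)) \<omega>) \<longlonglongrightarrow> X (enn2real (\<sigma> \<omega>)) \<omega>"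

definition C0_feller :: "('e::metric_space \<Rightarrow> 'a measure) \<Rightarrow> (real \<Rightarrow> 'a \<Rightarrow> 'e) \<Rightarrow> bool"
  where "C0_feller P X \<longleftrightarrow> (\<forall>t\<ge>0. \<forall>f\<in>C0. transition P X t f \<in> C0)"

section \<open>Optimal stopping values\<close>

text \<open>
  The expectation of a nonnegative process \<open>Z\<close> at a stopping time \<open>\<tau>\<close> is by convention the lower
  limit of the expectations at \<open>\<tau> \<and> n\<close>; it may be infinite.
\<close>

definition stopped_expectation ::
    "'a measure \<Rightarrow> (real \<Rightarrow> 'a \<Rightarrow> real) \<Rightarrow> ('a \<Rightarrow> real) \<Rightarrow> ennreal"
  where "stopped_expectation M Z \<tau> =
    liminf (\<lambda>n. \<integral>\<^sup>+\<omega>. ennreal (Z (min (\<tau> \<omega>) (real n)) \<omega>) \<partial>M)"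

definition exp_cost ::
    "(real \<Rightarrow> 'a \<Rightarrow> 'e) \<Rightarrow> ('e \<Rightarrow> real) \<Rightarrow> ('e \<Rightarrow> real) \<Rightarrow> real \<Rightarrow> 'a \<Rightarrow> real"
  where "exp_cost X g G t \<omega> = exp ((LBINT s:{0..t}. g (X s \<omega>)) + G (X t \<omega>))"

text \<open>
  The infimum is taken in \<open>[0,\<infinity>]\<close>.  Whenever \<open>T\<close> contains the stopping time 0 and \<open>G\<close> is bounded
  above, it is finite, so that \<^const>\<open>enn2real\<close> loses nothing; see \<open>INF_exp_cost_finite\<close>.
\<close>

definition stopping_value ::
    "'a measure \<Rightarrow> ('a \<Rightarrow> real) set \<Rightarrow> (real \<Rightarrow> 'a \<Rightarrow> 'e) \<Rightarrow> ('e \<Rightarrow> real) \<Rightarrow> ('e \<Rightarrow> real) \<Rightarrow> real"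
  where "stopping_value M T X g G =
    enn2real (INF \<tau>\<in>T. stopped_expectation M (exp_cost X g G) \<tau>)"

lemma zero_in_dyadic_stopping_times: "(\<lambda>_. 0) \<in> dyadic_stopping_times m M F"
  by (auto simp: dyadic_stopping_times_def stopping_times_def stopping_time_const
      intro!: exI[of _ "0::nat"])

lemma zero_in_stopping_times: "(\<lambda>_. 0) \<in> stopping_times M F"
  using zero_in_dyadic_stopping_times[of 0] by (auto simp: dyadic_stopping_times_def)

lemma INF_exp_cost_finite:
  assumes "prob_space M" "(\<lambda>_. 0) \<in> T" "\<And>y. G y \<le> B"
  shows "(INF \<tau>\<in>T. stopped_expectation M (exp_cost X g G) \<tau>) < \<infinity>"
proof -
  interpret prob_space M by fact
  have "(LBINT s:{0..0}. h s) = 0" for h :: "real \<Rightarrow> real"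
  proof -
    have "AE s in lborel. indicator {0..0} s *\<^sub>R h s = 0"
      using AE_lborel_singleton[of "0::real"] by eventually_elim (auto simp: indicator_def)
    then show ?thesis
      unfolding set_lebesgue_integral_def by (rule integral_eq_zero_AE)
  qed
  then have cost_0: "exp_cost X g G (min 0 (real n)) \<omega> \<le> exp B" for n \<omega>
    using assms(3)[of "X 0 \<omega>"] by (simp only: exp_cost_def min_0R of_nat_0_le_iff min_absorb1) simp
  have "(\<integral>\<^sup>+\<omega>. ennreal (exp_cost X g G (min 0 (real n)) \<omega>) \<partial>M) \<le> ennreal (exp B)" for n
  proof -
    have "(\<integral>\<^sup>+\<omega>. ennreal (exp_cost X g G (min 0 (real n)) \<omega>) \<partial>M) \<le> (\<integral>\<^sup>+\<omega>. ennreal (exp B) \<partial>M)"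
      by (rule nn_integral_mono) (rule ennreal_leI, rule cost_0)
    also have "\<dots> = ennreal (exp B)"
      by (simp only: nn_integral_const emeasure_space_1 mult_1_right)
    finally show ?thesis .
  qed
  then have "stopped_expectation M (exp_cost X g G) (\<lambda>_. 0) \<le> liminf (\<lambda>n::nat. ennreal (exp B))"
    unfolding stopped_expectation_def by (intro Liminf_mono always_eventually allI)
  also have "\<dots> = ennreal (exp B)"
    by (rule Liminf_const) simp
  also have "\<dots> < \<infinity>"
    by simp
  finally show ?thesis
    using INF_lower[OF assms(2)] by (rule le_less_trans[rotated])
qed

end

theory Submission
  imports Defs
begin

text \<open>
  A stopping time that is not worse than stopping at once can be cut off at a deterministic horizon
  at small extra cost: divide \<open>[0, n S]\<close> into \<open>n\<close> windows whose length satisfies \<open>c\<^sub>0 S \<ge> sup G\<close>.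
  One window carries at most a fraction \<open>1/n\<close> of the cost; stop at its beginning.  The error
  depends only on \<open>c\<^sub>0\<close> and \<open>sup G\<close>, so both problems reduce to stopping before a common time \<open>T\<close>,
  and no dynamic programming is needed.

  Up to time \<open>T\<close>, replacing \<open>g\<close> by \<open>g\<^sub>m\<close> costs a multiple of the expectation of the integral of
  \<open>(g - g\<^sub>m) (X\<^sub>s)\<close> over \<open>[0, T]\<close>, which decreases to 0 locally uniformly by Dini's theorem.
  Rounding \<open>\<tau>\<close> up to the dyadic grid is harmless provided that the expectation of
  \<open>\<bar>f (X\<^sub>\<sigma>) - f (X\<^sub>\<tau>)\<bar>\<close> is small uniformly over all stopping times \<open>\<tau> \<le> \<sigma> \<le> \<tau> + \<delta>\<close> before \<open>T\<close>, where
  \<open>f = exp \<circ> G\<close>.  This follows from strong continuity of the semigroup on \<^const>\<open>C0\<close> and from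
  compact containment of the process at bounded stopping times.
\<close>

section \<open>Convex combinations of bounded continuous functions\<close>

text \<open>The Feller hypothesis only says that the semigroup maps \<open>C0\<close> into itself;
  with right-continuous paths this yields pointwise, not uniform, convergence of
  \<open>Q s f\<close> to \<open>f\<close> as \<open>s\<close> tends to 0. The time averages of the
  semigroup repair this: \<open>Q s\<close> moves \<open>U L f\<close> by at most
  \<open>2 * s * B\<close> in sup norm, and the averages converge to \<open>f\<close> boundedly and
  pointwise. Simons' argument then yields convex combinations that converge in norm, and these
  inherit the uniform estimate. A second obstacle is that \<open>exp \<circ> G\<close> is merely
  bounded and continuous. It has to be multiplied by a function in \<open>C0\<close> that is close
  to 1 at the stopped process, uniformly over all stopping times before \<open>T\<close>. The order
  of the choices is essential: the tolerance fixes the horizon \<open>T\<close> through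
  \<open>c0\<close> and a common bound on the terminal costs, \<open>T\<close> fixes the admissible
  distance between stopping times, and only then is \<open>m\<close> taken large. Errors are
  amplified by factors such as \<open>exp (C * T + B)\<close>, so \<open>T\<close> must not depend
  on \<open>m\<close>.\<close>

lemma dini_decreasing:
  fixes f :: "nat \<Rightarrow> 'x::topological_space \<Rightarrow> real"
  assumes K: "compact K"
    and cont: "\<And>n. continuous_on K (f n)"
    and dec: "\<And>x. x \<in> K \<Longrightarrow> decseq (\<lambda>n. f n x)"
    and lim: "\<And>x. x \<in> K \<Longrightarrow> (\<lambda>n. f n x) \<longlonglongrightarrow> 0"
  shows "uniform_limit K f (\<lambda>_. 0) sequentially"
proof (rule uniform_limitI)
  fix e :: real assume e: "e > 0"
  have "\<exists>A. open A \<and> A \<inter> K = {x \<in> K. f n x < e}" for n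
  proof -
    have "open {..<e}" by simp
    from continuous_on_open_invariant[THEN iffD1, OF cont, rule_format, OF this, of n]
    show ?thesis by (auto simp: vimage_def Int_def conj_commute)
  qed
  then obtain A where A: "\<And>n. open (A n)" "\<And>n. A n \<inter> K = {x \<in> K. f n x < e}"
    by metis
  have "K \<subseteq> (\<Union>n. A n)"
  proof
    fix x assume x: "x \<in> K"
    have "eventually (\<lambda>n. f n x < e) sequentially"
      using order_tendstoD(2)[OF lim[OF x] e] .
    then obtain n where "f n x < e" by (auto simp: eventually_sequentially)
    with x A(2)[of n] show "x \<in> (\<Union>n. A n)" by auto
  qed
  then obtain C where C: "finite C" "K \<subseteq> (\<Union>n\<in>C. A n)"
    using compactE_image[OF K, of UNIV A] A(1) by metis
  show "\<forall>\<^sub>F n in sequentially. \<forall>x\<in>K. dist (f n x) 0 < e"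
    \<comment> \<open>Inserting 0 keeps \<open>Max\<close> meaningful for an empty subcover. By
      monotonicity, every \<open>n\<close> beyond the largest index of the subcover works on all of
      \<open>K\<close>.\<close>
    using eventually_ge_at_top[of "Max (insert 0 C)"]
  proof eventually_elim
    case (elim n)
    show ?case
    proof
      fix x assume x: "x \<in> K"
      then obtain k where "k \<in> C" "x \<in> A k" using C by auto
      with x A(2)[of k] have k: "k \<in> C" "f k x < e" by auto
      have "k \<le> n" using elim k C by (meson Max_ge finite.insertI insertCI le_trans)
      then have "f n x \<le> f k x" using dec[OF x] by (auto simp: decseq_def)
      moreover have "0 \<le> f n x" using decseq_ge[OF dec[OF x] lim[OF x]] .
      ultimately show "dist (f n x) 0 < e" using k by simp
    qed
  qed
qed

text \<open>The weights \<open>(1/2) ^ Suc k\<close> sum to 1, so the series is an infinite convex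
  combination. A partial sum becomes a finite one once the missing mass \<open>(1/2) ^ N\<close> is
  placed on a point of \<open>C\<close>, and this correction vanishes in the limit.\<close>

lemma closed_convex_dyadic_suminf:
  fixes C :: "'v::banach set"
  assumes C: "closed C" "convex C" "bounded C" and c: "\<And>k. c k \<in> C"
  shows "summable (\<lambda>k. (1/2) ^ Suc k *\<^sub>R c k)" and "(\<Sum>k. (1/2) ^ Suc k *\<^sub>R c k) \<in> C"
proof -
  obtain B where B: "\<And>x. x \<in> C \<Longrightarrow> norm x \<le> B" using C(3) by (auto simp: bounded_iff)
  show s: "summable (\<lambda>k. (1/2) ^ Suc k *\<^sub>R c k)"
  proof (rule summable_comparison_test[OF _ summable_mult[OF summable_geometric]])
    have "norm ((1/2) ^ Suc n *\<^sub>R c n) \<le> B * (1/2) ^ n" for n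
    proof -
      have "(1/2) ^ Suc n * norm (c n) \<le> (1/2) ^ n * B"
        using B[OF c[of n]] by (intro mult_mono) auto
      then show ?thesis by (simp add: mult.commute)
    qed
    then show "\<exists>N. \<forall>n\<ge>N. norm ((1/2) ^ Suc n *\<^sub>R c n) \<le> B * (1/2) ^ n" by blast
  qed simp
  have *: "(\<Sum>k<N. (1/2) ^ Suc k *\<^sub>R c k) + (1/2) ^ N *\<^sub>R y \<in> C" if "y \<in> C" for N y
    using that
  proof (induction N arbitrary: y)
    case (Suc N)
    \<comment> \<open>The last term and the remainder carry equal mass, so replacing both by their
      midpoint reduces \<open>Suc N\<close> to \<open>N\<close>.\<close>
    have "(1/2) *\<^sub>R c N + (1/2) *\<^sub>R y \<in> C"
      using C(2) c Suc.prems by (intro convexD) auto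
    from Suc.IH[OF this] show ?case by (simp add: algebra_simps)
  qed simp
  have "(\<lambda>N. (\<Sum>k<N. (1/2) ^ Suc k *\<^sub>R c k) + (1/2) ^ N *\<^sub>R c 0)
      \<longlonglongrightarrow> (\<Sum>k. (1/2) ^ Suc k *\<^sub>R c k) + 0 *\<^sub>R c 0"
    by (intro tendsto_intros summable_LIMSEQ s LIMSEQ_realpow_zero) auto
  then show "(\<Sum>k. (1/2) ^ Suc k *\<^sub>R c k) \<in> C"
    using closed_sequentially[OF C(1), OF *[OF c]] by simp
qed

instance bcontfun :: (metric_space, banach) banach ..

lemma approx_minimizer:
  fixes p :: "'v \<Rightarrow> real"
  assumes "C \<noteq> {}" "\<And>x. x \<in> C \<Longrightarrow> 0 \<le> p x" "e > 0"
  shows "\<exists>g\<in>C. \<forall>h\<in>C. p g \<le> p h + e"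
proof -
  have bdd: "bdd_below (p ` C)" using assms(2) by (auto intro: bdd_belowI[of _ 0])
  have "Inf (p ` C) < Inf (p ` C) + e" using assms by simp
  then obtain g where "g \<in> C" "p g < Inf (p ` C) + e"
    using cInf_lessD[of "p ` C" "Inf (p ` C) + e"] assms(1) by auto
  moreover have "Inf (p ` C) \<le> p h" if "h \<in> C" for h using cInf_lower[OF _ bdd] that by auto
  ultimately show ?thesis by (intro bexI[of _ g]) (auto intro!: less_imp_le dest: less_le_trans[OF _ add_right_mono])
qed

text \<open>
  Simons' argument: it replaces the Riesz representation theorem and Mazur's lemma.
\<close>

lemma convex_combination_small:
  fixes f :: "nat \<Rightarrow> 'x::metric_space \<Rightarrow>\<^sub>C real"
  assumes V: "closed V" "convex V" "\<And>n. f n \<in> V"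
    and attain: "\<And>h. h \<in> V \<Longrightarrow> \<exists>b. norm h \<le> \<bar>apply_bcontfun h b\<bar>"
    and bdd: "bounded (range f)"
    and lim: "\<And>b. (\<lambda>n. apply_bcontfun (f n) b) \<longlonglongrightarrow> 0"
    and e: "e > 0"
  shows "\<exists>g \<in> convex hull (range f). norm g < e"
proof (rule ccontr)
  assume "\<not> ?thesis"
  then have ge: "\<And>g. g \<in> convex hull (range f) \<Longrightarrow> e \<le> norm g" by force
  \<comment> \<open>Closed convex hulls of the tails. They decrease, lie in \<open>V\<close>, and by
    assumption contain only elements of norm at least \<open>e\<close>. The contradiction comes from
    evaluating one specially built element of \<open>K 0\<close> at a point where its norm is
    attained.\<close>
  define K where "K n = closure (convex hull (f ` {n..}))" for n
  have K_closed: "closed (K n)" and K_convex: "convex (K n)" and K_ne: "K n \<noteq> {}" for n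
    by (auto simp: K_def convex_closure)
  have K_bdd: "bounded (K n)" for n
    unfolding K_def by (intro bounded_closure bounded_convex_hull bounded_subset[OF bdd]) auto
  have K_mono: "K n \<subseteq> K m" if "m \<le> n" for m n
    unfolding K_def using that by (intro closure_mono hull_mono) auto
  have K0V: "K 0 \<subseteq> V"
    unfolding K_def using V by (intro closure_minimal hull_minimal) auto
  have K0_norm: "e \<le> norm g" if "g \<in> K 0" for g
  proof -
    have "K 0 \<subseteq> {g. e \<le> norm g}"
      unfolding K_def using ge by (intro closure_minimal closed_Collect_le continuous_intros) (auto simp: atLeast_0)
    then show ?thesis using that by auto
  qed
  \<comment> \<open>The infimum over \<open>K n\<close> need not be attained, so \<open>g\<close> is
    only a near-minimiser. The tolerance decays like \<open>(1/4)^n\<close> because a gap of order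
    \<open>(1/2)^n\<close> has to survive it.\<close>
  define good where "good n y g \<longleftrightarrow> g \<in> K n \<and>
    (\<forall>h\<in>K n. norm (y + (1/2)^n *\<^sub>R g) \<le> norm (y + (1/2)^n *\<^sub>R h) + e / 4 * (1/4)^n)"
    for n and y g :: "'x \<Rightarrow>\<^sub>C real"
  define G where "G n y = (SOME g. good n y g)" for n y
  have G: "good n y (G n y)" for n y
  proof -
    have "\<exists>g\<in>K n. \<forall>h\<in>K n. norm (y + (1/2)^n *\<^sub>R g) \<le> norm (y + (1/2)^n *\<^sub>R h) + e / 4 * (1/4)^n"
      using K_ne e by (intro approx_minimizer) auto
    then have "\<exists>g. good n y g" by (auto simp: good_def)
    then show ?thesis unfolding G_def by (rule someI_ex)
  qed
  \<comment> \<open>These are the partial sums of the dyadic series of the \<open>g n\<close>; each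
    \<open>g n\<close> is chosen greedily, given the sum so far.\<close>
  define x where "x = rec_nat 0 (\<lambda>n y. y + (1/2) ^ Suc n *\<^sub>R G n y)"
  define g where "g n = G n (x n)" for n
  have x0: "x 0 = 0" and xS: "\<And>n. x (Suc n) = x n + (1/2) ^ Suc n *\<^sub>R g n"
    by (auto simp: x_def g_def)
  have gK: "g n \<in> K n"
    and gmin: "h \<in> K n \<Longrightarrow>
      norm (x n + (1/2)^n *\<^sub>R g n) \<le> norm (x n + (1/2)^n *\<^sub>R h) + e / 4 * (1/4)^n" for n h
    using G[of n "x n"] by (auto simp: good_def g_def)
  have gK': "g (k + n) \<in> K n" for k n using gK[of "k + n"] K_mono[of n "k+n"] by auto
  \<comment> \<open>The tail of the series from index \<open>n\<close> on, renormalised to total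
    mass 1. It lies in \<open>K n\<close> and therefore competes with \<open>g n\<close> in the
    near-minimisation at stage \<open>n\<close>; there its value is exactly
    \<open>norm (z 0)\<close>.\<close>
  define z where "z n = (\<Sum>k. (1/2) ^ Suc k *\<^sub>R g (k + n))" for n
  have zK: "z n \<in> K n"
    and zsum: "summable (\<lambda>k. (1/2) ^ Suc k *\<^sub>R g (k + n))" for n
    unfolding z_def
    using closed_convex_dyadic_suminf[of "K n" "\<lambda>k. g (k + n)"] K_closed K_convex K_bdd gK' by auto
  have zS: "z n = (1/2) *\<^sub>R g n + (1/2) *\<^sub>R z (Suc n)" for n
  proof -
    have "z n = (1/2) *\<^sub>R g n + (\<Sum>k. (1/2) ^ Suc (Suc k) *\<^sub>R g (Suc k + n))"
      unfolding z_def using suminf_split_head[OF zsum[of n]] by simp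
    also have "(\<Sum>k. (1/2) ^ Suc (Suc k) *\<^sub>R g (Suc k + n)) = (1/2) *\<^sub>R z (Suc n)"
      unfolding z_def using suminf_scaleR_right[OF zsum[of "Suc n"], of "1/2"] by simp
    finally show ?thesis .
  qed
  have xz: "z 0 = x n + (1/2) ^ n *\<^sub>R z n" for n
  proof (induction n)
    case (Suc n) then show ?case using zS[of n] xS[of n] by (simp add: algebra_simps)
  qed (simp add: x0)
  \<comment> \<open>The extra summand \<open>e/2 * (1/2)^n\<close> is tuned to the recursion:
    subtracting the tolerance \<open>e / 4 * (1/4)^n\<close> and halving leaves exactly the claim
    for \<open>Suc n\<close>.\<close>
  have gap: "(1/2)^n * (e/2 + e/2 * (1/2)^n) \<le> norm (z 0) - norm (x n)" for n
  proof (induction n)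
    case 0 then show ?case using K0_norm[OF zK] x0 by simp
  next
    case (Suc n)
    \<comment> \<open>The next partial sum is the midpoint of \<open>x n\<close> and the
      near-minimal point, whose norm is at most \<open>norm (z 0)\<close> up to the
      tolerance.\<close>
    have "x (Suc n) = (1/2) *\<^sub>R x n + (1/2) *\<^sub>R (x n + (1/2)^n *\<^sub>R g n)"
      by (simp add: xS algebra_simps flip: scaleR_left_distrib)
    then have "norm (x (Suc n)) \<le> (1/2) * norm (x n) + (1/2) * norm (x n + (1/2)^n *\<^sub>R g n)"
      using norm_triangle_ineq[of "(1/2) *\<^sub>R x n" "(1/2) *\<^sub>R (x n + (1/2)^n *\<^sub>R g n)"]
      by (simp only: norm_scaleR)
    also have "\<dots> \<le> (1/2) * norm (x n) + (1/2) * (norm (z 0) + e / 4 * (1/4)^n)"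
      using gmin[OF zK, of n] xz[of n] by simp
    finally have "2 * (norm (z 0) - norm (x (Suc n))) \<ge> (norm (z 0) - norm (x n)) - e / 4 * (1/4)^n"
      by (simp add: field_simps)
    with Suc.IH have "2 * (norm (z 0) - norm (x (Suc n))) \<ge>
        (1/2)^n * (e/2 + e/2 * (1/2)^n) - e / 4 * (1/4)^n" by linarith
    moreover have "(1/4::real)^n = (1/2)^n * (1/2)^n" by (simp flip: power_mult_distrib)
    ultimately show ?case by (simp add: algebra_simps)
  qed
  \<comment> \<open>For large \<open>n\<close> the closed convex set \<open>?W\<close> contains all
    of \<open>K n\<close>, hence \<open>z n\<close>. Thus at \<open>b\<close>, where
    \<open>z 0\<close> attains its norm, passing from \<open>x n\<close> to \<open>z 0\<close> gains
    at most \<open>(1/2)^n * (e/4)\<close>, less than \<open>gap\<close> demands.\<close>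
  obtain b where b: "norm (z 0) \<le> \<bar>apply_bcontfun (z 0) b\<bar>"
    using attain[of "z 0"] zK[of 0] K0V by auto
  have "eventually (\<lambda>n. \<bar>apply_bcontfun (f n) b\<bar> < e/4) sequentially"
    using tendstoD[OF lim[of b], of "e/4"] e by (simp add: dist_real_def)
  then obtain n where n: "\<And>k. k \<ge> n \<Longrightarrow> \<bar>apply_bcontfun (f k) b\<bar> < e/4"
    by (auto simp: eventually_sequentially)
  let ?W = "{h :: 'x \<Rightarrow>\<^sub>C real. \<bar>apply_bcontfun h b\<bar> \<le> e/4}"
  have ev_cont: "continuous_on UNIV (\<lambda>h :: 'x \<Rightarrow>\<^sub>C real. apply_bcontfun h b)"
    unfolding continuous_on_iff
  proof (intro ballI allI impI)
    fix h :: "'x \<Rightarrow>\<^sub>C real" and d :: real assume "0 < d"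
    then show "\<exists>r>0. \<forall>k\<in>UNIV. dist k h < r \<longrightarrow> dist (apply_bcontfun k b) (apply_bcontfun h b) < d"
      using dist_fun_lt_imp_dist_val_lt by blast
  qed
  have "K n \<subseteq> ?W" unfolding K_def
  proof (intro closure_minimal hull_minimal)
    show "f ` {n..} \<subseteq> ?W" using n by (auto intro: less_imp_le)
    show "convex ?W"
    proof (rule convexI)
      fix h k :: "'x \<Rightarrow>\<^sub>C real" and u v :: real
      assume "h \<in> ?W" "k \<in> ?W" and uv: "0 \<le> u" "0 \<le> v" "u + v = 1"
      then have "\<bar>apply_bcontfun h b\<bar> \<le> e/4" "\<bar>apply_bcontfun k b\<bar> \<le> e/4" by auto
      then have "u * \<bar>apply_bcontfun h b\<bar> + v * \<bar>apply_bcontfun k b\<bar> \<le> e/4"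
        using uv convex_bound_le by blast
      moreover have "\<bar>u * apply_bcontfun h b + v * apply_bcontfun k b\<bar>
          \<le> u * \<bar>apply_bcontfun h b\<bar> + v * \<bar>apply_bcontfun k b\<bar>"
        using uv by (metis abs_mult abs_of_nonneg abs_triangle_ineq)
      ultimately show "u *\<^sub>R h + v *\<^sub>R k \<in> ?W" by simp
    qed
    show "closed ?W" using ev_cont by (intro closed_Collect_le continuous_intros) auto
  qed
  then have small: "\<bar>apply_bcontfun (z n) b\<bar> \<le> e/4" using zK by auto
  have "(1/2)^n * (e/2) \<le> (1/2)^n * (e/2 + e/2 * (1/2)^n)" using e by simp
  also have "\<dots> \<le> norm (z 0) - norm (x n)" by (rule gap)
  also have "\<dots> \<le> \<bar>apply_bcontfun (z 0) b\<bar> - \<bar>apply_bcontfun (x n) b\<bar>"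
    using b norm_bounded[of "x n" b] by simp
  also have "\<dots> \<le> (1/2)^n * \<bar>apply_bcontfun (z n) b\<bar>"
    using xz[of n] abs_triangle_ineq[of "apply_bcontfun (x n) b" "(1/2)^n * apply_bcontfun (z n) b"]
    by (simp add: abs_mult)
  also have "\<dots> \<le> (1/2)^n * (e/4)" using small by simp
  finally show False using e by simp
qed

section \<open>Functions vanishing at infinity\<close>

lemma bcontfun_bound:
  fixes f :: "'x::topological_space \<Rightarrow> real"
  assumes "f \<in> bcontfun"
  obtains B where "B > 0" "\<And>x. \<bar>f x\<bar> \<le> B"
  using assms by (auto simp: bcontfun_def bounded_pos)

lemma bcontfun_boundI:
  fixes f :: "'x::topological_space \<Rightarrow> real"
  assumes "continuous_on UNIV f" "\<And>x. \<bar>f x\<bar> \<le> B"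
  shows "f \<in> bcontfun"
  using assms by (auto simp: bcontfun_def intro!: boundedI)

lemma bcontfun_continuous: "f \<in> bcontfun \<Longrightarrow> continuous_on UNIV f"
  by (auto simp: bcontfun_def)

lemma bcontfun_measurable: "f \<in> bcontfun \<Longrightarrow> f \<in> borel_measurable borel"
  by (intro borel_measurable_continuous_onI) (auto simp: bcontfun_def)

lemma bcontfun_bounded: "f \<in> bcontfun \<Longrightarrow> bounded (range f)"
  by (auto simp: bcontfun_def)

lemma bcontfun_times:
  fixes f g :: "'x::topological_space \<Rightarrow> real"
  assumes "f \<in> bcontfun" "g \<in> bcontfun"
  shows "(\<lambda>x. f x * g x) \<in> bcontfun"
proof -
  obtain A B where "A > 0" "\<And>x. \<bar>f x\<bar> \<le> A" "B > 0" "\<And>x. \<bar>g x\<bar> \<le> B"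
    using assms bcontfun_bound by metis
  then have "\<bar>f x * g x\<bar> \<le> A * B" for x by (simp add: abs_mult mult_mono)
  then show ?thesis
    using assms by (intro bcontfun_boundI continuous_intros) (auto intro: bcontfun_continuous)
qed

lemma C0_bcontfun: "f \<in> C0 \<Longrightarrow> f \<in> bcontfun"
  by (simp add: C0_def)

lemma C0_vanish: "f \<in> C0 \<Longrightarrow> \<epsilon> > 0 \<Longrightarrow> \<exists>K. compact K \<and> (\<forall>x. x \<notin> K \<longrightarrow> \<bar>f x\<bar> < \<epsilon>)"
  by (simp add: C0_def)

lemma C0_dominated:
  assumes f: "f \<in> C0" and g: "continuous_on UNIV g" and le: "\<And>x. \<bar>g x\<bar> \<le> c * \<bar>f x\<bar>" and c: "0 \<le> c"
  shows "g \<in> C0"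
  unfolding C0_def
proof (intro CollectI conjI allI impI)
  obtain B where B: "B > 0" "\<And>x. \<bar>f x\<bar> \<le> B" using f C0_bcontfun bcontfun_bound by metis
  have "\<bar>g x\<bar> \<le> c * B" for x using le[of x] mult_left_mono[OF B(2) c] order_trans by blast
  with g show "g \<in> bcontfun" by (intro bcontfun_boundI)
  fix e :: real assume "e > 0"
  \<comment> \<open>Dividing by \<open>c + 1\<close> covers \<open>c = 0\<close> and keeps the final
    inequality strict.\<close>
  then obtain K where K: "compact K" "\<And>x. x \<notin> K \<Longrightarrow> \<bar>f x\<bar> < e / (c + 1)"
    using C0_vanish[OF f, of "e / (c + 1)"] c by auto
  have "\<bar>g x\<bar> < e" if "x \<notin> K" for x
  proof -
    have "\<bar>g x\<bar> \<le> c * \<bar>f x\<bar>" by (rule le)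
    also have "\<dots> \<le> c * (e / (c + 1))" using K(2)[OF that] c by (intro mult_left_mono) auto
    also have "\<dots> < e" using c \<open>e > 0\<close> by (simp add: field_simps)
    finally show ?thesis .
  qed
  then show "\<exists>K. compact K \<and> (\<forall>x. x \<notin> K \<longrightarrow> \<bar>g x\<bar> < e)" using K(1) by blast
qed

lemma C0_add:
  assumes f: "f \<in> C0" and g: "g \<in> C0"
  shows "(\<lambda>x. f x + g x) \<in> C0"
  unfolding C0_def
proof (intro CollectI conjI allI impI)
  show "(\<lambda>x. f x + g x) \<in> bcontfun" using f g by (intro plus_cont C0_bcontfun)
  fix e :: real assume "e > 0"
  then obtain K L where KL: "compact K" "\<And>x. x \<notin> K \<Longrightarrow> \<bar>f x\<bar> < e / 2"
      "compact L" "\<And>x. x \<notin> L \<Longrightarrow> \<bar>g x\<bar> < e / 2"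
    using C0_vanish[OF f, of "e/2"] C0_vanish[OF g, of "e/2"] by auto
  have "\<bar>f x + g x\<bar> < e" if "x \<notin> K \<union> L" for x
    using that KL(2)[of x] KL(4)[of x] by auto
  with KL(1,3) show "\<exists>K. compact K \<and> (\<forall>x. x \<notin> K \<longrightarrow> \<bar>f x + g x\<bar> < e)"
    by (intro exI[of _ "K \<union> L"]) auto
qed

lemma C0_times:
  assumes f: "f \<in> C0" and g: "g \<in> bcontfun"
  shows "(\<lambda>x. f x * g x) \<in> C0"
proof -
  obtain B where B: "B > 0" "\<And>x. \<bar>g x\<bar> \<le> B" using bcontfun_bound[OF g] by metis
  show ?thesis
  proof (rule C0_dominated[OF f])
    show "continuous_on UNIV (\<lambda>x. f x * g x)"
      using bcontfun_continuous[OF C0_bcontfun[OF f]] bcontfun_continuous[OF g]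
      by (intro continuous_intros)
    show "\<bar>f x * g x\<bar> \<le> B * \<bar>f x\<bar>" for x
      using mult_left_mono[OF B(2)[of x], of "\<bar>f x\<bar>"] by (simp add: abs_mult mult.commute)
  qed (use B in auto)
qed

lemma C0_zero: "(\<lambda>_. 0) \<in> C0"
  by (auto simp: C0_def const_bcontfun intro!: exI[of _ "{}"])

lemma C0_cmult: "f \<in> C0 \<Longrightarrow> (\<lambda>x. c * f x) \<in> C0"
  using C0_times[of f "\<lambda>_. c"] by (simp add: const_bcontfun mult.commute)

lemma C0_sum:
  assumes "\<And>i. i \<in> I \<Longrightarrow> f i \<in> C0"
  shows "(\<lambda>x. \<Sum>i\<in>I. f i x) \<in> C0"
  using assms by (induction I rule: infinite_finite_induct) (auto intro: C0_zero C0_add)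

text \<open>If \<open>f a\<close> is nonzero, the points where the absolute value is at least that
  at \<open>a\<close> lie in a compact set containing \<open>a\<close>. This supplies the attainment
  hypothesis of \<open>convex_combination_small\<close>.\<close>

lemma C0_attains_max_abs:
  assumes f: "f \<in> C0"
  shows "\<exists>b. \<forall>x. \<bar>f x\<bar> \<le> \<bar>f b\<bar>"
proof (cases "\<exists>a. f a \<noteq> 0")
  case True
  then obtain a where a: "f a \<noteq> 0" by blast
  then obtain K where K: "compact K" "\<And>x. x \<notin> K \<Longrightarrow> \<bar>f x\<bar> < \<bar>f a\<bar>"
    using C0_vanish[OF f, of "\<bar>f a\<bar>"] by auto
  then have aK: "a \<in> K" by force
  have "continuous_on K (\<lambda>x. \<bar>f x\<bar>)"
    by (intro continuous_intros continuous_on_subset[OF bcontfun_continuous[OF C0_bcontfun[OF f]]]) auto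
  then obtain b where "b \<in> K" "\<And>x. x \<in> K \<Longrightarrow> \<bar>f x\<bar> \<le> \<bar>f b\<bar>"
    using continuous_attains_sup[of K "\<lambda>x. \<bar>f x\<bar>"] K(1) aK by blast
  then show ?thesis using K(2) aK by (metis le_less_trans less_imp_le order_trans)
qed auto

text \<open>An increasing approximate unit of \<open>C0\<close>. It turns vanishing at infinity into
  a statement about sequences, which dominated convergence can handle.\<close>

locale cutoff =
  fixes \<phi> :: "nat \<Rightarrow> 'e::metric_space \<Rightarrow> real"
  assumes cutoff_C0: "\<And>n. \<phi> n \<in> C0"
    and cutoff_nonneg: "\<And>n x. 0 \<le> \<phi> n x"
    and cutoff_le_1: "\<And>n x. \<phi> n x \<le> 1"
    and cutoff_mono: "\<And>x. incseq (\<lambda>n. \<phi> n x)"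
    and cutoff_lim: "\<And>x. (\<lambda>n. \<phi> n x) \<longlonglongrightarrow> 1"
begin

lemma cutoff_continuous: "continuous_on S (\<phi> n)"
  using cutoff_C0[of n] C0_bcontfun bcontfun_continuous continuous_on_subset by blast

text \<open>Off a compact set \<open>f\<close> itself is small; on that set \<open>\<phi> n\<close>
  tends to 1 uniformly by Dini's theorem.\<close>

lemma C0_eventually_small:
  assumes f: "f \<in> C0" and e: "e > 0"
  shows "\<forall>\<^sub>F n in sequentially. \<forall>x. \<bar>f x\<bar> * (1 - \<phi> n x) < e"
proof -
  obtain B where B: "B > 0" "\<And>x. \<bar>f x\<bar> \<le> B" using f C0_bcontfun bcontfun_bound by metis
  obtain K where K: "compact K" "\<And>x. x \<notin> K \<Longrightarrow> \<bar>f x\<bar> < e" using C0_vanish[OF f e] by auto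
  have "uniform_limit K (\<lambda>n x. 1 - \<phi> n x) (\<lambda>_. 0) sequentially"
  proof (rule dini_decreasing[OF K(1)])
    show "continuous_on K (\<lambda>x. 1 - \<phi> n x)" for n by (intro continuous_intros cutoff_continuous)
    show "decseq (\<lambda>n. 1 - \<phi> n x)" for x using cutoff_mono[of x] by (auto simp: decseq_def incseq_def)
    show "(\<lambda>n. 1 - \<phi> n x) \<longlonglongrightarrow> 0" for x using tendsto_diff[OF tendsto_const cutoff_lim[of x], of 1] by simp
  qed
  from uniform_limitD[OF this, of "e / B"] B(1) e
  have "\<forall>\<^sub>F n in sequentially. \<forall>x\<in>K. dist (1 - \<phi> n x) 0 < e / B" by simp
  then show ?thesis
  proof eventually_elim
    case (elim n)
    show ?case
    proof
      fix x
      have nn: "0 \<le> 1 - \<phi> n x" "1 - \<phi> n x \<le> 1" using cutoff_le_1[of n x] cutoff_nonneg[of n x] by auto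
      show "\<bar>f x\<bar> * (1 - \<phi> n x) < e"
      proof (cases "x \<in> K")
        case True
        have "\<bar>f x\<bar> * (1 - \<phi> n x) \<le> B * (1 - \<phi> n x)" using B nn by (intro mult_right_mono) auto
        also have "\<dots> < B * (e / B)" using elim True B(1) nn by (intro mult_strict_left_mono) auto
        finally show ?thesis using B(1) by simp
      next
        case False
        have "\<bar>f x\<bar> * (1 - \<phi> n x) \<le> \<bar>f x\<bar> * 1" using nn by (intro mult_left_mono) auto
        then show ?thesis using K(2)[OF False] by simp
      qed
    qed
  qed
qed

text \<open>Outside a compact set \<open>\<phi> n\<close> is below 1/2, so there the factor
  \<open>1 - \<phi> n x\<close> costs at most a factor 2. Together with
  \<open>C0_eventually_small\<close> this gives a sequential test for membership in
  \<open>C0\<close>.\<close>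

lemma C0_if_small:
  assumes f: "f \<in> bcontfun" and small: "\<And>e. e > 0 \<Longrightarrow> \<exists>n. \<forall>x. \<bar>f x\<bar> * (1 - \<phi> n x) \<le> e"
  shows "f \<in> C0"
  unfolding C0_def
proof (intro CollectI conjI allI impI)
  fix e :: real assume e: "e > 0"
  then obtain n where n: "\<And>x. \<bar>f x\<bar> * (1 - \<phi> n x) \<le> e / 3" using small[of "e/3"] by auto
  obtain K where K: "compact K" "\<And>x. x \<notin> K \<Longrightarrow> \<bar>\<phi> n x\<bar> < 1/2"
    using C0_vanish[OF cutoff_C0, of "1/2" n] by auto
  have "\<bar>f x\<bar> < e" if "x \<notin> K" for x
  proof -
    have "\<bar>f x\<bar> * (1/2) \<le> \<bar>f x\<bar> * (1 - \<phi> n x)" using K(2)[OF that] by (intro mult_left_mono) auto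
    then show ?thesis using n[of x] e by simp
  qed
  with K(1) show "\<exists>K. compact K \<and> (\<forall>x. x \<notin> K \<longrightarrow> \<bar>f x\<bar> < e)" by blast
qed (rule f)

end

text \<open>Local compactness provides balls whose closed counterparts are compact, and by
  Lindelof's theorem countably many of them cover the space. The cutoffs are capped sums of tent
  functions on these balls.\<close>

lemma locally_compact_cutoff:
  assumes lc: "locally_compact_space (euclidean :: 'e::{metric_space, second_countable_topology} topology)"
  shows "\<exists>\<phi> :: nat \<Rightarrow> 'e \<Rightarrow> real. cutoff \<phi>"
proof -
  have "\<exists>r>0. compact (cball x r)" for x :: 'e
  proof -
    obtain U K where UK: "open U" "compact K" "x \<in> U" "U \<subseteq> K"
      using lc unfolding locally_compact_space_def by simp metis
    then obtain r where "r > 0" "cball x r \<subseteq> U" using open_contains_cball by blast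
    then have "cball x r = K \<inter> cball x r" using UK by auto
    moreover have "compact (K \<inter> cball x r)" using UK by (intro compact_Int_closed) auto
    ultimately show ?thesis using \<open>r > 0\<close> by auto
  qed
  then obtain r where r: "\<And>x :: 'e. r x > 0" "\<And>x. compact (cball x (r x))" by metis
  obtain D where D: "D \<subseteq> range (\<lambda>x. ball x (r x))" "countable D" "\<Union>D = \<Union>(range (\<lambda>x. ball x (r x)))"
    by (rule Lindelof[of "range (\<lambda>x. ball x (r x))"]) auto
  have "x \<in> \<Union>(range (\<lambda>x. ball x (r x)))" for x :: 'e using r(1)[of x] by (intro UN_I[of x]) auto
  then have "\<Union>(range (\<lambda>x. ball x (r x))) = (UNIV :: 'e set)" by blast
  then have D_UNIV: "\<Union>D = (UNIV :: 'e set)" using D by simp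
  then have "D \<noteq> {}" by auto
  then obtain d :: "nat \<Rightarrow> 'e set" where d: "range d = D" using range_from_nat_into[OF _ D(2)] by metis
  have "\<exists>x. d n = ball x (r x)" for n
    using D(1) rangeI[of d n] unfolding d by auto
  then obtain c where c: "\<And>n. d n = ball (c n) (r (c n))"
    using choice[of "\<lambda>n x. d n = ball x (r x)"] by blast
  define b where "b i y = max 0 (1 - dist (c i) y / r (c i))" for i y
  have b_C0: "b i \<in> C0" for i
    unfolding C0_def
  proof (intro CollectI conjI allI impI)
    show "b i \<in> bcontfun" unfolding b_def using r(1)[of "c i"]
      by (intro bcontfun_boundI[of _ 1] continuous_intros) (auto simp: field_simps)
    show "\<exists>K. compact K \<and> (\<forall>x. x \<notin> K \<longrightarrow> \<bar>b i x\<bar> < e)" if "e > 0" for e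
      using that r[of "c i"] by (intro exI[of _ "cball (c i) (r (c i))"]) (auto simp: b_def field_simps)
  qed
  have b0: "0 \<le> b i y" for i y by (simp add: b_def)
  \<comment> \<open>The factor \<open>real n\<close> drives the value up to 1 wherever some tent is
    positive, however small it is.\<close>
  define \<phi> where "\<phi> n y = min 1 (real n * (\<Sum>i<n. b i y))" for n y
  have s0: "0 \<le> (\<Sum>i<n. b i y)" for n y by (intro sum_nonneg b0)
  have "cutoff \<phi>"
  proof
    fix n and x :: 'e
    have s: "(\<lambda>y. \<Sum>i<n. b i y) \<in> C0" by (intro C0_sum b_C0)
    show "\<phi> n \<in> C0"
    proof (rule C0_dominated[OF s, of _ "real n"])
      show "continuous_on UNIV (\<phi> n)" unfolding \<phi>_def
        by (intro continuous_on_min continuous_on_mult continuous_on_const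
            bcontfun_continuous[OF C0_bcontfun[OF s]])
    qed (use s0 in \<open>auto simp: \<phi>_def\<close>)
    show "0 \<le> \<phi> n x" "\<phi> n x \<le> 1" using s0 by (auto simp: \<phi>_def)
    show "incseq (\<lambda>n. \<phi> n x)"
      unfolding incseq_def \<phi>_def
      by (intro allI impI min.mono mult_mono sum_mono2) (use b0 s0 in auto)
    obtain k where k: "x \<in> d k" using D_UNIV d by auto
    then have bk: "b k x > 0" using r(1)[of "c k"] by (auto simp: c b_def field_simps)
    obtain N :: nat where N: "1 / b k x < real N" using reals_Archimedean2 by blast
    have "\<phi> n x = 1" if n: "n \<ge> max N (Suc k)" for n
    proof -
      have "1 \<le> real N * b k x" using N bk by (simp add: field_simps)
      also have "\<dots> \<le> real n * (\<Sum>i<n. b i x)"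
        using n b0 by (intro mult_mono member_le_sum) auto
      finally show ?thesis by (simp add: \<phi>_def)
    qed
    then have "\<forall>\<^sub>F n in sequentially. \<phi> n x = 1"
      unfolding eventually_sequentially by blast
    then show "(\<lambda>n. \<phi> n x) \<longlonglongrightarrow> 1" by (rule tendsto_eventually)
  qed
  then show ?thesis by blast
qed

section \<open>Measurability and integrals over time windows\<close>

abbreviation lebI :: "real \<Rightarrow> real measure"
  where "lebI L \<equiv> restrict_space lborel {0..L}"

lemma space_lebI [simp]: "space (lebI L) = {0..L}"
  by (simp add: space_restrict_space)

lemma finite_measure_lebI: "finite_measure (lebI L)"
  by (rule finite_measureI) (cases "0 \<le> L"; simp add: emeasure_restrict_space)

lemma measure_lebI: "0 \<le> L \<Longrightarrow> measure (lebI L) {0..L} = L"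
  by (simp add: measure_restrict_space)

lemma tendsto_at_right_seq:
  assumes h: "continuous (at_right t) h" and "\<And>n. (s :: nat \<Rightarrow> real) n > t" "s \<longlonglongrightarrow> t"
  shows "(\<lambda>n. h (s n)) \<longlonglongrightarrow> h t"
proof -
  have "(h \<longlongrightarrow> h t) (at_right t)" using h by (simp add: continuous_within)
  moreover have "filterlim s (at_right t) sequentially"
    unfolding filterlim_at using assms by (auto intro!: always_eventually simp: less_imp_neq[symmetric])
  ultimately show ?thesis by (rule filterlim_compose)
qed

text \<open>Discretised in time, the process is measurable in the pair because only countably many
  times occur; right continuity passes this to the limit. \<open>max 0\<close> is used because
  nothing is assumed at negative times.\<close>

lemma right_continuous_measurable_pair:
  fixes Y :: "real \<Rightarrow> 'b \<Rightarrow> 'c::metric_space"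
  assumes meas: "\<And>t. 0 \<le> t \<Longrightarrow> Y t \<in> borel_measurable M"
    and rc: "\<And>t \<omega>. 0 \<le> t \<Longrightarrow> \<omega> \<in> space M \<Longrightarrow> continuous (at_right t) (\<lambda>s. Y s \<omega>)"
  shows "(\<lambda>p. Y (max 0 (fst p)) (snd p)) \<in> borel_measurable (borel \<Otimes>\<^sub>M M)"
proof (rule borel_measurable_LIMSEQ_metric)
  \<comment> \<open>Rounding down and adding 1 gives a grid point strictly to the right of the time,
    even for times on the grid, as \<open>at_right\<close> demands.\<close>
  let ?d = "\<lambda>n t. (real (nat \<lfloor>max 0 t * real (Suc n)\<rfloor>) + 1) / real (Suc n)"
  show "(\<lambda>p. Y (?d n (fst p)) (snd p)) \<in> borel_measurable (borel \<Otimes>\<^sub>M M)" for n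
  proof (rule measurable_compose_countable[where f = "\<lambda>i p. Y ((real i + 1) / real (Suc n)) (snd p)"
        and g = "\<lambda>p. nat \<lfloor>max 0 (fst p) * real (Suc n)\<rfloor>"])
    show "(\<lambda>p. Y ((real i + 1) / real (Suc n)) (snd p)) \<in> borel_measurable (borel \<Otimes>\<^sub>M M)" for i
      by (rule measurable_compose[OF measurable_snd meas]) auto
  qed measurable
  fix p :: "real \<times> 'b" assume "p \<in> space (borel \<Otimes>\<^sub>M M)"
  then have p: "snd p \<in> space M" by (auto simp: space_pair_measure)
  let ?t = "max 0 (fst p)"
  have gt: "?t < ?d n (fst p)" and le: "?d n (fst p) \<le> ?t + 1 / real (Suc n)" for n
  proof -
    have "0 \<le> \<lfloor>?t * real (Suc n)\<rfloor>" by simp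
    then have "real (nat \<lfloor>?t * real (Suc n)\<rfloor>) = of_int \<lfloor>?t * real (Suc n)\<rfloor>" by simp
    then have "?t * real (Suc n) < real (nat \<lfloor>?t * real (Suc n)\<rfloor>) + 1"
      "real (nat \<lfloor>?t * real (Suc n)\<rfloor>) \<le> ?t * real (Suc n)"
      by linarith+
    then have "(?t * real (Suc n)) / real (Suc n) < ?d n (fst p)"
      "real (nat \<lfloor>?t * real (Suc n)\<rfloor>) / real (Suc n) \<le> (?t * real (Suc n)) / real (Suc n)"
      by (intro divide_strict_right_mono divide_right_mono; simp)+
    then show "?t < ?d n (fst p)" "?d n (fst p) \<le> ?t + 1 / real (Suc n)"
      by (simp_all only: add_divide_distrib nonzero_mult_div_cancel_right of_nat_0_eq_iff Suc_not_Zero nat.distinct not_False_eq_True)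
  qed
  have "(\<lambda>n. ?d n (fst p)) \<longlonglongrightarrow> ?t"
  proof (rule tendsto_sandwich[of "\<lambda>_. ?t" _ _ "\<lambda>n. ?t + 1 / real (Suc n)"])
    show "(\<lambda>n. ?t + 1 / real (Suc n)) \<longlonglongrightarrow> ?t"
      using tendsto_add[OF tendsto_const LIMSEQ_inverse_real_of_nat, of ?t] by (simp add: inverse_eq_divide)
  qed (use gt le in \<open>auto intro: less_imp_le always_eventually\<close>)
  then show "(\<lambda>n. Y (?d n (fst p)) (snd p)) \<longlonglongrightarrow> Y ?t (snd p)"
    using rc[OF _ p, of ?t] gt by (intro tendsto_at_right_seq[where h = "\<lambda>s. Y s (snd p)"]) auto
qed

lemma right_continuous_measurable_at:
  fixes Y :: "real \<Rightarrow> 'b \<Rightarrow> 'c::metric_space"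
  assumes meas: "\<And>t. 0 \<le> t \<Longrightarrow> Y t \<in> borel_measurable M"
    and rc: "\<And>t \<omega>. 0 \<le> t \<Longrightarrow> \<omega> \<in> space M \<Longrightarrow> continuous (at_right t) (\<lambda>s. Y s \<omega>)"
    and [measurable]: "T \<in> borel_measurable N" "g \<in> measurable N M"
    and T0: "\<And>x. x \<in> space N \<Longrightarrow> 0 \<le> T x"
  shows "(\<lambda>x. Y (T x) (g x)) \<in> borel_measurable N"
proof -
  note [measurable] = right_continuous_measurable_pair[of Y M, OF meas rc]
  have "(\<lambda>x. (\<lambda>p. Y (max 0 (fst p)) (snd p)) (T x, g x)) \<in> borel_measurable N"
    by measurable
  then show ?thesis
    by (rule measurable_cong[THEN iffD1, rotated]) (use T0 in auto)
qed

text \<open>After a change of variables the integrals run over \<open>[s, L + s]\<close> and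
  \<open>[0, L]\<close>, which differ at most on \<open>[0, s]\<close> and
  \<open>[L, L + s]\<close>.\<close>

lemma shifted_integral_diff:
  fixes h :: "real \<Rightarrow> real"
  assumes h: "\<And>t. \<bar>h t\<bar> \<le> B" and [measurable]: "h \<in> borel_measurable borel"
    and s: "0 \<le> s" and L: "0 \<le> L"
  shows "\<bar>(\<integral>u. h (s + u) \<partial>lebI L) - (\<integral>u. h u \<partial>lebI L)\<bar> \<le> 2 * s * B"
proof -
  have B: "0 \<le> B" using h[of 0] by linarith
  have ind: "integrable lborel (indicator {a..b} :: real \<Rightarrow> real)" for a b :: real
    by (intro integrable_real_indicator) (auto simp: emeasure_lborel_Icc_eq)
  have int: "integrable lborel (\<lambda>u. indicator {a..b} u * h u)" for a b
  proof (rule Bochner_Integration.integrable_bound[of _ "\<lambda>u. B * indicator {a..b} u"])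
    show "AE u in lborel. norm (indicator {a..b} u * h u) \<le> norm (B * indicator {a..b} u)"
      using h B by (intro AE_I2) (auto simp: indicator_def)
  qed (use ind in auto)
  have "(\<integral>u. h (s + u) \<partial>lebI L) = (\<integral>u. indicator {0..L} u * h (s + u) \<partial>lborel)"
    by (subst integral_restrict_space) (auto simp: mult.commute)
  also have "\<dots> = (\<integral>u. indicator {s..L+s} (s + 1 * u) * h (s + 1 * u) \<partial>lborel)"
    by (intro Bochner_Integration.integral_cong) (auto simp: indicator_def)
  also have "\<dots> = (\<integral>u. indicator {s..L+s} u * h u \<partial>lborel)"
    using lborel_integral_real_affine[of 1 "\<lambda>u. indicator {s..L+s} u * h u" s] by simp
  finally have 1: "(\<integral>u. h (s + u) \<partial>lebI L) = (\<integral>u. indicator {s..L+s} u * h u \<partial>lborel)" .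
  have 2: "(\<integral>u. h u \<partial>lebI L) = (\<integral>u. indicator {0..L} u * h u \<partial>lborel)"
    by (subst integral_restrict_space) (auto simp: mult.commute)
  have "\<bar>(\<integral>u. h (s + u) \<partial>lebI L) - (\<integral>u. h u \<partial>lebI L)\<bar>
      = \<bar>\<integral>u. indicator {s..L+s} u * h u - indicator {0..L} u * h u \<partial>lborel\<bar>"
    unfolding 1 2 by (subst Bochner_Integration.integral_diff[OF int int]) simp
  also have "\<dots> \<le> (\<integral>u. B * (indicator {0..s} u + indicator {L..L+s} u) \<partial>lborel)"
  proof (rule integral_abs_bound_integral)
    show "integrable lborel (\<lambda>u. indicator {s..L+s} u * h u - indicator {0..L} u * h u)"
      using int by auto
    show "integrable lborel (\<lambda>u. B * (indicator {0..s} u + indicator {L..L+s} u))"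
      by (intro integrable_mult_right Bochner_Integration.integrable_add ind)
    show "\<bar>indicator {s..L+s} u * h u - indicator {0..L} u * h u\<bar>
        \<le> B * (indicator {0..s} u + indicator {L..L+s} u)" for u
      using h[of u] B s L by (auto simp: indicator_def)
  qed
  also have "\<dots> = B * (s + s)" using s L by simp
  finally show ?thesis by (simp add: algebra_simps)
qed

lemma integrable_bounded_finite:
  fixes h :: "'b \<Rightarrow> real"
  assumes "finite_measure N" "h \<in> borel_measurable N" "\<And>x. x \<in> space N \<Longrightarrow> \<bar>h x\<bar> \<le> C"
  shows "integrable N h"
  using assms by (intro finite_measure.integrable_const_bound[of N h C]) (auto intro: AE_I2)

lemma abs_integral_le_prob:
  fixes h :: "'b \<Rightarrow> real"
  assumes "prob_space N" "\<And>x. x \<in> space N \<Longrightarrow> \<bar>h x\<bar> \<le> C" "h \<in> borel_measurable N"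
  shows "\<bar>\<integral>x. h x \<partial>N\<bar> \<le> C"
proof -
  interpret prob_space N by fact
  have "\<bar>\<integral>x. h x \<partial>N\<bar> \<le> (\<integral>x. \<bar>h x\<bar> \<partial>N)" by (rule integral_abs_bound)
  also have "\<dots> \<le> C"
    using assms by (intro integral_le_const integrable_abs integrable_bounded_finite[of _ _ C])
      (auto intro: AE_I2 finite_measure_axioms)
  finally show ?thesis .
qed

lemma fubini_bounded:
  fixes h :: "'b \<Rightarrow> 'c \<Rightarrow> real"
  assumes "finite_measure A" "finite_measure B"
    and h: "(\<lambda>p. h (fst p) (snd p)) \<in> borel_measurable (A \<Otimes>\<^sub>M B)"
    and bound: "\<And>a b. a \<in> space A \<Longrightarrow> b \<in> space B \<Longrightarrow> \<bar>h a b\<bar> \<le> C"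
  shows "(\<integral>a. \<integral>b. h a b \<partial>B \<partial>A) = (\<integral>b. \<integral>a. h a b \<partial>A \<partial>B)"
proof -
  interpret A: finite_measure A by fact
  interpret B: finite_measure B by fact
  interpret AB: pair_sigma_finite A B ..
  interpret fin: finite_measure "A \<Otimes>\<^sub>M B" by (rule finite_measure_pair_measure) fact+
  have "integrable (A \<Otimes>\<^sub>M B) (\<lambda>p. h (fst p) (snd p))"
    using h bound by (intro integrable_bounded_finite[of _ _ C]) (auto simp: space_pair_measure fin.finite_measure_axioms)
  then show ?thesis
    by (intro AB.Fubini_integral[symmetric]) (simp add: case_prod_beta')
qed

lemma lebI_integral_abs_le:
  fixes h :: "real \<Rightarrow> real"
  assumes L: "0 \<le> L" and h: "h \<in> borel_measurable (lebI L)"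
    and B: "\<And>u. 0 \<le> u \<Longrightarrow> u \<le> L \<Longrightarrow> \<bar>h u\<bar> \<le> B"
  shows "\<bar>\<integral>u. h u \<partial>lebI L\<bar> \<le> L * B"
proof -
  have "\<bar>\<integral>u. h u \<partial>lebI L\<bar> \<le> (\<integral>u. B \<partial>lebI L)"
  proof (rule integral_abs_bound_integral)
    show "integrable (lebI L) h"
      using B by (intro integrable_bounded_finite[OF finite_measure_lebI h, of B]) auto
    show "integrable (lebI L) (\<lambda>_. B)" by (rule finite_measure.integrable_const[OF finite_measure_lebI])
  qed (use B in auto)
  also have "\<dots> = L * B" using L by (simp add: measure_lebI)
  finally show ?thesis .
qed

lemma lebI_integral_const: "0 \<le> L \<Longrightarrow> (\<integral>u. (c::real) \<partial>lebI L) = L * c"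
  by (simp add: measure_lebI)

lemma lebI_integrable_bounded:
  fixes h :: "real \<Rightarrow> real"
  assumes "h \<in> borel_measurable borel" "\<And>u. \<bar>h u\<bar> \<le> B"
  shows "integrable (lebI L) h"
  using assms by (intro integrable_bounded_finite[OF finite_measure_lebI, of _ _ B] measurable_restrict_space1) auto

lemma window_integral_le:
  fixes h :: "real \<Rightarrow> real"
  assumes [measurable]: "h \<in> borel_measurable borel" and h: "\<And>t. 0 \<le> h t" "\<And>t. h t \<le> B"
    and a: "0 \<le> a" and L: "a + L \<le> T"
  shows "(\<integral>u. h (a + u) \<partial>lebI L) \<le> (\<integral>u. h u \<partial>lebI T)"
proof -
  have ind: "integrable lborel (indicator {a..b} :: real \<Rightarrow> real)" for a b :: real
    by (intro integrable_real_indicator) (auto simp: emeasure_lborel_Icc_eq)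
  have int: "integrable lborel (\<lambda>u. indicator {a..b} u * h u)" for a b
  proof (rule Bochner_Integration.integrable_bound[of _ "\<lambda>u. B * indicator {a..b} u"])
    show "AE u in lborel. norm (indicator {a..b} u * h u) \<le> norm (B * indicator {a..b} u)"
      using h order_trans[OF h(1) h(2)] by (intro AE_I2) (auto simp: indicator_def)
  qed (use ind in auto)
  have "(\<integral>u. h (a + u) \<partial>lebI L) = (\<integral>u. indicator {0..L} u * h (a + u) \<partial>lborel)"
    by (subst integral_restrict_space) (auto simp: mult.commute)
  also have "\<dots> = (\<integral>u. indicator {a..L+a} (a + 1 * u) * h (a + 1 * u) \<partial>lborel)"
    by (intro Bochner_Integration.integral_cong) (auto simp: indicator_def)
  also have "\<dots> = (\<integral>u. indicator {a..L+a} u * h u \<partial>lborel)"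
    using lborel_integral_real_affine[of 1 "\<lambda>u. indicator {a..L+a} u * h u" a] by simp
  also have "\<dots> \<le> (\<integral>u. indicator {0..T} u * h u \<partial>lborel)"
    using a L h by (intro integral_mono int) (auto simp: indicator_def)
  also have "\<dots> = (\<integral>u. h u \<partial>lebI T)"
    by (subst integral_restrict_space) (auto simp: mult.commute)
  finally show ?thesis .
qed

text \<open>One of the two summands alone already dominates. This converts second-moment bounds into
  first-moment bounds.\<close>

lemma abs_le_plus_square: "0 < e \<Longrightarrow> \<bar>t\<bar> \<le> e + t\<^sup>2 / (e :: real)"
proof (cases "\<bar>t\<bar> \<le> e")
  case False
  assume e: "0 < e"
  then have "\<bar>t\<bar> * e \<le> \<bar>t\<bar> * \<bar>t\<bar>" using False by (intro mult_left_mono) auto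
  then have "\<bar>t\<bar> \<le> t\<^sup>2 / e" using e by (simp add: pos_le_divide_eq power2_eq_square)
  then show ?thesis using e by linarith
qed (simp add: add_increasing2)

text \<open>The graph of \<open>exp\<close> lies above its tangent at \<open>a\<close>.\<close>

lemma exp_diff_le: "exp a - exp b \<le> exp a * (a - b)" for a b :: real
proof -
  have "exp a * (1 + (b - a)) \<le> exp a * exp (b - a)" by (intro mult_left_mono exp_ge_add_one_self) auto
  then show ?thesis by (simp add: algebra_simps flip: exp_add)
qed

lemma bcontfun_exp:
  fixes G :: "'x::topological_space \<Rightarrow> real"
  assumes "G \<in> bcontfun" "\<And>y. G y \<le> B"
  shows "(\<lambda>y. exp (G y)) \<in> bcontfun"
proof (rule bcontfun_boundI[of _ "exp B"])
  show "continuous_on UNIV (\<lambda>y. exp (G y))"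
    by (rule continuous_on_exp[OF bcontfun_continuous[OF assms(1)]])
qed (use assms(2) in simp)

section \<open>Feller processes at stopping times\<close>

locale feller_process = standard_markov_process P F X + cutoff \<phi>
  for P :: "'e::{metric_space, second_countable_topology} \<Rightarrow> 'a measure"
    and F :: "'e \<Rightarrow> real \<Rightarrow> 'a measure"
    and X :: "real \<Rightarrow> 'a \<Rightarrow> 'e"
    and \<phi> :: "nat \<Rightarrow> 'e \<Rightarrow> real" +
  assumes feller: "C0_feller P X"
begin

abbreviation "st x \<equiv> stopping_times (P x) (F x)"
abbreviation "Q \<equiv> transition P X"

lemma prob: "prob_space (P x)"
  using usual_conditions[of x] by (simp add: usual_filtered_prob_space_def)

lemma fin: "finite_measure (P x)"
  using prob prob_space.finite_measure by blast

lemma filt: "filtration (space (P x)) (F x)"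
  using usual_conditions[of x] by (simp add: usual_filtered_prob_space_def)

lemmas space_F = filtration.space_F[OF filt]

lemma sets_F: "sets (F x t) \<subseteq> sets (P x)"
proof -
  \<comment> \<open>The inclusion in \<open>sets (P x)\<close> is assumed only for nonnegative
    times; earlier ones are dominated by time 0.\<close>
  have "sets (F x t) \<subseteq> sets (F x (max 0 t))" by (rule filtration.sets_F_mono[OF filt]) simp
  also have "\<dots> \<subseteq> sets (P x)"
    by (rule usual_filtered_prob_space.sets_F_subset[OF usual_conditions]) simp
  finally show ?thesis .
qed

lemma X_measurable: "0 \<le> t \<Longrightarrow> X t \<in> borel_measurable (P x)"
  by (rule measurable_mono[THEN subsetD, OF order_refl refl sets_F _ adapted]) (auto simp: space_F)

lemma st_stopping: "\<tau> \<in> st x \<Longrightarrow> stopping_time (F x) \<tau>"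
  and st_nonneg: "\<tau> \<in> st x \<Longrightarrow> \<omega> \<in> space (P x) \<Longrightarrow> 0 \<le> \<tau> \<omega>"
  by (auto simp: stopping_times_def)

lemma st_measurable: "\<tau> \<in> st x \<Longrightarrow> \<tau> \<in> borel_measurable (P x)"
  by (rule measurable_stopping_time[OF st_stopping]) (auto simp: sets_F[THEN subsetD] space_F)

lemma st_const: "0 \<le> c \<Longrightarrow> (\<lambda>_. c) \<in> st x"
  by (auto simp: stopping_times_def stopping_time_const)

lemma st_min_const: "\<tau> \<in> st x \<Longrightarrow> 0 \<le> c \<Longrightarrow> (\<lambda>\<omega>. min (\<tau> \<omega>) c) \<in> st x"
  by (auto simp: stopping_times_def stopping_time_const intro!: stopping_time_min)

lemma st_add_const:
  assumes "\<tau> \<in> st x" "0 \<le> c"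
  shows "(\<lambda>\<omega>. \<tau> \<omega> + c) \<in> st x"
proof -
  have "Measurable.pred (F x t) (\<lambda>\<omega>. \<tau> \<omega> + c \<le> t)" for t
    using filtration.stopping_time_le_const[OF filt st_stopping[OF assms(1)], of "t - c" t] assms(2)
    by (simp add: le_diff_eq)
  then show ?thesis using assms by (auto simp: stopping_times_def stopping_time_def)
qed

lemma X_at_measurable:
  assumes "T \<in> borel_measurable N" "g \<in> measurable N (P x)" "\<And>y. y \<in> space N \<Longrightarrow> 0 \<le> T y"
  shows "(\<lambda>y. X (T y) (g y)) \<in> borel_measurable N"
  by (rule right_continuous_measurable_at[of X "P x" T N g, OF X_measurable right_continuous assms])

lemma X_st_measurable:
  assumes "\<tau> \<in> st x" shows "(\<lambda>\<omega>. X (\<tau> \<omega>) \<omega>) \<in> borel_measurable (P x)"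
  using X_at_measurable[OF st_measurable[OF assms], of "\<lambda>\<omega>. \<omega>" x] st_nonneg[OF assms] by simp

lemma fX_st_measurable:
  assumes "\<tau> \<in> st x" "f \<in> bcontfun"
  shows "(\<lambda>\<omega>. f (X (\<tau> \<omega>) \<omega>)) \<in> borel_measurable (P x)"
  by (rule measurable_compose[OF X_st_measurable[OF assms(1)] bcontfun_measurable[OF assms(2)]])

lemma fX_st_integrable:
  fixes f :: "'e \<Rightarrow> real"
  assumes "\<tau> \<in> st x" "f \<in> bcontfun"
  shows "integrable (P x) (\<lambda>\<omega>. f (X (\<tau> \<omega>) \<omega>))"
proof -
  obtain B where "\<And>y. \<bar>f y\<bar> \<le> B" using bcontfun_bound[OF assms(2)] by metis
  then show ?thesis by (intro integrable_bounded_finite[OF fin fX_st_measurable[OF assms]]) auto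
qed

lemma fX_measurable: "0 \<le> t \<Longrightarrow> f \<in> bcontfun \<Longrightarrow> (\<lambda>\<omega>. f (X t \<omega>)) \<in> borel_measurable (P x)"
  using fX_st_measurable[of "\<lambda>_. t" x f, OF st_const] by simp

lemma fX_integrable: "0 \<le> t \<Longrightarrow> (f :: 'e \<Rightarrow> real) \<in> bcontfun \<Longrightarrow> integrable (P x) (\<lambda>\<omega>. f (X t \<omega>))"
  using fX_st_integrable[of "\<lambda>_. t" x f, OF st_const] by simp

section \<open>The transition operators on bounded continuous functions\<close>

lemma Q_bound: "0 \<le> t \<Longrightarrow> f \<in> bcontfun \<Longrightarrow> (\<And>y. \<bar>f y\<bar> \<le> B) \<Longrightarrow> \<bar>Q t f z\<bar> \<le> B"
  unfolding transition_def by (intro abs_integral_le_prob prob fX_measurable) auto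

lemma Q_diff: "0 \<le> t \<Longrightarrow> f \<in> bcontfun \<Longrightarrow> h \<in> bcontfun \<Longrightarrow>
    Q t (\<lambda>y. f y - h y) z = Q t f z - Q t h z"
  unfolding transition_def by (intro Bochner_Integration.integral_diff fX_integrable)

lemma Q_add: "0 \<le> t \<Longrightarrow> f \<in> bcontfun \<Longrightarrow> h \<in> bcontfun \<Longrightarrow>
    Q t (\<lambda>y. f y + h y) z = Q t f z + Q t h z"
  unfolding transition_def by (intro Bochner_Integration.integral_add fX_integrable)

lemma Q_cmult: "Q t (\<lambda>y. c * f y) z = c * Q t f z"
  unfolding transition_def by (rule integral_mult_right_zero)

lemma Q_const: "Q t (\<lambda>y. c) z = c"
  unfolding transition_def using prob_space.prob_space[OF prob[of z]] by simp

lemma Q_mono: "0 \<le> t \<Longrightarrow> f \<in> bcontfun \<Longrightarrow> h \<in> bcontfun \<Longrightarrow> (\<And>y. f y \<le> h y) \<Longrightarrow> Q t f z \<le> Q t h z"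
  unfolding transition_def by (intro integral_mono fX_integrable) auto

lemma Q_0: assumes f: "f \<in> bcontfun" shows "Q 0 f z = f z"
proof -
  have "(\<integral>\<omega>. f (X 0 \<omega>) \<partial>P z) = (\<integral>\<omega>. f z \<partial>P z)"
  proof (rule integral_cong_AE)
    show "AE \<omega> in P z. f (X 0 \<omega>) = f z" using start[of z] by eventually_elim simp
  qed (simp_all add: fX_measurable[OF order_refl f])
  then show ?thesis using Q_const[of 0 "f z" z] by (simp add: transition_def)
qed

lemma Q_C0: "0 \<le> t \<Longrightarrow> f \<in> C0 \<Longrightarrow> Q t f \<in> C0"
  using feller by (simp add: C0_feller_def)

lemma Q_tendsto:
  assumes t: "0 \<le> t" and f: "\<And>n. f n \<in> bcontfun" "\<And>n y. \<bar>f n y\<bar> \<le> B" and h: "h \<in> bcontfun"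
    and lim: "\<And>y. (\<lambda>n. f n y) \<longlonglongrightarrow> h y"
  shows "(\<lambda>n. Q t (f n) z) \<longlonglongrightarrow> Q t h z"
  unfolding transition_def
proof (rule integral_dominated_convergence[where w = "\<lambda>_. B"])
  show "integrable (P z) (\<lambda>_. B)" by (rule finite_measure.integrable_const[OF fin])
  show "AE \<omega> in P z. (\<lambda>n. f n (X t \<omega>)) \<longlonglongrightarrow> h (X t \<omega>)" by (intro AE_I2 lim)
qed (simp_all add: fX_measurable t f h)

text \<open>The Feller property covers \<open>\<phi> n * f\<close> only. The remainder is at most
  \<open>B * (1 - Q t (\<phi> n))\<close>, which is small at \<open>z\<close> for large
  \<open>n\<close>, and stays small near \<open>z\<close> because \<open>Q t (\<phi> n)\<close> is
  itself continuous.\<close>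

lemma Q_continuous:
  assumes t: "0 \<le> t" and f: "f \<in> bcontfun"
  shows "continuous_on UNIV (Q t f)"
proof (intro continuous_at_imp_continuous_on ballI)
  fix z
  obtain B where B: "B > 0" "\<And>y. \<bar>f y\<bar> \<le> B" using bcontfun_bound[OF f] by metis
  have \<phi>b: "\<phi> n \<in> bcontfun" for n by (rule C0_bcontfun[OF cutoff_C0])
  have f\<phi>: "(\<lambda>y. \<phi> n y * f y) \<in> C0" for n by (rule C0_times[OF cutoff_C0 f])
  have close: "\<bar>Q t f y - Q t (\<lambda>y. \<phi> n y * f y) y\<bar> \<le> B * (1 - Q t (\<phi> n) y)" for n y
  proof -
    have b1: "(\<lambda>y. f y - \<phi> n y * f y) \<in> bcontfun"
      by (intro minus_cont f C0_bcontfun f\<phi>)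
    have b2: "(\<lambda>y. B * (1 - \<phi> n y)) \<in> bcontfun"
      by (intro bcontfun_times minus_cont \<phi>b const_bcontfun)
    have b3: "(\<lambda>y. - (B * (1 - \<phi> n y))) \<in> bcontfun" by (rule uminus_cont[OF b2])
    have le: "- (B * (1 - \<phi> n y)) \<le> f y - \<phi> n y * f y \<and> f y - \<phi> n y * f y \<le> B * (1 - \<phi> n y)" for y
    proof -
      have "f y - \<phi> n y * f y = f y * (1 - \<phi> n y)" by (simp add: algebra_simps)
      then have "\<bar>f y - \<phi> n y * f y\<bar> \<le> B * (1 - \<phi> n y)"
        using B(2)[of y] cutoff_le_1[of n y] by (simp add: abs_mult mult_right_mono)
      then show ?thesis by linarith
    qed
    have eq: "Q t (\<lambda>y. B * (1 - \<phi> n y)) y = B * (1 - Q t (\<phi> n) y)"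
      by (subst Q_cmult, subst Q_diff[OF t const_bcontfun \<phi>b]) (simp add: Q_const)
    have "Q t (\<lambda>y. f y - \<phi> n y * f y) y \<le> Q t (\<lambda>y. B * (1 - \<phi> n y)) y"
      using le by (intro Q_mono t b1 b2) auto
    moreover have "Q t (\<lambda>y. - (B * (1 - \<phi> n y))) y \<le> Q t (\<lambda>y. f y - \<phi> n y * f y) y"
      using le by (intro Q_mono t b1 b3) auto
    moreover have "Q t (\<lambda>y. - (B * (1 - \<phi> n y))) y = - Q t (\<lambda>y. B * (1 - \<phi> n y)) y"
      using Q_cmult[of t "-1" "\<lambda>y. B * (1 - \<phi> n y)" y] by simp
    ultimately show ?thesis
      using eq Q_diff[OF t f C0_bcontfun[OF f\<phi>], of n y] by (simp add: abs_le_iff)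
  qed
  have "(\<lambda>n. Q t (\<phi> n) z) \<longlonglongrightarrow> Q t (\<lambda>_. 1) z"
    using cutoff_le_1 cutoff_nonneg
    by (intro Q_tendsto[OF t, where B = 1] \<phi>b const_bcontfun cutoff_lim) (auto simp: abs_le_iff intro: order_trans[of _ 0])
  then have lim: "(\<lambda>n. Q t (\<phi> n) z) \<longlonglongrightarrow> 1" by (simp add: Q_const)
  show "isCont (Q t f) z"
    unfolding isCont_def tendsto_iff
  proof (intro allI impI)
    fix e :: real assume e: "0 < e"
    have "\<forall>\<^sub>F n in sequentially. 1 - e / (4 * B) < Q t (\<phi> n) z"
      using e B(1) by (intro order_tendstoD(1)[OF lim]) auto
    then obtain n where n: "1 - e / (4 * B) < Q t (\<phi> n) z" by (auto simp: eventually_sequentially)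
    have c1: "isCont (Q t (\<phi> n)) z" and c2: "isCont (Q t (\<lambda>y. \<phi> n y * f y)) z"
      using bcontfun_continuous[OF C0_bcontfun[OF Q_C0[OF t]]] cutoff_C0 f\<phi>
      by (auto simp: continuous_on_eq_continuous_at)
    have "\<forall>\<^sub>F y in at z. 1 - e / (4 * B) < Q t (\<phi> n) y"
      using c1 n by (intro order_tendstoD(1)) (auto simp: isCont_def)
    moreover have "\<forall>\<^sub>F y in at z. dist (Q t (\<lambda>y. \<phi> n y * f y) y) (Q t (\<lambda>y. \<phi> n y * f y) z) < e / 2"
      using c2 e by (intro tendstoD) (auto simp: isCont_def)
    ultimately show "\<forall>\<^sub>F y in at z. dist (Q t f y) (Q t f z) < e"
    proof eventually_elim
      case (elim y)
      have small: "B * (1 - q) < e / 4" if "1 - e / (4 * B) < q" for q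
        using that B(1) by (simp add: field_simps)
      have "\<bar>Q t f y - Q t (\<lambda>y. \<phi> n y * f y) y\<bar> < e / 4" "\<bar>Q t f z - Q t (\<lambda>y. \<phi> n y * f y) z\<bar> < e / 4"
        using close[of y n] close[of z n] small[OF elim(1)] small[OF n] by linarith+
      then show ?case using elim(2) unfolding dist_real_def by linarith
    qed
  qed
qed

lemma Q_bcontfun:
  assumes "0 \<le> t" "f \<in> bcontfun" shows "Q t f \<in> bcontfun"
proof -
  obtain B where "\<And>y. \<bar>f y\<bar> \<le> B" using bcontfun_bound[OF assms(2)] by metis
  then show ?thesis using Q_bound[OF assms, of B] Q_continuous[OF assms] by (intro bcontfun_boundI[of _ B]) auto
qed

lemma Q_right_continuous:
  assumes t: "0 \<le> t" and f: "f \<in> bcontfun"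
  shows "continuous (at_right t) (\<lambda>s. Q s f z)"
proof -
  obtain B where B: "\<And>y. \<bar>f y\<bar> \<le> B" using bcontfun_bound[OF f] by metis
  have "((\<lambda>s. Q s f z) \<longlongrightarrow> Q t f z) (at t within {t<..})"
    unfolding tendsto_at_iff_sequentially comp_def
  proof (intro allI impI)
    fix s :: "nat \<Rightarrow> real" assume s: "\<forall>i. s i \<in> {t<..} - {t}" "s \<longlonglongrightarrow> t"
    show "(\<lambda>n. Q (s n) f z) \<longlonglongrightarrow> Q t f z"
      unfolding transition_def
    proof (rule integral_dominated_convergence[where w = "\<lambda>_. B"])
      show "integrable (P z) (\<lambda>_. B)" by (rule finite_measure.integrable_const[OF fin])
      show "AE \<omega> in P z. (\<lambda>n. f (X (s n) \<omega>)) \<longlonglongrightarrow> f (X t \<omega>)"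
      proof (intro AE_I2)
        fix \<omega> assume \<omega>: "\<omega> \<in> space (P z)"
        have "isCont f (X t \<omega>)"
          using bcontfun_continuous[OF f] by (simp add: continuous_on_eq_continuous_at)
        moreover have "(\<lambda>n. X (s n) \<omega>) \<longlonglongrightarrow> X t \<omega>"
          using s by (intro tendsto_at_right_seq[OF right_continuous[OF \<omega> t]]) auto
        ultimately show "(\<lambda>n. f (X (s n) \<omega>)) \<longlonglongrightarrow> f (X t \<omega>)" by (rule isCont_tendsto_compose)
      qed
      have "0 \<le> s n" for n using s t by (metis DiffD1 greaterThan_iff less_imp_le order_trans)
      then show "(\<lambda>\<omega>. f (X (s n) \<omega>)) \<in> borel_measurable (P z)" for n
        by (intro fX_measurable f)
    qed (simp_all add: fX_measurable t f B)
  qed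
  then show ?thesis by (simp add: continuous_within)
qed

text \<open>\<open>Q t f\<close> is measurable in space and right continuous in \<open>t\<close>, so
  the measurability result for processes applies with the state space in the role of the sample
  space.\<close>

lemma Q_measurable:
  assumes "f \<in> bcontfun" "T \<in> borel_measurable N" "g \<in> borel_measurable N" "\<And>y. y \<in> space N \<Longrightarrow> 0 \<le> T y"
  shows "(\<lambda>y. Q (T y) f (g y)) \<in> borel_measurable N"
  by (rule right_continuous_measurable_at[of "\<lambda>t. Q t f" borel T N g,
      OF bcontfun_measurable[OF Q_bcontfun[OF _ assms(1)]] Q_right_continuous[OF _ assms(1)] assms(2-4)])

section \<open>The strong Markov property in integrated form\<close>

lemma pre_sigma_subalgebra:
  assumes "\<tau> \<in> st x"
  shows "finite_measure_subalgebra (P x) (filtration.pre_sigma (space (P x)) (F x) \<tau>)"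
proof -
  interpret filtration "space (P x)" "F x" by (rule filt)
  have "subalgebra (P x) (pre_sigma \<tau>)"
    unfolding subalgebra_def
  proof (intro conjI subsetI)
    fix A assume A: "A \<in> sets (pre_sigma \<tau>)"
    \<comment> \<open>An event of the \<open>\<sigma>\<close>-field of \<open>\<tau>\<close> is
      directly known to be measurable only where \<open>\<tau>\<close> is bounded; since
      \<open>\<tau>\<close> is finite, these pieces exhaust it.\<close>
    have "{\<omega>\<in>A. \<tau> \<omega> \<le> real n} \<in> sets (P x)" for n
      using sets_pre_sigmaD[OF st_stopping[OF assms] A] sets_F by blast
    then have "(\<Union>n. {\<omega>\<in>A. \<tau> \<omega> \<le> real n}) \<in> sets (P x)" by blast
    also have "(\<Union>n. {\<omega>\<in>A. \<tau> \<omega> \<le> real n}) = A" using real_arch_simple by auto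
    finally show "A \<in> sets (P x)" .
  qed (simp add: space_pre_sigma)
  then show ?thesis
    by (intro finite_measure_subalgebra.intro fin finite_measure_subalgebra_axioms.intro)
qed

text \<open>
  The strong Markov property at \<open>s = 0\<close> says that \<open>h (X \<tau>)\<close> agrees almost everywhere with a
  function measurable with respect to the \<open>\<sigma>\<close>-field of \<open>\<tau>\<close>, so no progressive measurability is needed.
\<close>

lemma strong_markov_product:
  assumes \<tau>: "\<tau> \<in> st x" and s: "0 \<le> s" and f: "f \<in> bcontfun" and h: "h \<in> bcontfun"
  shows "(\<integral>\<omega>. h (X (\<tau> \<omega>) \<omega>) * f (X (\<tau> \<omega> + s) \<omega>) \<partial>P x) = (\<integral>\<omega>. h (X (\<tau> \<omega>) \<omega>) * Q s f (X (\<tau> \<omega>) \<omega>) \<partial>P x)"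
proof -
  define G where "G = filtration.pre_sigma (space (P x)) (F x) \<tau>"
  interpret finite_measure_subalgebra "P x" G unfolding G_def by (rule pre_sigma_subalgebra[OF \<tau>])
  let ?c = "real_cond_exp (P x) G"
  let ?h = "\<lambda>\<omega>. h (X (\<tau> \<omega>) \<omega>)" and ?f = "\<lambda>\<omega>. f (X (\<tau> \<omega> + s) \<omega>)"
  have mh: "?h \<in> borel_measurable (P x)" by (rule fX_st_measurable[OF \<tau> h])
  have mf: "?f \<in> borel_measurable (P x)" by (rule fX_st_measurable[OF st_add_const[OF \<tau> s] f])
  have mQ: "(\<lambda>\<omega>. Q s f (X (\<tau> \<omega>) \<omega>)) \<in> borel_measurable (P x)"
    by (rule fX_st_measurable[OF \<tau> Q_bcontfun[OF s f]])
  have mc: "?c k \<in> borel_measurable G" "?c k \<in> borel_measurable (P x)" for k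
    by (rule borel_measurable_cond_exp borel_measurable_cond_exp2)+
  have ch: "AE \<omega> in P x. ?c ?h \<omega> = ?h \<omega>"
    using strong_markov[OF \<tau> order_refl bcontfun_measurable[OF h] bcontfun_bounded[OF h]]
    by (simp add: G_def Q_0[OF h])
  have cf: "AE \<omega> in P x. ?c ?f \<omega> = Q s f (X (\<tau> \<omega>) \<omega>)"
    using strong_markov[OF \<tau> s bcontfun_measurable[OF f] bcontfun_bounded[OF f]]
    by (simp add: G_def)
  obtain A where A: "\<And>y. \<bar>f y\<bar> \<le> A" using bcontfun_bound[OF f] by metis
  obtain B where B: "B > 0" "\<And>y. \<bar>h y\<bar> \<le> B" using bcontfun_bound[OF h] by metis
  have "integrable (P x) (\<lambda>\<omega>. ?h \<omega> * ?f \<omega>)"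
  proof (rule integrable_bounded_finite[OF fin, where C = "B * A"])
    show "\<bar>?h \<omega> * ?f \<omega>\<bar> \<le> B * A" for \<omega>
      unfolding abs_mult using A B by (intro mult_mono) (auto intro: less_imp_le)
  qed (intro borel_measurable_times mh mf)
  moreover have "AE \<omega> in P x. ?h \<omega> * ?f \<omega> = ?c ?h \<omega> * ?f \<omega>" using ch by eventually_elim simp
  ultimately have int: "integrable (P x) (\<lambda>\<omega>. ?c ?h \<omega> * ?f \<omega>)"
    by (rule integrable_cong_AE_imp[OF _ borel_measurable_times[OF mc(2) mf]])
  have "(\<integral>\<omega>. ?h \<omega> * ?f \<omega> \<partial>P x) = (\<integral>\<omega>. ?c ?h \<omega> * ?f \<omega> \<partial>P x)"
  proof (rule integral_cong_AE)
    show "AE \<omega> in P x. ?h \<omega> * ?f \<omega> = ?c ?h \<omega> * ?f \<omega>" using ch by eventually_elim simp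
  qed (intro borel_measurable_times mh mf mc)+
  also have "\<dots> = (\<integral>\<omega>. ?c ?h \<omega> * ?c ?f \<omega> \<partial>P x)"
    by (rule real_cond_exp_intg(2)[symmetric, OF int mc(1) mf])
  also have "\<dots> = (\<integral>\<omega>. ?h \<omega> * Q s f (X (\<tau> \<omega>) \<omega>) \<partial>P x)"
  proof (rule integral_cong_AE)
    show "AE \<omega> in P x. ?c ?h \<omega> * ?c ?f \<omega> = ?h \<omega> * Q s f (X (\<tau> \<omega>) \<omega>)"
      using ch cf by eventually_elim simp
  qed (intro borel_measurable_times mh mQ mc)+
  finally show ?thesis .
qed

lemma strong_markov_expectation:
  assumes "\<tau> \<in> st x" "0 \<le> s" "f \<in> bcontfun"
  shows "(\<integral>\<omega>. f (X (\<tau> \<omega> + s) \<omega>) \<partial>P x) = (\<integral>\<omega>. Q s f (X (\<tau> \<omega>) \<omega>) \<partial>P x)"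
  using strong_markov_product[OF assms, of "\<lambda>_. 1"] by (simp add: const_bcontfun)

text \<open>After expanding the square, the strong Markov property leaves
  \<open>Q s (f\<^sup>2) - f\<^sup>2 - 2 * f * (Q s f - f)\<close> at the stopped process. Only sup
  bounds enter, so the estimate is the same for all \<open>x\<close> and
  \<open>\<tau>\<close>.\<close>

lemma squared_increment:
  assumes \<tau>: "\<tau> \<in> st x" and s: "0 \<le> s" and f: "f \<in> bcontfun" and B: "\<And>y. \<bar>f y\<bar> \<le> B"
    and a: "\<And>y. \<bar>Q s (\<lambda>y. f y * f y) y - f y * f y\<bar> \<le> a" and b: "\<And>y. \<bar>Q s f y - f y\<bar> \<le> b"
  shows "(\<integral>\<omega>. (f (X (\<tau> \<omega> + s) \<omega>) - f (X (\<tau> \<omega>) \<omega>))\<^sup>2 \<partial>P x) \<le> a + 2 * B * b"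
proof -
  let ?Y = "\<lambda>\<omega>. X (\<tau> \<omega>) \<omega>" and ?Z = "\<lambda>\<omega>. X (\<tau> \<omega> + s) \<omega>"
  have ff: "(\<lambda>y. f y * f y) \<in> bcontfun" by (rule bcontfun_times[OF f f])
  have fQ: "(\<lambda>y. f y * Q s f y) \<in> bcontfun" by (rule bcontfun_times[OF f Q_bcontfun[OF s f]])
  note i = fX_st_integrable[OF \<tau>] fX_st_integrable[OF st_add_const[OF \<tau> s]]
  have i1: "integrable (P x) (\<lambda>\<omega>. f (?Y \<omega>) * f (?Z \<omega>))"
  proof (rule integrable_bounded_finite[OF fin, where C = "B * B"])
    show "\<bar>f (?Y \<omega>) * f (?Z \<omega>)\<bar> \<le> B * B" for \<omega>
      unfolding abs_mult using B order_trans[OF abs_ge_zero B] by (intro mult_mono) auto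
    show "(\<lambda>\<omega>. f (?Y \<omega>) * f (?Z \<omega>)) \<in> borel_measurable (P x)"
      by (intro borel_measurable_times fX_st_measurable \<tau> f st_add_const[OF \<tau> s])
  qed
  have "(\<integral>\<omega>. (f (?Z \<omega>) - f (?Y \<omega>))\<^sup>2 \<partial>P x)
      = (\<integral>\<omega>. f (?Z \<omega>) * f (?Z \<omega>) - 2 * (f (?Y \<omega>) * f (?Z \<omega>)) + f (?Y \<omega>) * f (?Y \<omega>) \<partial>P x)"
    by (intro Bochner_Integration.integral_cong) (auto simp: power2_eq_square algebra_simps)
  also have "\<dots> = (\<integral>\<omega>. f (?Z \<omega>) * f (?Z \<omega>) \<partial>P x) - 2 * (\<integral>\<omega>. f (?Y \<omega>) * f (?Z \<omega>) \<partial>P x)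
      + (\<integral>\<omega>. f (?Y \<omega>) * f (?Y \<omega>) \<partial>P x)"
    using i(1)[OF ff] i(2)[OF ff] i1 by simp
  also have "\<dots> = (\<integral>\<omega>. Q s (\<lambda>y. f y * f y) (?Y \<omega>) \<partial>P x) - 2 * (\<integral>\<omega>. f (?Y \<omega>) * Q s f (?Y \<omega>) \<partial>P x)
      + (\<integral>\<omega>. f (?Y \<omega>) * f (?Y \<omega>) \<partial>P x)"
    using strong_markov_expectation[OF \<tau> s ff] strong_markov_product[OF \<tau> s f f] by simp
  also have "\<dots> = (\<integral>\<omega>. Q s (\<lambda>y. f y * f y) (?Y \<omega>) - 2 * (f (?Y \<omega>) * Q s f (?Y \<omega>)) + f (?Y \<omega>) * f (?Y \<omega>) \<partial>P x)"
    using i(1)[OF ff] i(1)[OF Q_bcontfun[OF s ff]] i(1)[OF fQ] by simp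
  also have "\<dots> \<le> a + 2 * B * b"
  proof (rule prob_space.integral_le_const[OF prob])
    show "integrable (P x) (\<lambda>\<omega>. Q s (\<lambda>y. f y * f y) (?Y \<omega>) - 2 * (f (?Y \<omega>) * Q s f (?Y \<omega>)) + f (?Y \<omega>) * f (?Y \<omega>))"
      using i(1)[OF ff] i(1)[OF Q_bcontfun[OF s ff]] i(1)[OF fQ] by simp
    have "Q s (\<lambda>y. f y * f y) y - 2 * (f y * Q s f y) + f y * f y \<le> a + 2 * B * b" for y
    proof -
      have "\<bar>f y * (Q s f y - f y)\<bar> \<le> B * b"
        unfolding abs_mult using B[of y] b[of y] by (intro mult_mono) auto
      moreover have "Q s (\<lambda>y. f y * f y) y - 2 * (f y * Q s f y) + f y * f y
          = (Q s (\<lambda>y. f y * f y) y - f y * f y) - 2 * (f y * (Q s f y - f y))" by (simp add: algebra_simps)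
      ultimately show ?thesis using a[of y] by linarith
    qed
    then show "AE \<omega> in P x. Q s (\<lambda>y. f y * f y) (?Y \<omega>) - 2 * (f (?Y \<omega>) * Q s f (?Y \<omega>)) + f (?Y \<omega>) * f (?Y \<omega>) \<le> a + 2 * B * b"
      by (intro AE_I2)
  qed
  finally show ?thesis .
qed

section \<open>Strong continuity of the semigroup\<close>

text \<open>The integrated semigroup. It is also the expected integral of \<open>f\<close> along the
  path up to time \<open>L\<close> (\<open>U_path\<close>), which makes it comparable for different
  stopping times.\<close>

definition U :: "real \<Rightarrow> ('e \<Rightarrow> real) \<Rightarrow> 'e \<Rightarrow> real"
  where "U L f z = (\<integral>u. Q u f z \<partial>lebI L)"

lemma Q_measurable_lebI: "f \<in> bcontfun \<Longrightarrow> (\<lambda>u. Q u f z) \<in> borel_measurable (lebI L)"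
  by (rule Q_measurable) (auto intro: measurable_restrict_space1)

lemma Q_integrable_lebI:
  assumes "f \<in> bcontfun" shows "integrable (lebI L) (\<lambda>u. Q u f z)"
proof -
  obtain B where "\<And>y. \<bar>f y\<bar> \<le> B" using bcontfun_bound[OF assms] by metis
  then show ?thesis using assms
    by (intro integrable_bounded_finite[OF finite_measure_lebI Q_measurable_lebI, where C = B]) (auto intro: Q_bound)
qed

lemma U_bound:
  assumes "0 \<le> L" "f \<in> bcontfun" "\<And>y. \<bar>f y\<bar> \<le> B"
  shows "\<bar>U L f z\<bar> \<le> L * B"
  unfolding U_def using assms by (intro lebI_integral_abs_le Q_measurable_lebI Q_bound) auto

lemma U_diff:
  assumes "f \<in> bcontfun" "h \<in> bcontfun"
  shows "U L (\<lambda>y. f y - h y) z = U L f z - U L h z"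
proof -
  have "U L (\<lambda>y. f y - h y) z = (\<integral>u. Q u f z - Q u h z \<partial>lebI L)"
    unfolding U_def using assms by (intro Bochner_Integration.integral_cong) (auto simp: Q_diff)
  also have "\<dots> = U L f z - U L h z"
    unfolding U_def using assms by (intro Bochner_Integration.integral_diff Q_integrable_lebI)
  finally show ?thesis .
qed

lemma U_const: "0 \<le> L \<Longrightarrow> U L (\<lambda>_. c) z = L * c"
  unfolding U_def by (simp add: Q_const measure_lebI)

lemma U_mono:
  assumes "f \<in> bcontfun" "h \<in> bcontfun" "\<And>y. f y \<le> h y"
  shows "U L f z \<le> U L h z"
  unfolding U_def using assms by (intro integral_mono Q_integrable_lebI Q_mono) auto

lemma U_tendsto:
  assumes f: "\<And>n. f n \<in> bcontfun" "\<And>n y. \<bar>f n y\<bar> \<le> B" and h: "h \<in> bcontfun"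
    and lim: "\<And>y. (\<lambda>n. f n y) \<longlonglongrightarrow> h y"
  shows "(\<lambda>n. U L (f n) z) \<longlonglongrightarrow> U L h z"
  unfolding U_def
proof (rule integral_dominated_convergence[where w = "\<lambda>_. B"])
  show "AE u in lebI L. (\<lambda>n. Q u (f n) z) \<longlonglongrightarrow> Q u h z"
    using Q_tendsto[OF _ f h lim] by (intro AE_I2) auto
  show "AE u in lebI L. norm (Q u (f n) z) \<le> B" for n
    using Q_bound[OF _ f] by (intro AE_I2) auto
qed (simp_all add: Q_measurable_lebI f h finite_measure.integrable_const[OF finite_measure_lebI])

lemma U_continuous:
  assumes f: "f \<in> bcontfun"
  shows "continuous_on UNIV (U L f)"
proof (rule continuous_on_sequentiallyI)
  fix s :: "nat \<Rightarrow> 'e" and z assume s: "s \<longlonglongrightarrow> z"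
  obtain B where B: "\<And>y. \<bar>f y\<bar> \<le> B" using bcontfun_bound[OF f] by metis
  show "(\<lambda>n. U L f (s n)) \<longlonglongrightarrow> U L f z"
    unfolding U_def
  proof (rule integral_dominated_convergence[where w = "\<lambda>_. B"])
    have "(\<lambda>n. Q u f (s n)) \<longlonglongrightarrow> Q u f z" if "0 \<le> u" for u
      using continuous_on_tendsto_compose[OF Q_continuous[OF that f] s] by simp
    then show "AE u in lebI L. (\<lambda>n. Q u f (s n)) \<longlonglongrightarrow> Q u f z" by (intro AE_I2) auto
    show "AE u in lebI L. norm (Q u f (s n)) \<le> B" for n
      using Q_bound[OF _ f B] by (intro AE_I2) auto
  qed (simp_all add: Q_measurable_lebI f finite_measure.integrable_const[OF finite_measure_lebI])
qed

lemma U_bcontfun: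
  assumes "0 \<le> L" "f \<in> bcontfun" shows "U L f \<in> bcontfun"
proof -
  obtain B where "\<And>y. \<bar>f y\<bar> \<le> B" using bcontfun_bound[OF assms(2)] by metis
  then show ?thesis
    using U_bound[OF assms, of B] U_continuous[OF assms(2)] by (intro bcontfun_boundI[of _ "L * B"]) auto
qed

text \<open>Each \<open>Q u f\<close> vanishes at infinity, but not evidently uniformly in
  \<open>u\<close>. A failure would produce points \<open>z n\<close> violating the test of
  \<open>C0_if_small\<close>, and dominated convergence in \<open>u\<close> along them gives the
  contradiction.\<close>

lemma U_C0:
  assumes L: "0 \<le> L" and f: "f \<in> C0" shows "U L f \<in> C0"
proof (rule C0_if_small)
  have fb: "f \<in> bcontfun" by (rule C0_bcontfun[OF f])
  then show "U L f \<in> bcontfun" by (rule U_bcontfun[OF L])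
  obtain B where B: "\<And>y. \<bar>f y\<bar> \<le> B" using bcontfun_bound[OF fb] by metis
  fix e :: real assume e: "e > 0"
  show "\<exists>n. \<forall>x. \<bar>U L f x\<bar> * (1 - \<phi> n x) \<le> e"
  proof (rule ccontr)
    assume "\<not> ?thesis"
    then have "\<forall>n. \<exists>x. e < \<bar>U L f x\<bar> * (1 - \<phi> n x)" by (auto simp: not_le)
    then obtain z where z: "\<And>n. e < \<bar>U L f (z n)\<bar> * (1 - \<phi> n (z n))"
      using choice[of "\<lambda>n x. e < \<bar>U L f x\<bar> * (1 - \<phi> n x)"] by blast
    let ?k = "\<lambda>n u. Q u f (z n) * (1 - \<phi> n (z n))"
    have \<phi>: "0 \<le> 1 - \<phi> n y" "1 - \<phi> n y \<le> 1" for n y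
      using cutoff_le_1[of n y] cutoff_nonneg[of n y] by auto
    have "(\<lambda>n. \<integral>u. ?k n u \<partial>lebI L) \<longlonglongrightarrow> (\<integral>u. 0 \<partial>lebI L)"
    proof (rule integral_dominated_convergence[where w = "\<lambda>_. B"])
      have "(\<lambda>n. ?k n u) \<longlonglongrightarrow> 0" if u: "0 \<le> u" for u
      proof (rule tendstoI)
        fix d :: real assume "0 < d"
        show "\<forall>\<^sub>F n in sequentially. dist (?k n u) 0 < d"
          using C0_eventually_small[OF Q_C0[OF u f] \<open>0 < d\<close>]
        proof eventually_elim
          case (elim n)
          then show ?case using elim[rule_format, of "z n"] \<phi>(1)[of n "z n"] by (simp add: abs_mult)
        qed
      qed
      then show "AE u in lebI L. (\<lambda>n. ?k n u) \<longlonglongrightarrow> 0" by (intro AE_I2) auto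
      have "\<bar>?k n u\<bar> \<le> B" if u: "0 \<le> u" for n u
      proof -
        have "\<bar>Q u f (z n)\<bar> * \<bar>1 - \<phi> n (z n)\<bar> \<le> B * 1"
          using Q_bound[OF u fb B, of "z n"] \<phi>[of n "z n"] order_trans[OF abs_ge_zero B] by (intro mult_mono) auto
        then show ?thesis by (simp add: abs_mult)
      qed
      then show "AE u in lebI L. norm (?k n u) \<le> B" for n by (intro AE_I2) auto
    qed (simp_all add: borel_measurable_times Q_measurable_lebI fb finite_measure.integrable_const[OF finite_measure_lebI])
    then have "(\<lambda>n. U L f (z n) * (1 - \<phi> n (z n))) \<longlonglongrightarrow> 0" by (simp add: U_def)
    then have "\<forall>\<^sub>F n in sequentially. dist (U L f (z n) * (1 - \<phi> n (z n))) 0 < e"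
      using e by (rule tendstoD)
    then obtain n where "\<bar>U L f (z n) * (1 - \<phi> n (z n))\<bar> < e" by (auto simp: eventually_sequentially)
    then show False using z[of n] \<phi>(1)[of n "z n"] by (simp add: abs_mult)
  qed
qed

section \<open>Integrals along paths and the integrated semigroup\<close>

lemma fX_path_measurable:
  assumes f: "f \<in> bcontfun" and \<omega>: "\<omega> \<in> space (P x)"
  shows "(\<lambda>u. f (X (max 0 u) \<omega>)) \<in> borel_measurable borel"
  by (rule measurable_compose[OF X_at_measurable[of "\<lambda>u. max 0 u" borel "\<lambda>_. \<omega>" x] bcontfun_measurable[OF f]])
    (use \<omega> in auto)

lemma fX_shift_measurable_pair:
  assumes f: "f \<in> bcontfun" and \<tau>: "\<tau> \<in> st x"
  shows "(\<lambda>p. f (X (\<tau> (snd p) + fst p) (snd p))) \<in> borel_measurable (lebI L \<Otimes>\<^sub>M P x)"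
proof -
  have [measurable]: "\<tau> \<in> borel_measurable (P x)" by (rule st_measurable[OF \<tau>])
  have [measurable]: "(\<lambda>u. u) \<in> borel_measurable (lebI L)" by (rule measurable_restrict_space1) simp
  show ?thesis
    by (rule measurable_compose[OF X_at_measurable[of "\<lambda>p. \<tau> (snd p) + fst p" _ snd x] bcontfun_measurable[OF f]])
      (use st_nonneg[OF \<tau>] in \<open>auto simp: space_pair_measure intro: measurable_compose[OF measurable_fst]\<close>)
qed

lemma U_expectation:
  assumes \<tau>: "\<tau> \<in> st x" and f: "f \<in> bcontfun"
  shows "(\<integral>\<omega>. U L f (X (\<tau> \<omega>) \<omega>) \<partial>P x) = (\<integral>u. \<integral>\<omega>. f (X (\<tau> \<omega> + u) \<omega>) \<partial>P x \<partial>lebI L)"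
proof -
  obtain B where B: "\<And>y. \<bar>f y\<bar> \<le> B" using bcontfun_bound[OF f] by metis
  have m1: "(\<lambda>p. snd p) \<in> borel_measurable (P x \<Otimes>\<^sub>M lebI L)"
    by (rule measurable_compose[OF measurable_snd]) (rule measurable_restrict_space1, simp)
  have m2: "(\<lambda>p. X (\<tau> (fst p)) (fst p)) \<in> borel_measurable (P x \<Otimes>\<^sub>M lebI L)"
    by (rule measurable_compose[OF measurable_fst X_st_measurable[OF \<tau>]])
  have "(\<integral>\<omega>. U L f (X (\<tau> \<omega>) \<omega>) \<partial>P x) = (\<integral>u. \<integral>\<omega>. Q u f (X (\<tau> \<omega>) \<omega>) \<partial>P x \<partial>lebI L)"
    unfolding U_def
  proof (rule fubini_bounded[OF fin finite_measure_lebI, where C = B])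
    show "(\<lambda>p. Q (snd p) f (X (\<tau> (fst p)) (fst p))) \<in> borel_measurable (P x \<Otimes>\<^sub>M lebI L)"
      by (rule Q_measurable[OF f m1 m2]) (auto simp: space_pair_measure)
  qed (use Q_bound[OF _ f B] in auto)
  also have "\<dots> = (\<integral>u. \<integral>\<omega>. f (X (\<tau> \<omega> + u) \<omega>) \<partial>P x \<partial>lebI L)"
    by (rule Bochner_Integration.integral_cong[OF refl]) (simp add: strong_markov_expectation[OF \<tau> _ f])
  finally show ?thesis .
qed

lemma fX_shift_fubini:
  fixes f :: "'e \<Rightarrow> real"
  assumes \<tau>: "\<tau> \<in> st x" and f: "f \<in> bcontfun"
  shows "(\<integral>u. \<integral>\<omega>. f (X (\<tau> \<omega> + u) \<omega>) \<partial>P x \<partial>lebI L) = (\<integral>\<omega>. \<integral>u. f (X (\<tau> \<omega> + u) \<omega>) \<partial>lebI L \<partial>P x)"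
proof -
  obtain B where B: "\<And>y. \<bar>f y\<bar> \<le> B" using bcontfun_bound[OF f] by metis
  show ?thesis
    by (rule fubini_bounded[where h = "\<lambda>u \<omega>. f (X (\<tau> \<omega> + u) \<omega>)" and C = B])
      (intro finite_measure_lebI fin fX_shift_measurable_pair f \<tau> B)+
qed

lemma U_path:
  assumes "f \<in> bcontfun"
  shows "U L f x = (\<integral>\<omega>. \<integral>u. f (X u \<omega>) \<partial>lebI L \<partial>P x)"
  using fX_shift_fubini[OF st_const[OF order_refl, of x] assms, of L] by (simp add: U_def transition_def)

text \<open>The Markov property shifts the time window by \<open>s\<close>, so only two boundary
  pieces of length \<open>s\<close> survive in the difference. The bound is independent of
  \<open>z\<close>, which is the gain from averaging.\<close>

lemma Q_U_diff:
  assumes s: "0 \<le> s" and L: "0 \<le> L" and f: "f \<in> bcontfun" and B: "\<And>y. \<bar>f y\<bar> \<le> B"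
  shows "\<bar>Q s (U L f) z - U L f z\<bar> \<le> 2 * s * B"
proof -
  let ?h = "\<lambda>u. Q (max 0 u) f z"
  have "Q s (U L f) z = (\<integral>u. Q (s + u) f z \<partial>lebI L)"
    using U_expectation[OF st_const[OF s] f, of z L] by (simp add: transition_def)
  also have "\<dots> = (\<integral>u. ?h (s + u) \<partial>lebI L)"
    using s by (intro Bochner_Integration.integral_cong) auto
  finally have "Q s (U L f) z = (\<integral>u. ?h (s + u) \<partial>lebI L)" .
  moreover have "U L f z = (\<integral>u. ?h u \<partial>lebI L)"
    unfolding U_def by (intro Bochner_Integration.integral_cong) auto
  moreover have "?h \<in> borel_measurable borel" by (rule Q_measurable[OF f]) auto
  moreover have "\<bar>?h u\<bar> \<le> B" for u by (rule Q_bound[OF _ f B]) simp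
  ultimately show ?thesis using shifted_integral_diff[of ?h B s L] s L by simp
qed

text \<open>This is right continuity of \<open>Q u f z\<close> at \<open>u = 0\<close>, where the
  value is \<open>f z\<close>. The rate may depend on \<open>z\<close>, so the convergence is only
  pointwise.\<close>

lemma U_average_tendsto:
  assumes f: "f \<in> bcontfun"
  shows "(\<lambda>k. real (Suc k) * U (1 / real (Suc k)) f z) \<longlonglongrightarrow> f z"
proof (rule tendstoI)
  fix e :: real assume e: "e > 0"
  have "((\<lambda>s. Q s f z) \<longlongrightarrow> f z) (at_right 0)"
    using Q_right_continuous[OF order_refl f, of z] by (simp add: continuous_within Q_0[OF f])
  then have "\<forall>\<^sub>F s in at_right 0. dist (Q s f z) (f z) < e / 2" using e by (intro tendstoD) auto
  then obtain d where d: "d > 0" "\<And>s. 0 < s \<Longrightarrow> s < d \<Longrightarrow> \<bar>Q s f z - f z\<bar> < e / 2"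
    unfolding eventually_at_right_field dist_real_def by blast
  have d': "\<bar>Q s f z - f z\<bar> \<le> e / 2" if "0 \<le> s" "s < d" for s
    using d(2)[of s] that e Q_0[OF f, of z] by (cases "s = 0") auto
  have "\<forall>\<^sub>F k in sequentially. 1 / real (Suc k) < d"
    using order_tendstoD(2)[OF LIMSEQ_inverse_real_of_nat d(1)] by (simp add: inverse_eq_divide)
  then show "\<forall>\<^sub>F k in sequentially. dist (real (Suc k) * U (1 / real (Suc k)) f z) (f z) < e"
  proof eventually_elim
    case (elim k)
    let ?L = "1 / real (Suc k)"
    have L: "0 < ?L" by simp
    have "U ?L f z - ?L * f z = (\<integral>u. Q u f z - f z \<partial>lebI ?L)"
      unfolding U_def using Q_integrable_lebI[OF f] L
      by (subst Bochner_Integration.integral_diff)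
        (auto simp: measure_lebI intro: finite_measure.integrable_const[OF finite_measure_lebI])
    also have "\<bar>\<dots>\<bar> \<le> ?L * (e / 2)"
      using elim by (intro lebI_integral_abs_le borel_measurable_diff Q_measurable_lebI f d') auto
    finally have "real (Suc k) * \<bar>U ?L f z - ?L * f z\<bar> \<le> real (Suc k) * (?L * (e / 2))"
      by (intro mult_left_mono) auto
    also have "\<dots> = e / 2" by (simp del: of_nat_Suc)
    also have "real (Suc k) * \<bar>U ?L f z - ?L * f z\<bar> = \<bar>real (Suc k) * (U ?L f z - ?L * f z)\<bar>"
      by (simp add: abs_mult)
    also have "real (Suc k) * (U ?L f z - ?L * f z) = real (Suc k) * U ?L f z - f z"
      by (simp add: right_diff_distrib)
    finally show ?case using e by (simp add: dist_real_def)
  qed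
qed

text \<open>Strong continuity of the semigroup at time 0 on the single vector \<open>f\<close>, in
  the sup norm.\<close>

definition uniformly_right_continuous :: "('e \<Rightarrow> real) \<Rightarrow> bool"
  where "uniformly_right_continuous f \<longleftrightarrow> (\<forall>e>0. \<exists>d>0. \<forall>s. 0 \<le> s \<longrightarrow> s \<le> d \<longrightarrow> (\<forall>z. \<bar>Q s f z - f z\<bar> \<le> e))"

lemma urc_U:
  assumes L: "0 \<le> L" and f: "f \<in> bcontfun"
  shows "uniformly_right_continuous (U L f)"
  unfolding uniformly_right_continuous_def
proof (intro allI impI)
  fix e :: real assume e: "e > 0"
  obtain B where B: "B > 0" "\<And>y. \<bar>f y\<bar> \<le> B" using bcontfun_bound[OF f] by metis
  have "\<bar>Q s (U L f) z - U L f z\<bar> \<le> e" if "0 \<le> s" "s \<le> e / (2 * B)" for s z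
    using Q_U_diff[OF that(1) L f B(2), of z] that(2) B(1) by (simp add: field_simps)
  then show "\<exists>d>0. \<forall>s. 0 \<le> s \<longrightarrow> s \<le> d \<longrightarrow> (\<forall>z. \<bar>Q s (U L f) z - U L f z\<bar> \<le> e)"
    using e B(1) by (intro exI[of _ "e / (2 * B)"]) auto
qed

lemma urc_cmult:
  assumes "uniformly_right_continuous f"
  shows "uniformly_right_continuous (\<lambda>y. c * f y)"
  unfolding uniformly_right_continuous_def
proof (intro allI impI)
  fix e :: real assume e: "e > 0"
  then have "e / (\<bar>c\<bar> + 1) > 0" by (auto intro: divide_pos_pos)
  then obtain d where d: "d > 0" "\<And>s z. 0 \<le> s \<Longrightarrow> s \<le> d \<Longrightarrow> \<bar>Q s f z - f z\<bar> \<le> e / (\<bar>c\<bar> + 1)"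
    using assms unfolding uniformly_right_continuous_def by metis
  have "\<bar>Q s (\<lambda>y. c * f y) z - c * f z\<bar> \<le> e" if "0 \<le> s" "s \<le> d" for s z
  proof -
    have "\<bar>Q s (\<lambda>y. c * f y) z - c * f z\<bar> = \<bar>c\<bar> * \<bar>Q s f z - f z\<bar>"
      by (simp add: Q_cmult abs_mult flip: right_diff_distrib)
    also have "\<dots> \<le> (\<bar>c\<bar> + 1) * (e / (\<bar>c\<bar> + 1))" using d(2)[OF that] by (intro mult_mono) auto
    finally show ?thesis by simp
  qed
  then show "\<exists>d>0. \<forall>s. 0 \<le> s \<longrightarrow> s \<le> d \<longrightarrow> (\<forall>z. \<bar>Q s (\<lambda>y. c * f y) z - c * f z\<bar> \<le> e)"
    using d(1) by blast
qed

lemma urc_add: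
  assumes f: "uniformly_right_continuous f" "f \<in> bcontfun" and h: "uniformly_right_continuous h" "h \<in> bcontfun"
  shows "uniformly_right_continuous (\<lambda>y. f y + h y)"
  unfolding uniformly_right_continuous_def
proof (intro allI impI)
  fix e :: real assume e: "e > 0"
  obtain d where d: "d > 0" "\<And>s z. 0 \<le> s \<Longrightarrow> s \<le> d \<Longrightarrow> \<bar>Q s f z - f z\<bar> \<le> e / 2"
    using f(1) e unfolding uniformly_right_continuous_def by (metis half_gt_zero)
  obtain d' where d': "d' > 0" "\<And>s z. 0 \<le> s \<Longrightarrow> s \<le> d' \<Longrightarrow> \<bar>Q s h z - h z\<bar> \<le> e / 2"
    using h(1) e unfolding uniformly_right_continuous_def by (metis half_gt_zero)
  have "\<bar>Q s (\<lambda>y. f y + h y) z - (f z + h z)\<bar> \<le> e" if "0 \<le> s" "s \<le> min d d'" for s z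
    using d(2)[of s z] d'(2)[of s z] that unfolding Q_add[OF that(1) f(2) h(2)] abs_le_iff by linarith
  then show "\<exists>d>0. \<forall>s. 0 \<le> s \<longrightarrow> s \<le> d \<longrightarrow> (\<forall>z. \<bar>Q s (\<lambda>y. f y + h y) z - (f z + h z)\<bar> \<le> e)"
    using d(1) d'(1) by (intro exI[of _ "min d d'"]) auto
qed

lemma urc_uniform_limit:
  assumes f: "f \<in> bcontfun"
    and approx: "\<And>e. e > 0 \<Longrightarrow> \<exists>h. h \<in> bcontfun \<and> uniformly_right_continuous h \<and> (\<forall>y. \<bar>h y - f y\<bar> \<le> e)"
  shows "uniformly_right_continuous f"
  unfolding uniformly_right_continuous_def
proof (intro allI impI)
  fix e :: real assume e: "e > 0"
  obtain h where h: "h \<in> bcontfun" "uniformly_right_continuous h" "\<And>y. \<bar>h y - f y\<bar> \<le> e / 3"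
    using approx[of "e / 3"] e by auto
  obtain d where d: "d > 0" "\<And>s z. 0 \<le> s \<Longrightarrow> s \<le> d \<Longrightarrow> \<bar>Q s h z - h z\<bar> \<le> e / 3"
    using h(2) e unfolding uniformly_right_continuous_def by (metis divide_pos_pos zero_less_numeral)
  have "\<bar>Q s f z - f z\<bar> \<le> e" if "0 \<le> s" "s \<le> d" for s z
  proof -
    have "\<bar>Q s (\<lambda>y. h y - f y) z\<bar> \<le> e / 3" using that h f by (intro Q_bound minus_cont) auto
    then have "\<bar>Q s h z - Q s f z\<bar> \<le> e / 3" by (simp add: Q_diff[OF that(1) h(1) f])
    then show ?thesis using d(2)[OF that, of z] h(3)[of z] by linarith
  qed
  then show "\<exists>d>0. \<forall>s. 0 \<le> s \<longrightarrow> s \<le> d \<longrightarrow> (\<forall>z. \<bar>Q s f z - f z\<bar> \<le> e)"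
    using d(1) by blast
qed

text \<open>The averages \<open>a k\<close> have the property and tend to \<open>f\<close> boundedly
  and pointwise. By \<open>convex_combination_small\<close>, some convex combination of them is
  uniformly close to \<open>f\<close>; the property survives convex combinations and uniform
  limits.\<close>

lemma urc_C0:
  assumes f: "f \<in> C0"
  shows "uniformly_right_continuous f"
proof (rule urc_uniform_limit)
  show fb: "f \<in> bcontfun" by (rule C0_bcontfun[OF f])
  obtain B where B: "B > 0" "\<And>y. \<bar>f y\<bar> \<le> B" using bcontfun_bound[OF fb] by metis
  let ?L = "\<lambda>k. 1 / real (Suc k)"
  define a where "a k y = real (Suc k) * U (?L k) f y" for k y
  have a_C0: "a k \<in> C0" for k unfolding a_def by (intro C0_cmult U_C0 f) simp
  have a_urc: "uniformly_right_continuous (a k)" for k unfolding a_def by (intro urc_cmult urc_U fb) simp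
  have a_bound: "\<bar>a k y\<bar> \<le> B" for k y
  proof -
    have "\<bar>a k y\<bar> = real (Suc k) * \<bar>U (?L k) f y\<bar>" unfolding a_def abs_mult by simp
    also have "\<dots> \<le> real (Suc k) * (?L k * B)" using fb B by (intro mult_left_mono U_bound) auto
    finally show ?thesis by simp
  qed
  define d where "d k = Bcontfun (\<lambda>y. a k y - f y)" for k
  have m: "(\<lambda>y. a k y + (-1) * f y) \<in> C0" for k by (intro C0_add a_C0 C0_cmult f)
  then have m': "(\<lambda>y. a k y - f y) \<in> C0" for k by simp
  have d: "apply_bcontfun (d k) = (\<lambda>y. a k y - f y)" for k
    unfolding d_def by (intro Bcontfun_inverse C0_bcontfun m')
  \<comment> \<open>The closed convex set on which norms are attained; it contains all differences
    \<open>d k\<close>.\<close>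
  define V where "V = {h :: 'e \<Rightarrow>\<^sub>C real. apply_bcontfun h \<in> C0}"
  have V_convex: "convex V"
    unfolding V_def by (intro convexI CollectI) (simp add: plus_bcontfun.rep_eq scaleR_bcontfun.rep_eq C0_add C0_cmult)
  have V_closed: "closed V"
    unfolding closed_sequential_limits
  proof (intro allI impI)
    fix s :: "nat \<Rightarrow> 'e \<Rightarrow>\<^sub>C real" and l assume s: "(\<forall>n. s n \<in> V) \<and> s \<longlonglongrightarrow> l"
    have "apply_bcontfun l \<in> C0"
      unfolding C0_def
    proof (intro CollectI conjI allI impI)
      show "apply_bcontfun l \<in> bcontfun" by (rule apply_bcontfun)
      fix e :: real assume "e > 0"
      then have "\<forall>\<^sub>F n in sequentially. dist (s n) l < e / 2" using s by (intro tendstoD) auto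
      then obtain n where n: "dist (s n) l < e / 2" by (auto simp: eventually_sequentially)
      obtain K where K: "compact K" "\<And>x. x \<notin> K \<Longrightarrow> \<bar>apply_bcontfun (s n) x\<bar> < e / 2"
        using C0_vanish[of "apply_bcontfun (s n)" "e/2"] s \<open>e > 0\<close> by (auto simp: V_def)
      have "\<bar>apply_bcontfun l x\<bar> < e" if "x \<notin> K" for x
        using K(2)[OF that] dist_fun_lt_imp_dist_val_lt[OF n, of x] unfolding dist_real_def by linarith
      then show "\<exists>K. compact K \<and> (\<forall>x. x \<notin> K \<longrightarrow> \<bar>apply_bcontfun l x\<bar> < e)" using K(1) by blast
    qed
    then show "l \<in> V" by (simp add: V_def)
  qed
  \<comment> \<open>Adding \<open>f\<close> back turns a difference into an approximant.
    \<open>W\<close> is convex because weights with \<open>u + v = 1\<close> leave exactly one copy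
    of \<open>f\<close>.\<close>
  define W where "W = {h :: 'e \<Rightarrow>\<^sub>C real. uniformly_right_continuous (\<lambda>y. apply_bcontfun h y + f y)}"
  have W_convex: "convex W"
  proof (rule convexI)
    fix h k :: "'e \<Rightarrow>\<^sub>C real" and u v :: real
    assume hk: "h \<in> W" "k \<in> W" and uv: "0 \<le> u" "0 \<le> v" "u + v = 1"
    have "uniformly_right_continuous
        (\<lambda>y. u * (apply_bcontfun h y + f y) + v * (apply_bcontfun k y + f y))"
    proof (rule urc_add)
      show "uniformly_right_continuous (\<lambda>y. u * (apply_bcontfun h y + f y))"
        "uniformly_right_continuous (\<lambda>y. v * (apply_bcontfun k y + f y))"
        using hk urc_cmult unfolding W_def by auto
    qed (intro bcontfun_times const_bcontfun plus_cont fb apply_bcontfun)+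
    also have "(\<lambda>y. u * (apply_bcontfun h y + f y) + v * (apply_bcontfun k y + f y))
        = (\<lambda>y. apply_bcontfun (u *\<^sub>R h + v *\<^sub>R k) y + (u + v) * f y)"
      by (auto simp: algebra_simps)
    finally show "u *\<^sub>R h + v *\<^sub>R k \<in> W" using uv by (simp add: W_def)
  qed
  have hull_W: "convex hull (range d) \<subseteq> W"
    using W_convex a_urc by (intro hull_minimal) (auto simp: W_def d)
  fix e :: real assume e: "e > 0"
  have "\<exists>g\<in>convex hull (range d). norm g < e"
  proof (rule convex_combination_small[OF V_closed V_convex])
    show "d n \<in> V" for n by (simp add: V_def d m')
    show "\<exists>b. norm h \<le> \<bar>apply_bcontfun h b\<bar>" if "h \<in> V" for h
    proof -
      from that have "apply_bcontfun h \<in> C0" by (simp add: V_def)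
      from C0_attains_max_abs[OF this]
      obtain b where "\<forall>x. \<bar>apply_bcontfun h x\<bar> \<le> \<bar>apply_bcontfun h b\<bar>" by blast
      then have "norm h \<le> \<bar>apply_bcontfun h b\<bar>" by (intro norm_bound) simp
      then show ?thesis by blast
    qed
    have "norm (d n) \<le> B + B" for n
    proof (rule norm_bound)
      show "norm (apply_bcontfun (d n) y) \<le> B + B" for y
        using a_bound[of n y] B(2)[of y] unfolding d real_norm_def by linarith
    qed
    then show "bounded (range d)" by (auto simp: bounded_iff)
    show "(\<lambda>n. apply_bcontfun (d n) b) \<longlonglongrightarrow> 0" for b
      using tendsto_diff[OF U_average_tendsto[OF fb, of b] tendsto_const, of "f b"] by (simp add: d a_def)
  qed (rule e)
  then obtain g where g: "g \<in> convex hull (range d)" "norm g < e" by blast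
  show "\<exists>h. h \<in> bcontfun \<and> uniformly_right_continuous h \<and> (\<forall>y. \<bar>h y - f y\<bar> \<le> e)"
  proof (intro exI[of _ "\<lambda>y. apply_bcontfun g y + f y"] conjI allI)
    show "(\<lambda>y. apply_bcontfun g y + f y) \<in> bcontfun" by (intro plus_cont apply_bcontfun fb)
    show "uniformly_right_continuous (\<lambda>y. apply_bcontfun g y + f y)" using g(1) hull_W by (auto simp: W_def)
    show "\<bar>apply_bcontfun g y + f y - f y\<bar> \<le> e" for y using norm_bounded[of g y] g(2) by simp
  qed
qed

section \<open>Compact containment and small increments\<close>

text \<open>By the strong Markov property the left side is the expected path integral of
  \<open>f\<close> over the window of length \<open>L\<close> after \<open>\<tau>\<close>. That
  window lies in \<open>[0, T]\<close> and \<open>f\<close> is nonnegative.\<close>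

lemma U_stopped_le:
  assumes \<tau>: "\<tau> \<in> st x" "\<And>\<omega>. \<omega> \<in> space (P x) \<Longrightarrow> \<tau> \<omega> + L \<le> T"
    and L: "0 \<le> L" and f: "f \<in> bcontfun" "\<And>y. 0 \<le> f y"
  shows "(\<integral>\<omega>. U L f (X (\<tau> \<omega>) \<omega>) \<partial>P x) \<le> U T f x"
proof -
  obtain B where B: "\<And>y. \<bar>f y\<bar> \<le> B" using bcontfun_bound[OF f(1)] by metis
  have fB: "f y \<le> B" for y using B[of y] by linarith
  have meas: "(\<lambda>\<omega>. \<integral>u. f (X (\<sigma> \<omega> + u) \<omega>) \<partial>lebI S) \<in> borel_measurable (P x)" if "\<sigma> \<in> st x" for \<sigma> S
  proof -
    interpret sigma_finite_measure "lebI S"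
      by (rule finite_measure.axioms(1)[OF finite_measure_lebI])
    have "(\<lambda>p. f (X (\<sigma> (fst p) + snd p) (fst p))) \<in> borel_measurable (P x \<Otimes>\<^sub>M lebI S)"
      using measurable_compose[OF measurable_pair_swap' fX_shift_measurable_pair[OF f(1) that, of S]]
      by (simp add: case_prod_beta')
    then show ?thesis by (intro borel_measurable_lebesgue_integral) (simp add: case_prod_beta')
  qed
  have int: "integrable (P x) (\<lambda>\<omega>. \<integral>u. f (X (\<sigma> \<omega> + u) \<omega>) \<partial>lebI S)" if "\<sigma> \<in> st x" "0 \<le> S" for \<sigma> S
  proof (rule integrable_bounded_finite[OF fin meas[OF that(1)], of _ "S * B"])
    fix \<omega> assume \<omega>: "\<omega> \<in> space (P x)"
    have "(\<lambda>u. f (X (\<sigma> \<omega> + u) \<omega>)) \<in> borel_measurable (lebI S)"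
      using measurable_compose[OF measurable_Pair2'[OF \<omega>] fX_shift_measurable_pair[OF f(1) that(1), of S]]
      by simp
    then show "\<bar>\<integral>u. f (X (\<sigma> \<omega> + u) \<omega>) \<partial>lebI S\<bar> \<le> S * B"
      by (intro lebI_integral_abs_le that(2) B)
  qed
  obtain \<omega> where "\<omega> \<in> space (P x)" using prob_space.not_empty[OF prob[of x]] by blast
  then have T: "0 \<le> T" using \<tau>(2)[of \<omega>] st_nonneg[OF \<tau>(1), of \<omega>] L by linarith
  have "(\<integral>\<omega>. U L f (X (\<tau> \<omega>) \<omega>) \<partial>P x) = (\<integral>\<omega>. \<integral>u. f (X (\<tau> \<omega> + u) \<omega>) \<partial>lebI L \<partial>P x)"
    using U_expectation[OF \<tau>(1) f(1)] fX_shift_fubini[OF \<tau>(1) f(1)] by simp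
  also have "\<dots> \<le> (\<integral>\<omega>. \<integral>u. f (X (0 + u) \<omega>) \<partial>lebI T \<partial>P x)"
  proof (rule integral_mono[OF int[OF \<tau>(1) L] int[OF st_const[OF order_refl] T]])
    fix \<omega> assume \<omega>: "\<omega> \<in> space (P x)"
    let ?h = "\<lambda>u. f (X (max 0 u) \<omega>)"
    have "(\<integral>u. f (X (\<tau> \<omega> + u) \<omega>) \<partial>lebI L) = (\<integral>u. ?h (\<tau> \<omega> + u) \<partial>lebI L)"
      using st_nonneg[OF \<tau>(1) \<omega>] by (intro Bochner_Integration.integral_cong[OF refl]) auto
    also have "\<dots> \<le> (\<integral>u. ?h u \<partial>lebI T)"
      by (rule window_integral_le[OF fX_path_measurable[OF f(1) \<omega>] f(2) fB st_nonneg[OF \<tau>(1) \<omega>] \<tau>(2)[OF \<omega>]])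
    also have "\<dots> = (\<integral>u. f (X (0 + u) \<omega>) \<partial>lebI T)"
      by (intro Bochner_Integration.integral_cong[OF refl]) auto
    finally show "(\<integral>u. f (X (\<tau> \<omega> + u) \<omega>) \<partial>lebI L) \<le> (\<integral>u. f (X (0 + u) \<omega>) \<partial>lebI T)" .
  qed
  also have "\<dots> = U T f x" using U_path[OF f(1)] by simp
  finally show ?thesis .
qed

text \<open>
  The expectation of \<open>U 1 f (X \<tau>)\<close> is that of the integral of \<open>f\<close> along the path over a window after
  \<open>\<tau>\<close>, hence bounded independently of \<open>\<tau>\<close>; so \<open>U 1 (\<phi> n)\<close> serves as the cutoff.
\<close>

lemma containment:
  assumes K: "compact K" and T: "0 \<le> T" and e: "e > 0"
  shows "\<exists>\<psi>\<in>C0. (\<forall>y. 0 \<le> \<psi> y \<and> \<psi> y \<le> 1) \<and>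
    (\<forall>x\<in>K. \<forall>\<tau>\<in>st x. (\<forall>\<omega>\<in>space (P x). \<tau> \<omega> \<le> T) \<longrightarrow> (\<integral>\<omega>. 1 - \<psi> (X (\<tau> \<omega>) \<omega>) \<partial>P x) \<le> e)"
proof -
  have \<phi>b: "\<phi> n \<in> bcontfun" for n by (rule C0_bcontfun[OF cutoff_C0])
  let ?f = "\<lambda>n y. 1 - \<phi> n y"
  have f: "?f n \<in> bcontfun" for n by (intro minus_cont const_bcontfun \<phi>b)
  \<comment> \<open>The horizon is \<open>T + 1\<close> because a window of length 1 after a
    stopping time bounded by \<open>T\<close> ends no later than that.\<close>
  have "uniform_limit K (\<lambda>n. U (T + 1) (?f n)) (\<lambda>_. 0) sequentially"
  proof (rule dini_decreasing[OF K])
    show "continuous_on K (U (T + 1) (?f n))" for n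
      using U_continuous[OF f] continuous_on_subset by blast
    show "decseq (\<lambda>n. U (T + 1) (?f n) x)" for x
      unfolding decseq_def using cutoff_mono by (intro allI impI U_mono f) (auto simp: incseq_def)
    have lim: "(\<lambda>n. U (T + 1) (?f n) x) \<longlonglongrightarrow> U (T + 1) (\<lambda>_. 1 - 1) x" for x
      using cutoff_le_1 cutoff_nonneg
      by (intro U_tendsto[where B = 1] f const_bcontfun tendsto_diff tendsto_const cutoff_lim) auto
    show "(\<lambda>n. U (T + 1) (?f n) x) \<longlonglongrightarrow> 0" for x
      using lim[of x] U_const[of "T + 1" 0 x] T by simp
  qed
  from uniform_limitD[OF this e]
  obtain n where "\<And>x. x \<in> K \<Longrightarrow> dist (U (T + 1) (?f n) x) 0 < e" by (auto simp: eventually_sequentially)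
  then have n: "U (T + 1) (?f n) x \<le> e" if "x \<in> K" for x using that by (force simp: dist_real_def)
  let ?\<psi> = "U 1 (\<phi> n)"
  have eq: "U 1 (?f n) z = 1 - ?\<psi> z" for z
    using U_diff[OF const_bcontfun \<phi>b, of 1 1 n z] U_const[of 1 1 z] by simp
  show ?thesis
  proof (intro bexI[of _ ?\<psi>] conjI allI ballI impI)
    show "?\<psi> \<in> C0" by (intro U_C0 cutoff_C0) simp
    show "0 \<le> ?\<psi> y" for y
      using U_mono[OF const_bcontfun \<phi>b, of 0 n 1 y] cutoff_nonneg U_const[of 1 0 y] by simp
    show "?\<psi> y \<le> 1" for y
      using U_mono[OF \<phi>b const_bcontfun, of n 1 1 y] cutoff_le_1 U_const[of 1 1 y] by simp
    fix x \<tau> assume "x \<in> K" "\<tau> \<in> st x" "\<forall>\<omega>\<in>space (P x). \<tau> \<omega> \<le> T"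
    then show "(\<integral>\<omega>. 1 - ?\<psi> (X (\<tau> \<omega>) \<omega>) \<partial>P x) \<le> e"
      using U_stopped_le[of \<tau> x 1 "T + 1" "?f n"] f cutoff_le_1 n[of x] by (simp add: eq)
  qed
qed

text \<open>Strong continuity, applied to both \<open>f\<close> and its square, makes the bound of
  \<open>squared_increment\<close> small uniformly in \<open>x\<close> and
  \<open>\<tau>\<close>.\<close>

lemma stopped_increment_C0:
  assumes f: "f \<in> C0" and e: "e > 0"
  shows "\<exists>d>0. \<forall>x. \<forall>\<tau>\<in>st x. \<forall>u. 0 \<le> u \<longrightarrow> u \<le> d \<longrightarrow>
    (\<integral>\<omega>. \<bar>f (X (\<tau> \<omega> + u) \<omega>) - f (X (\<tau> \<omega>) \<omega>)\<bar> \<partial>P x) \<le> e"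
proof -
  have fb: "f \<in> bcontfun" by (rule C0_bcontfun[OF f])
  obtain B where B: "B > 0" "\<And>y. \<bar>f y\<bar> \<le> B" using bcontfun_bound[OF fb] by metis
  \<comment> \<open>A second moment of at most \<open>\<eta>\<^sup>2\<close> will give a first
    moment of at most \<open>\<eta> + \<eta>\<^sup>2 / \<eta> = e\<close>.\<close>
  define \<eta> where "\<eta> = e / 2"
  have \<eta>: "\<eta> > 0" using e by (simp add: \<eta>_def)
  have "uniformly_right_continuous (\<lambda>y. f y * f y)" by (intro urc_C0 C0_times f fb)
  then obtain d where d: "d > 0" "\<And>s z. 0 \<le> s \<Longrightarrow> s \<le> d \<Longrightarrow> \<bar>Q s (\<lambda>y. f y * f y) z - f z * f z\<bar> \<le> \<eta>\<^sup>2 / 2"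
    unfolding uniformly_right_continuous_def using \<eta> by (metis half_gt_zero zero_less_power)
  have "\<eta>\<^sup>2 / (4 * B) > 0" using \<eta> B by simp
  then obtain d' where d': "d' > 0" "\<And>s z. 0 \<le> s \<Longrightarrow> s \<le> d' \<Longrightarrow> \<bar>Q s f z - f z\<bar> \<le> \<eta>\<^sup>2 / (4 * B)"
    using urc_C0[OF f] unfolding uniformly_right_continuous_def by metis
  show ?thesis
  proof (intro exI[of _ "min d d'"] conjI allI ballI impI)
    show "0 < min d d'" using d d' by simp
    fix x \<tau> u assume \<tau>: "\<tau> \<in> st x" and u: "0 \<le> u" "u \<le> min d d'"
    let ?D = "\<lambda>\<omega>. f (X (\<tau> \<omega> + u) \<omega>) - f (X (\<tau> \<omega>) \<omega>)"
    have D_int: "integrable (P x) ?D"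
      by (intro Bochner_Integration.integrable_diff fX_st_integrable \<tau> fb st_add_const u)
    have D2_int: "integrable (P x) (\<lambda>\<omega>. (?D \<omega>)\<^sup>2)"
    proof (rule integrable_bounded_finite[OF fin, where C = "(2 * B)\<^sup>2"])
      show "(\<lambda>\<omega>. (?D \<omega>)\<^sup>2) \<in> borel_measurable (P x)"
        using D_int by (intro borel_measurable_power) simp
      show "\<bar>(?D \<omega>)\<^sup>2\<bar> \<le> (2 * B)\<^sup>2" for \<omega>
      proof -
        have "\<bar>?D \<omega>\<bar> \<le> \<bar>2 * B\<bar>"
          using B(2)[of "X (\<tau> \<omega> + u) \<omega>"] B(2)[of "X (\<tau> \<omega>) \<omega>"] B(1) by linarith
        then show ?thesis unfolding abs_le_square_iff by simp
      qed
    qed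
    have "(\<integral>\<omega>. (?D \<omega>)\<^sup>2 \<partial>P x) \<le> \<eta>\<^sup>2 / 2 + 2 * B * (\<eta>\<^sup>2 / (4 * B))"
      using u d d' by (intro squared_increment[OF \<tau> u(1) fb B(2)]) auto
    also have "\<dots> = \<eta>\<^sup>2" using B(1) by (simp add: field_simps)
    finally have sq: "(\<integral>\<omega>. (?D \<omega>)\<^sup>2 \<partial>P x) \<le> \<eta>\<^sup>2" .
    have "(\<integral>\<omega>. \<bar>?D \<omega>\<bar> \<partial>P x) \<le> (\<integral>\<omega>. \<eta> + (?D \<omega>)\<^sup>2 / \<eta> \<partial>P x)"
      using D_int D2_int \<eta>
      by (intro integral_mono abs_le_plus_square Bochner_Integration.integrable_add integrable_abs
          integrable_divide finite_measure.integrable_const[OF fin]) auto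
    also have "\<dots> = \<eta> + (\<integral>\<omega>. (?D \<omega>)\<^sup>2 \<partial>P x) / \<eta>"
      using D2_int prob_space.prob_space[OF prob[of x]]
      by (subst Bochner_Integration.integral_add) (auto intro: finite_measure.integrable_const[OF fin])
    also have "\<dots> \<le> \<eta> + \<eta>\<^sup>2 / \<eta>" using sq \<eta> by (intro add_left_mono divide_right_mono) auto
    also have "\<dots> = e" using \<eta> by (simp add: \<eta>_def power2_eq_square)
    finally show "(\<integral>\<omega>. \<bar>?D \<omega>\<bar> \<partial>P x) \<le> e" .
  qed
qed

text \<open>Split off \<open>\<psi> * f\<close>, which is in \<open>C0\<close>. It costs
  \<open>e / 2\<close>, and the remainders at the two times cost \<open>e / 4\<close> each by
  containment; \<open>u \<le> 1\<close> keeps the later time below \<open>T + 1\<close>.\<close>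

lemma stopped_increment:
  fixes f :: "'e \<Rightarrow> real"
  assumes f: "f \<in> bcontfun" and K: "compact K" and T: "0 \<le> T" and e: "e > 0"
  shows "\<exists>d>0. \<forall>x\<in>K. \<forall>\<tau>\<in>st x. (\<forall>\<omega>\<in>space (P x). \<tau> \<omega> \<le> T) \<longrightarrow> (\<forall>u. 0 \<le> u \<longrightarrow> u \<le> d \<longrightarrow>
    (\<integral>\<omega>. \<bar>f (X (\<tau> \<omega> + u) \<omega>) - f (X (\<tau> \<omega>) \<omega>)\<bar> \<partial>P x) \<le> e)"
proof -
  obtain B where B: "B > 0" "\<And>y. \<bar>f y\<bar> \<le> B" using bcontfun_bound[OF f] by metis
  have "e / (4 * B) > 0" using e B by simp
  from containment[OF K _ this, of "T + 1"] T obtain \<psi> where \<psi>: "\<psi> \<in> C0" "\<And>y. 0 \<le> \<psi> y" "\<And>y. \<psi> y \<le> 1"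
    and \<psi>_int: "\<And>x \<tau>. x \<in> K \<Longrightarrow> \<tau> \<in> st x \<Longrightarrow> (\<forall>\<omega>\<in>space (P x). \<tau> \<omega> \<le> T + 1) \<Longrightarrow>
      (\<integral>\<omega>. 1 - \<psi> (X (\<tau> \<omega>) \<omega>) \<partial>P x) \<le> e / (4 * B)"
    by auto
  let ?h = "\<lambda>y. \<psi> y * f y"
  have h: "?h \<in> C0" by (rule C0_times[OF \<psi>(1) f])
  have "e / 2 > 0" using e by simp
  from stopped_increment_C0[OF h this] obtain d where d: "d > 0"
    "\<And>x \<tau> u. \<tau> \<in> st x \<Longrightarrow> 0 \<le> u \<Longrightarrow> u \<le> d \<Longrightarrow>
      (\<integral>\<omega>. \<bar>?h (X (\<tau> \<omega> + u) \<omega>) - ?h (X (\<tau> \<omega>) \<omega>)\<bar> \<partial>P x) \<le> e / 2"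
    by blast
  have close: "\<bar>f y - ?h y\<bar> \<le> B * (1 - \<psi> y)" for y
  proof -
    have "f y - ?h y = f y * (1 - \<psi> y)" by (simp add: algebra_simps)
    then show ?thesis using B(2)[of y] \<psi>(3)[of y] by (simp add: abs_mult mult_right_mono)
  qed
  have g: "(\<lambda>y. 1 - \<psi> y) \<in> bcontfun" by (intro minus_cont const_bcontfun C0_bcontfun \<psi>)
  show ?thesis
  proof (intro exI[of _ "min d 1"] conjI ballI allI impI)
    show "0 < min d 1" using d by simp
    fix x \<tau> u assume x: "x \<in> K" and \<tau>: "\<tau> \<in> st x" "\<forall>\<omega>\<in>space (P x). \<tau> \<omega> \<le> T" and u: "0 \<le> u" "u \<le> min d 1"
    have \<tau>u: "(\<lambda>\<omega>. \<tau> \<omega> + u) \<in> st x" by (rule st_add_const[OF \<tau>(1) u(1)])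
    have le1: "\<forall>\<omega>\<in>space (P x). \<tau> \<omega> \<le> T + 1" using \<tau>(2) by force
    have le2: "\<forall>\<omega>\<in>space (P x). \<tau> \<omega> + u \<le> T + 1" using \<tau>(2) u by force
    note i = fX_st_integrable[OF \<tau>(1)] fX_st_integrable[OF \<tau>u]
    note hb = C0_bcontfun[OF h]
    have "(\<integral>\<omega>. \<bar>f (X (\<tau> \<omega> + u) \<omega>) - f (X (\<tau> \<omega>) \<omega>)\<bar> \<partial>P x)
      \<le> (\<integral>\<omega>. \<bar>?h (X (\<tau> \<omega> + u) \<omega>) - ?h (X (\<tau> \<omega>) \<omega>)\<bar>
          + B * (1 - \<psi> (X (\<tau> \<omega> + u) \<omega>)) + B * (1 - \<psi> (X (\<tau> \<omega>) \<omega>)) \<partial>P x)"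
    proof (rule integral_mono)
      show "integrable (P x) (\<lambda>\<omega>. \<bar>f (X (\<tau> \<omega> + u) \<omega>) - f (X (\<tau> \<omega>) \<omega>)\<bar>)"
        by (intro integrable_abs Bochner_Integration.integrable_diff i f)
      show "integrable (P x) (\<lambda>\<omega>. \<bar>?h (X (\<tau> \<omega> + u) \<omega>) - ?h (X (\<tau> \<omega>) \<omega>)\<bar>
          + B * (1 - \<psi> (X (\<tau> \<omega> + u) \<omega>)) + B * (1 - \<psi> (X (\<tau> \<omega>) \<omega>)))"
        by (intro Bochner_Integration.integrable_add integrable_abs Bochner_Integration.integrable_diff
            integrable_mult_right i(1)[OF hb] i(2)[OF hb] i(1)[OF g] i(2)[OF g])
    next
      fix \<omega>
      show "\<bar>f (X (\<tau> \<omega> + u) \<omega>) - f (X (\<tau> \<omega>) \<omega>)\<bar> \<le> \<bar>?h (X (\<tau> \<omega> + u) \<omega>) - ?h (X (\<tau> \<omega>) \<omega>)\<bar>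
          + B * (1 - \<psi> (X (\<tau> \<omega> + u) \<omega>)) + B * (1 - \<psi> (X (\<tau> \<omega>) \<omega>))"
        using close[of "X (\<tau> \<omega> + u) \<omega>"] close[of "X (\<tau> \<omega>) \<omega>"] by linarith
    qed
    also have "\<dots> = (\<integral>\<omega>. \<bar>?h (X (\<tau> \<omega> + u) \<omega>) - ?h (X (\<tau> \<omega>) \<omega>)\<bar> \<partial>P x)
        + B * (\<integral>\<omega>. 1 - \<psi> (X (\<tau> \<omega> + u) \<omega>) \<partial>P x) + B * (\<integral>\<omega>. 1 - \<psi> (X (\<tau> \<omega>) \<omega>) \<partial>P x)"
    proof -
      have "integrable (P x) (\<lambda>\<omega>. \<bar>?h (X (\<tau> \<omega> + u) \<omega>) - ?h (X (\<tau> \<omega>) \<omega>)\<bar>)"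
        by (intro integrable_abs Bochner_Integration.integrable_diff i(1)[OF hb] i(2)[OF hb])
      then show ?thesis
        using integrable_mult_right[OF i(1)[OF g], of B] integrable_mult_right[OF i(2)[OF g], of B]
        by (simp only: Bochner_Integration.integral_add Bochner_Integration.integrable_add integral_mult_right_zero)
    qed
    also have "\<dots> \<le> e / 2 + B * (e / (4 * B)) + B * (e / (4 * B))"
      using d(2)[OF \<tau>(1) u(1)] u(2) \<psi>_int[OF x \<tau>(1) le1] \<psi>_int[OF x \<tau>u le2] B(1)
      by (intro add_mono mult_left_mono) auto
    also have "\<dots> = e" using B(1) by simp
    finally show "(\<integral>\<omega>. \<bar>f (X (\<tau> \<omega> + u) \<omega>) - f (X (\<tau> \<omega>) \<omega>)\<bar> \<partial>P x) \<le> e" .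
  qed
qed

text \<open>
  Two nearby stopping times are compared through the overlap of the windows following them; thus
  the strong Markov property is used for deterministic shifts only.
\<close>

lemma nearby_stopping_times:
  fixes f :: "'e \<Rightarrow> real"
  assumes f: "f \<in> bcontfun" and K: "compact K" and T: "0 \<le> T" and e: "e > 0"
  shows "\<exists>d>0. \<forall>x\<in>K. \<forall>\<tau>\<in>st x. \<forall>\<sigma>\<in>st x.
    (\<forall>\<omega>\<in>space (P x). \<tau> \<omega> \<le> \<sigma> \<omega> \<and> \<sigma> \<omega> \<le> \<tau> \<omega> + d \<and> \<sigma> \<omega> \<le> T) \<longrightarrow>
    (\<integral>\<omega>. \<bar>f (X (\<sigma> \<omega>) \<omega>) - f (X (\<tau> \<omega>) \<omega>)\<bar> \<partial>P x) \<le> e"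
proof -
  obtain B where B: "B > 0" "\<And>y. \<bar>f y\<bar> \<le> B" using bcontfun_bound[OF f] by metis
  have "e / 4 > 0" using e by simp
  from stopped_increment[OF f K T this] obtain L where L: "L > 0"
    and inc: "\<forall>x\<in>K. \<forall>\<tau>\<in>st x. (\<forall>\<omega>\<in>space (P x). \<tau> \<omega> \<le> T) \<longrightarrow> (\<forall>u. 0 \<le> u \<longrightarrow> u \<le> L \<longrightarrow>
      (\<integral>\<omega>. \<bar>f (X (\<tau> \<omega> + u) \<omega>) - f (X (\<tau> \<omega>) \<omega>)\<bar> \<partial>P x) \<le> e / 4)"
    by (elim exE conjE)
  \<comment> \<open>The deviation from the value at \<open>\<rho>\<close>, integrated over the
    window of length \<open>L\<close> following \<open>\<rho>\<close>.\<close>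
  define W where "W \<rho> \<omega> = (\<integral>u. \<bar>f (X (\<rho> \<omega> + u) \<omega>) - f (X (\<rho> \<omega>) \<omega>)\<bar> \<partial>lebI L)" for \<rho> :: "'a \<Rightarrow> real" and \<omega>
  have W: "integrable (P x) (W \<rho>)" "(\<integral>\<omega>. W \<rho> \<omega> \<partial>P x) \<le> L * (e / 4)"
    if \<rho>: "\<rho> \<in> st x" "\<forall>\<omega>\<in>space (P x). \<rho> \<omega> \<le> T" and x: "x \<in> K" for \<rho> x
  proof -
    let ?k = "\<lambda>u \<omega>. \<bar>f (X (\<rho> \<omega> + u) \<omega>) - f (X (\<rho> \<omega>) \<omega>)\<bar>"
    have k_meas: "(\<lambda>p. ?k (fst p) (snd p)) \<in> borel_measurable (lebI L \<Otimes>\<^sub>M P x)"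
      by (intro borel_measurable_abs borel_measurable_diff fX_shift_measurable_pair f \<rho>(1)
          measurable_compose[OF measurable_snd fX_st_measurable[OF \<rho>(1) f]])
    have k_bound: "\<bar>?k u \<omega>\<bar> \<le> 2 * B" for u \<omega>
      using B(2)[of "X (\<rho> \<omega> + u) \<omega>"] B(2)[of "X (\<rho> \<omega>) \<omega>"] by linarith
    interpret sigma_finite_measure "lebI L"
      by (rule finite_measure.axioms(1)[OF finite_measure_lebI])
    have "(\<lambda>p. ?k (snd p) (fst p)) \<in> borel_measurable (P x \<Otimes>\<^sub>M lebI L)"
      using measurable_compose[OF measurable_pair_swap' k_meas] by (simp add: case_prod_beta')
    then have W_meas: "W \<rho> \<in> borel_measurable (P x)"
      unfolding W_def by (intro borel_measurable_lebesgue_integral) (simp add: case_prod_beta')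
    show "integrable (P x) (W \<rho>)"
    proof (rule integrable_bounded_finite[OF fin W_meas])
      fix \<omega> assume \<omega>: "\<omega> \<in> space (P x)"
      have "(\<lambda>u. ?k u \<omega>) \<in> borel_measurable (lebI L)"
        using measurable_compose[OF measurable_Pair2'[OF \<omega>] k_meas] by simp
      then show "\<bar>W \<rho> \<omega>\<bar> \<le> L * (2 * B)"
        unfolding W_def using L k_bound by (intro lebI_integral_abs_le) auto
    qed
    have "(\<integral>\<omega>. W \<rho> \<omega> \<partial>P x) = (\<integral>u. \<integral>\<omega>. ?k u \<omega> \<partial>P x \<partial>lebI L)"
      unfolding W_def
      by (rule fubini_bounded[where h = ?k and C = "2 * B", symmetric])
        (intro finite_measure_lebI fin k_meas k_bound)+
    also have "\<bar>\<dots>\<bar> \<le> L * (e / 4)"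
    proof (rule lebI_integral_abs_le)
      interpret PP: sigma_finite_measure "P x" by (rule finite_measure.axioms(1)[OF fin])
      show "(\<lambda>u. \<integral>\<omega>. ?k u \<omega> \<partial>P x) \<in> borel_measurable (lebI L)"
        by (rule PP.borel_measurable_lebesgue_integral) (use k_meas in \<open>simp add: case_prod_beta'\<close>)
      show "\<bar>\<integral>\<omega>. ?k u \<omega> \<partial>P x\<bar> \<le> e / 4" if "0 \<le> u" "u \<le> L" for u
        using inc[THEN bspec, OF x, THEN bspec, OF \<rho>(1), THEN mp, OF \<rho>(2), THEN spec, THEN mp, OF that(1), THEN mp, OF that(2)]
        by simp
    qed (use L in simp)
    finally show "(\<integral>\<omega>. W \<rho> \<omega> \<partial>P x) \<le> L * (e / 4)" by linarith
  qed
  show ?thesis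
  proof (intro exI[of _ "L / 2"] conjI ballI impI)
    show "0 < L / 2" using L by simp
    fix x \<tau> \<sigma> assume x: "x \<in> K" and \<tau>: "\<tau> \<in> st x" and \<sigma>: "\<sigma> \<in> st x"
      and le: "\<forall>\<omega>\<in>space (P x). \<tau> \<omega> \<le> \<sigma> \<omega> \<and> \<sigma> \<omega> \<le> \<tau> \<omega> + L / 2 \<and> \<sigma> \<omega> \<le> T"
    let ?c = "\<lambda>\<omega>. \<bar>f (X (\<sigma> \<omega>) \<omega>) - f (X (\<tau> \<omega>) \<omega>)\<bar>"
    have \<tau>T: "\<forall>\<omega>\<in>space (P x). \<tau> \<omega> \<le> T" and \<sigma>T: "\<forall>\<omega>\<in>space (P x). \<sigma> \<omega> \<le> T" using le by force+
    \<comment> \<open>For \<open>u\<close> in \<open>[0, L / 2]\<close> the time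
      \<open>\<sigma> \<omega> + u\<close> lies in the windows of length \<open>L\<close> after both
      \<open>\<tau> \<omega>\<close> and \<open>\<sigma> \<omega>\<close>. The triangle inequality
      through the value at that time, integrated over \<open>u\<close>, gives the bound.\<close>
    have point: "L / 2 * ?c \<omega> \<le> W \<tau> \<omega> + W \<sigma> \<omega>" if \<omega>: "\<omega> \<in> space (P x)" for \<omega>
    proof -
      let ?h = "\<lambda>u. f (X (max 0 u) \<omega>)"
      have [measurable]: "?h \<in> borel_measurable borel" by (rule fX_path_measurable[OF f \<omega>])
      define k where "k a u = \<bar>?h (a + u) - ?h a\<bar>" for a u
      have k_meas [measurable]: "k a \<in> borel_measurable borel" for a unfolding k_def by measurable
      have k0: "0 \<le> k a u" and k_bound: "k a u \<le> 2 * B" for a u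
        unfolding k_def using B(2)[of "X (max 0 (a + u)) \<omega>"] B(2)[of "X (max 0 a) \<omega>"] by linarith+
      have k_int: "integrable (lebI (L / 2)) (\<lambda>u. k a (b + u))" for a b
        by (rule lebI_integrable_bounded[of _ "2 * B"]) (use k0 k_bound in auto)
      have W_k: "W \<rho> \<omega> = (\<integral>u. k (\<rho> \<omega>) u \<partial>lebI L)" if "0 \<le> \<rho> \<omega>" for \<rho>
        unfolding W_def k_def using that by (intro Bochner_Integration.integral_cong[OF refl]) auto
      let ?a = "\<tau> \<omega>" and ?b = "\<sigma> \<omega>"
      have ab: "0 \<le> ?a" "?a \<le> ?b" "?b \<le> ?a + L / 2" using le \<omega> st_nonneg[OF \<tau> \<omega>] by auto
      have "L / 2 * ?c \<omega> = (\<integral>u. ?c \<omega> \<partial>lebI (L / 2))" by (rule lebI_integral_const[symmetric]) (use L in simp)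
      also have "\<dots> \<le> (\<integral>u. k ?a ((?b - ?a) + u) + k ?b (0 + u) \<partial>lebI (L / 2))"
        using ab by (intro integral_mono Bochner_Integration.integrable_add k_int
            finite_measure.integrable_const[OF finite_measure_lebI]) (auto simp: k_def max_absorb2)
      also have "\<dots> = (\<integral>u. k ?a ((?b - ?a) + u) \<partial>lebI (L / 2)) + (\<integral>u. k ?b (0 + u) \<partial>lebI (L / 2))"
        by (intro Bochner_Integration.integral_add k_int)
      also have "\<dots> \<le> (\<integral>u. k ?a u \<partial>lebI L) + (\<integral>u. k ?b u \<partial>lebI L)"
        using ab L by (intro add_mono window_integral_le[where B = "2 * B"] k_meas k0 k_bound) auto
      also have "\<dots> = W \<tau> \<omega> + W \<sigma> \<omega>" using ab by (simp add: W_k)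
      finally show ?thesis .
    qed
    have c_int: "integrable (P x) ?c"
      by (intro integrable_abs Bochner_Integration.integrable_diff fX_st_integrable \<tau> \<sigma> f)
    have "L / 2 * (\<integral>\<omega>. ?c \<omega> \<partial>P x) = (\<integral>\<omega>. L / 2 * ?c \<omega> \<partial>P x)" by simp
    also have "\<dots> \<le> (\<integral>\<omega>. W \<tau> \<omega> + W \<sigma> \<omega> \<partial>P x)"
      by (intro integral_mono integrable_mult_right c_int Bochner_Integration.integrable_add
          W(1) \<tau> \<sigma> \<tau>T \<sigma>T x point)
    also have "\<dots> = (\<integral>\<omega>. W \<tau> \<omega> \<partial>P x) + (\<integral>\<omega>. W \<sigma> \<omega> \<partial>P x)"
      by (intro Bochner_Integration.integral_add W(1) \<tau> \<sigma> \<tau>T \<sigma>T x)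
    \<comment> \<open>Each of the two windows contributes \<open>L * (e / 4)\<close>.\<close>
    also have "\<dots> \<le> L / 2 * e" using W(2)[OF \<tau> \<tau>T x] W(2)[OF \<sigma> \<sigma>T x] by simp
    finally show "(\<integral>\<omega>. ?c \<omega> \<partial>P x) \<le> e" using L by simp
  qed
qed

section \<open>Costs at bounded stopping times\<close>

text \<open>One set of constants serves the limit problem and the approximating ones, so that
  horizons and error bounds do not depend on \<open>m\<close>.\<close>

definition cost_bounds :: "real \<Rightarrow> real \<Rightarrow> real \<Rightarrow> ('e \<Rightarrow> real) \<Rightarrow> ('e \<Rightarrow> real) \<Rightarrow> bool"
  where "cost_bounds c C B g G \<longleftrightarrow> g \<in> bcontfun \<and> G \<in> bcontfun \<and> 0 < c \<and> 0 < B \<and>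
    (\<forall>y. c \<le> g y \<and> g y \<le> C \<and> 0 \<le> G y \<and> G y \<le> B)"

lemma cost_boundsD:
  assumes "cost_bounds c C B g G"
  shows "g \<in> bcontfun" "G \<in> bcontfun" "0 < c" "0 < B" "0 < C"
    "c \<le> g y" "g y \<le> C" "0 \<le> G y" "G y \<le> B" "0 \<le> g y"
  using assms unfolding cost_bounds_def by (auto dest: spec[of _ y])

abbreviation "cost \<equiv> exp_cost X"

definition run :: "('e \<Rightarrow> real) \<Rightarrow> real \<Rightarrow> 'a \<Rightarrow> real"
  where "run g t \<omega> = (LBINT s:{0..t}. g (X s \<omega>))"

definition J :: "'e \<Rightarrow> ('e \<Rightarrow> real) \<Rightarrow> ('e \<Rightarrow> real) \<Rightarrow> ('a \<Rightarrow> real) \<Rightarrow> real"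
  where "J x g G \<tau> = (\<integral>\<omega>. cost g G (\<tau> \<omega>) \<omega> \<partial>P x)"

lemma cost_eq: "cost g G t \<omega> = exp (run g t \<omega> + G (X t \<omega>))"
  by (simp add: exp_cost_def run_def)

text \<open>With \<open>max 0 s\<close> the integrand is measurable on the whole line, so running
  costs with different end points can be compared under one integral.\<close>

lemma run_lborel: "run g t \<omega> = (\<integral>s. indicator {0..t} s * g (X (max 0 s) \<omega>) \<partial>lborel)"
  unfolding run_def set_lebesgue_integral_def
  by (intro Bochner_Integration.integral_cong) (auto simp: indicator_def)

lemma run_lebI: "run g t \<omega> = (\<integral>u. g (X u \<omega>) \<partial>lebI t)"
  unfolding run_def set_lebesgue_integral_def by (subst integral_restrict_space) auto

lemma run_integrable:
  fixes g :: "'e \<Rightarrow> real"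
  assumes g: "g \<in> bcontfun" and \<omega>: "\<omega> \<in> space (P x)"
  shows "integrable lborel (\<lambda>s. indicator {a..b} s * g (X (max 0 s) \<omega>))"
proof -
  obtain B where B: "B > 0" "\<And>y. \<bar>g y\<bar> \<le> B" using bcontfun_bound[OF g] by metis
  note [measurable] = fX_path_measurable[OF g \<omega>]
  show ?thesis
  proof (rule Bochner_Integration.integrable_bound[of _ "\<lambda>u. B * indicator {a..b} u"])
    show "integrable lborel (\<lambda>u. B * indicator {a..b} u)"
      by (intro integrable_mult_right integrable_real_indicator) (auto simp: emeasure_lborel_Icc_eq)
    show "AE u in lborel. norm (indicator {a..b} u * g (X (max 0 u) \<omega>)) \<le> norm (B * indicator {a..b} u)"
      using B by (intro AE_I2) (auto simp: indicator_def)
  qed measurable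
qed

lemma run_increment:
  assumes g: "g \<in> bcontfun" "\<And>y. c \<le> g y" "\<And>y. g y \<le> C" and \<omega>: "\<omega> \<in> space (P x)" and t: "0 \<le> s" "s \<le> t"
  shows "c * (t - s) \<le> run g t \<omega> - run g s \<omega>" "run g t \<omega> - run g s \<omega> \<le> C * (t - s)"
proof -
  have eq: "run g t \<omega> - run g s \<omega> =
      (\<integral>u. indicator {0..t} u * g (X (max 0 u) \<omega>) - indicator {0..s} u * g (X (max 0 u) \<omega>) \<partial>lborel)"
    unfolding run_lborel by (intro Bochner_Integration.integral_diff[symmetric] run_integrable[OF g(1) \<omega>])
  have int: "integrable lborel (\<lambda>u. indicator {0..t} u * g (X (max 0 u) \<omega>) - indicator {0..s} u * g (X (max 0 u) \<omega>))"
    by (intro Bochner_Integration.integrable_diff run_integrable[OF g(1) \<omega>])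
  have ind: "integrable lborel (\<lambda>u. k * indicator {s<..t} u)" for k :: real
    using t by (intro integrable_mult_right integrable_real_indicator) auto
  have const: "(\<integral>u. k * indicator {s<..t} u \<partial>lborel) = k * (t - s)" for k
    using t by simp
  show "c * (t - s) \<le> run g t \<omega> - run g s \<omega>"
    unfolding eq const[symmetric] using t g
    by (intro integral_mono int ind) (auto simp: indicator_def)
  show "run g t \<omega> - run g s \<omega> \<le> C * (t - s)"
    unfolding eq const[symmetric] using t g
    by (intro integral_mono int ind) (auto simp: indicator_def)
qed

lemma run_0: "run g 0 \<omega> = 0"
proof -
  have "AE s in lborel. indicator {0..0} s * g (X (max 0 s) \<omega>) = 0"
    using AE_lborel_singleton[of "0::real"] by eventually_elim (auto simp: indicator_def)
  then show ?thesis unfolding run_lborel by (rule integral_eq_zero_AE)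
qed

lemma run_measurable:
  assumes g: "g \<in> bcontfun" and \<tau>: "\<tau> \<in> st x"
  shows "(\<lambda>\<omega>. run g (\<tau> \<omega>) \<omega>) \<in> borel_measurable (P x)"
proof -
  note [measurable] = st_measurable[OF \<tau>]
  have [measurable]: "(\<lambda>p. g (X (max 0 (snd p)) (fst p))) \<in> borel_measurable (P x \<Otimes>\<^sub>M lborel)"
    by (rule measurable_compose[OF X_at_measurable[of "\<lambda>p. max 0 (snd p)" _ fst x] bcontfun_measurable[OF g]]) auto
  have "(\<lambda>p. (if 0 \<le> snd p \<and> snd p \<le> \<tau> (fst p) then 1 else 0) * g (X (max 0 (snd p)) (fst p)))
      \<in> borel_measurable (P x \<Otimes>\<^sub>M lborel)"
    by measurable
  then have "(\<lambda>\<omega>. \<integral>s. (if 0 \<le> s \<and> s \<le> \<tau> \<omega> then 1 else 0) * g (X (max 0 s) \<omega>) \<partial>lborel) \<in> borel_measurable (P x)"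
    by (intro lborel.borel_measurable_lebesgue_integral) (simp add: case_prod_beta')
  moreover have "run g (\<tau> \<omega>) \<omega> = (\<integral>s. (if 0 \<le> s \<and> s \<le> \<tau> \<omega> then 1 else 0) * g (X (max 0 s) \<omega>) \<partial>lborel)" for \<omega>
    unfolding run_lborel by (intro Bochner_Integration.integral_cong) (auto simp: indicator_def)
  ultimately show ?thesis by simp
qed

lemma cost_measurable:
  assumes "cost_bounds c C B g G" "\<tau> \<in> st x"
  shows "(\<lambda>\<omega>. cost g G (\<tau> \<omega>) \<omega>) \<in> borel_measurable (P x)"
  unfolding cost_eq using cost_boundsD[OF assms(1)] assms(2)
  by (intro borel_measurable_exp[THEN measurable_compose[rotated]] borel_measurable_add run_measurable fX_st_measurable)

lemma cost_pos: "0 < cost g G t \<omega>" by (simp add: cost_eq)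

lemma cost_le:
  assumes cb: "cost_bounds c C B g G" and \<omega>: "\<omega> \<in> space (P x)" and t: "0 \<le> t" "t \<le> T"
  shows "cost g G t \<omega> \<le> exp (C * T + B)"
proof -
  note D = cost_boundsD[OF cb]
  have "run g t \<omega> \<le> C * t" using run_increment(2)[OF D(1,6,7) \<omega> order_refl t(1)] by (simp add: run_0)
  also have "\<dots> \<le> C * T" using t D(5) by (intro mult_left_mono) auto
  finally show ?thesis unfolding cost_eq using D(9)[of "X t \<omega>"] by simp
qed

lemma cost_integrable:
  assumes cb: "cost_bounds c C B g G" and \<tau>: "\<tau> \<in> st x" "\<forall>\<omega>\<in>space (P x). \<tau> \<omega> \<le> T"
  shows "integrable (P x) (\<lambda>\<omega>. cost g G (\<tau> \<omega>) \<omega>)"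
  using cost_le[OF cb _ st_nonneg[OF \<tau>(1)]] \<tau>(2) cost_pos
  by (intro integrable_bounded_finite[OF fin cost_measurable[OF cb \<tau>(1)], of "exp (C * T + B)"]) (auto simp: abs_of_pos)

lemma J_nonneg: "0 \<le> J x g G \<tau>"
  unfolding J_def by (intro integral_nonneg_AE AE_I2) (simp add: cost_eq)

lemma J_zero_le:
  assumes cb: "cost_bounds c C B g G" shows "J x g G (\<lambda>_. 0) \<le> exp B"
proof -
  have "J x g G (\<lambda>_. 0) \<le> exp (C * 0 + B)"
    unfolding J_def using cost_le[OF cb _ order_refl order_refl]
    by (intro prob_space.integral_le_const[OF prob] cost_integrable[OF cb st_const[OF order_refl], of _ 0] AE_I2) auto
  then show ?thesis by simp
qed

section \<open>Reduction of the stopping values to bounded stopping times\<close>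

lemma nn_integral_cost:
  assumes "cost_bounds c C B g G" "\<tau> \<in> st x" "\<forall>\<omega>\<in>space (P x). \<tau> \<omega> \<le> T"
  shows "(\<integral>\<^sup>+\<omega>. ennreal (cost g G (\<tau> \<omega>) \<omega>) \<partial>P x) = ennreal (J x g G \<tau>)"
  unfolding J_def using cost_pos
  by (intro nn_integral_eq_integral cost_integrable[OF assms] AE_I2) (auto intro: less_imp_le)

text \<open>For bounded \<open>\<tau>\<close> the sequence whose lower limit defines
  \<open>stopped_expectation\<close> is constant from \<open>N\<close> on.\<close>

lemma stopping_value_le:
  assumes cb: "cost_bounds c C B g G" and T: "T \<subseteq> st x" and \<tau>: "\<tau> \<in> T" "\<forall>\<omega>\<in>space (P x). \<tau> \<omega> \<le> real N"
  shows "stopping_value (P x) T X g G \<le> J x g G \<tau>"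
proof -
  have "(\<integral>\<^sup>+\<omega>. ennreal (cost g G (min (\<tau> \<omega>) (real n)) \<omega>) \<partial>P x) = ennreal (J x g G \<tau>)" if "n \<ge> N" for n
  proof -
    have "min (\<tau> \<omega>) (real n) = \<tau> \<omega>" if "\<omega> \<in> space (P x)" for \<omega> using \<tau>(2) that \<open>n \<ge> N\<close> by (force simp: min_def)
    then show ?thesis using nn_integral_cost[OF cb subsetD[OF T \<tau>(1)] \<tau>(2)] by (simp cong: nn_integral_cong)
  qed
  then have "(\<lambda>n. \<integral>\<^sup>+\<omega>. ennreal (cost g G (min (\<tau> \<omega>) (real n)) \<omega>) \<partial>P x) \<longlonglongrightarrow> ennreal (J x g G \<tau>)"
    by (intro tendsto_eventually) (auto simp: eventually_sequentially)
  then have "stopped_expectation (P x) (cost g G) \<tau> = ennreal (J x g G \<tau>)"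
    unfolding stopped_expectation_def by (intro lim_imp_Liminf) auto
  then have "(INF \<tau>\<in>T. stopped_expectation (P x) (cost g G) \<tau>) \<le> ennreal (J x g G \<tau>)"
    using INF_lower[OF \<tau>(1), of "stopped_expectation (P x) (cost g G)"] by simp
  then show ?thesis
    unfolding stopping_value_def using J_nonneg by (intro enn2real_leI) auto
qed

text \<open>
  Among the \<open>n\<close> windows of length \<open>S\<close> one carries at most a fraction \<open>1/n\<close> of the cost of \<open>\<tau>\<close>;
  stop at its beginning.  Beyond the window, this is no loss since \<open>B \<le> c * S\<close>.
\<close>

lemma truncate_stopping_time:
  assumes cb: "cost_bounds c C B g G" and \<tau>: "\<tau> \<in> st x" "\<forall>\<omega>\<in>space (P x). \<tau> \<omega> \<le> real N"
    and S: "B \<le> c * real S" and n: "0 < n" and small: "J x g G \<tau> \<le> exp B"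
  shows "\<exists>k<n. J x g G (\<lambda>\<omega>. min (\<tau> \<omega>) (real (k * S))) \<le> J x g G \<tau> + exp (2 * B) / real n"
proof -
  note D = cost_boundsD[OF cb]
  let ?Z = "\<lambda>\<omega>. cost g G (\<tau> \<omega>) \<omega>"
  let ?I = "\<lambda>k. {\<omega>. real (k * S) < \<tau> \<omega> \<and> \<tau> \<omega> \<le> real (Suc k * S)}"
  have Z_int: "integrable (P x) ?Z" by (rule cost_integrable[OF cb \<tau>])
  have I_int: "integrable (P x) (\<lambda>\<omega>. ?Z \<omega> * indicator (?I k) \<omega>)" for k
  proof (rule Bochner_Integration.integrable_bound[OF Z_int])
    have [measurable]: "\<tau> \<in> borel_measurable (P x)" "?Z \<in> borel_measurable (P x)"
      by (rule st_measurable[OF \<tau>(1)], rule cost_measurable[OF cb \<tau>(1)])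
    have "(\<lambda>\<omega>. ?Z \<omega> * (if real (k * S) < \<tau> \<omega> \<and> \<tau> \<omega> \<le> real (Suc k * S) then 1 else 0)) \<in> borel_measurable (P x)"
      by measurable
    then show "(\<lambda>\<omega>. ?Z \<omega> * indicator (?I k) \<omega>) \<in> borel_measurable (P x)"
      by (simp add: indicator_def)
  qed (auto simp: indicator_def)
  have "(\<Sum>k<n. \<integral>\<omega>. ?Z \<omega> * indicator (?I k) \<omega> \<partial>P x) = (\<integral>\<omega>. (\<Sum>k<n. ?Z \<omega> * indicator (?I k) \<omega>) \<partial>P x)"
    by (intro Bochner_Integration.integral_sum[symmetric] I_int)
  also have "\<dots> \<le> (\<integral>\<omega>. ?Z \<omega> \<partial>P x)"
  proof (intro integral_mono Bochner_Integration.integrable_sum I_int Z_int)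
    fix \<omega>
    \<comment> \<open>The windows are open on the left and closed on the right, hence disjoint, so
      \<open>\<tau> \<omega>\<close> falls into at most one of them.\<close>
    have "(\<Sum>k<n. indicator (?I k) \<omega>) = real (card ({..<n} \<inter> {k. \<omega> \<in> ?I k}))"
      by (simp add: indicator_def sum.If_cases)
    also have "card ({..<n} \<inter> {k. \<omega> \<in> ?I k}) \<le> 1"
    proof (rule card_le_Suc0_iff_eq[THEN iffD2, folded One_nat_def], simp, intro ballI)
      fix k l assume "k \<in> ({..<n} \<inter> {k. \<omega> \<in> ?I k})" "l \<in> ({..<n} \<inter> {k. \<omega> \<in> ?I k})"
      then have "real (k * S) < real (Suc l * S)" "real (l * S) < real (Suc k * S)" by auto
      then have "k * S < Suc l * S" "l * S < Suc k * S" by (simp_all only: of_nat_less_iff)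
      then show "k = l" by (simp only: mult_less_cancel2) linarith
    qed
    finally have "(\<Sum>k<n. indicator (?I k) \<omega>) \<le> (1::real)" by simp
    then have "?Z \<omega> * (\<Sum>k<n. indicator (?I k) \<omega>) \<le> ?Z \<omega> * 1"
      using cost_pos[of g G "\<tau> \<omega>" \<omega>] by (intro mult_left_mono) auto
    then show "(\<Sum>k<n. ?Z \<omega> * indicator (?I k) \<omega>) \<le> ?Z \<omega>" by (simp add: sum_distrib_left)
  qed
  also have "\<dots> \<le> exp B" using small by (simp add: J_def)
  finally have sum_le: "(\<Sum>k<n. \<integral>\<omega>. ?Z \<omega> * indicator (?I k) \<omega> \<partial>P x) \<le> exp B" .
  \<comment> \<open>Pigeonhole: the shares of the \<open>n\<close> windows sum to at most
    \<open>exp B\<close>.\<close>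
  have "\<exists>k<n. (\<integral>\<omega>. ?Z \<omega> * indicator (?I k) \<omega> \<partial>P x) \<le> exp B / real n"
  proof (rule ccontr)
    assume "\<not> ?thesis"
    then have "(\<Sum>k<n. exp B / real n) < (\<Sum>k<n. \<integral>\<omega>. ?Z \<omega> * indicator (?I k) \<omega> \<partial>P x)"
      using n by (intro sum_strict_mono) (auto simp: not_le)
    then show False using sum_le n by simp
  qed
  then obtain k where k: "k < n" "(\<integral>\<omega>. ?Z \<omega> * indicator (?I k) \<omega> \<partial>P x) \<le> exp B / real n" by blast
  let ?\<sigma> = "\<lambda>\<omega>. min (\<tau> \<omega>) (real (k * S))"
  have "J x g G ?\<sigma> \<le> (\<integral>\<omega>. ?Z \<omega> + exp B * (?Z \<omega> * indicator (?I k) \<omega>) \<partial>P x)"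
    unfolding J_def
  proof (rule integral_mono)
    show "integrable (P x) (\<lambda>\<omega>. cost g G (?\<sigma> \<omega>) \<omega>)"
      using \<tau>(2) by (intro cost_integrable[OF cb st_min_const[OF \<tau>(1)], of _ "real N"]) auto
    show "integrable (P x) (\<lambda>\<omega>. ?Z \<omega> + exp B * (?Z \<omega> * indicator (?I k) \<omega>))"
      by (intro Bochner_Integration.integrable_add Z_int integrable_mult_right I_int)
    fix \<omega> assume \<omega>: "\<omega> \<in> space (P x)"
    note inc = run_increment(1)[OF D(1,6,7) \<omega>]
    have Zp: "0 < ?Z \<omega>" by (rule cost_pos)
    let ?r = "real (k * S)"
    have r: "0 \<le> ?r" by simp
    consider "\<tau> \<omega> \<le> ?r" | "\<omega> \<in> ?I k" | "real (Suc k * S) < \<tau> \<omega>" by fastforce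
    then show "cost g G (?\<sigma> \<omega>) \<omega> \<le> ?Z \<omega> + exp B * (?Z \<omega> * indicator (?I k) \<omega>)"
    proof cases
      case 1
      then show ?thesis using Zp by (simp add: min_absorb1)
    next
      \<comment> \<open>Stopping at the beginning of the window lowers the running cost but may
        raise the terminal one by up to \<open>B\<close>; the factor \<open>exp B\<close> is paid on
        this event only.\<close>
      case 2
      then have "0 \<le> c * (\<tau> \<omega> - ?r)" using D(3) by (intro mult_nonneg_nonneg) auto
      then have "run g ?r \<omega> \<le> run g (\<tau> \<omega>) \<omega>" using inc[OF r, of "\<tau> \<omega>"] 2 by auto
      then have "run g ?r \<omega> + G (X ?r \<omega>) \<le> B + (run g (\<tau> \<omega>) \<omega> + G (X (\<tau> \<omega>) \<omega>))"
        using D(9)[of "X ?r \<omega>"] D(8)[of "X (\<tau> \<omega>) \<omega>"] by linarith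
      then have "cost g G ?r \<omega> \<le> exp B * ?Z \<omega>" by (simp add: cost_eq flip: exp_add)
      then show ?thesis using 2 Zp by (simp add: min_absorb2)
    next
      case 3
      then have S3: "?r + real S < \<tau> \<omega>" by simp
      have "c * real S \<le> c * (\<tau> \<omega> - ?r)" using D(3) S3 by (intro mult_left_mono) auto
      then have "run g ?r \<omega> + B \<le> run g (\<tau> \<omega>) \<omega>" using inc[OF r, of "\<tau> \<omega>"] S3 S by auto
      then have "run g ?r \<omega> + G (X ?r \<omega>) \<le> run g (\<tau> \<omega>) \<omega> + G (X (\<tau> \<omega>) \<omega>)"
        using D(9)[of "X ?r \<omega>"] D(8)[of "X (\<tau> \<omega>) \<omega>"] by linarith
      then have "cost g G ?r \<omega> \<le> ?Z \<omega>" by (simp add: cost_eq)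
      moreover have "?\<sigma> \<omega> = ?r" using S3 by simp
      moreover have "0 \<le> exp B * (?Z \<omega> * indicator (?I k) \<omega>)" using Zp by simp
      ultimately show ?thesis by simp
    qed
  qed
  also have "\<dots> = J x g G \<tau> + exp B * (\<integral>\<omega>. ?Z \<omega> * indicator (?I k) \<omega> \<partial>P x)"
    unfolding J_def using Z_int integrable_mult_right[OF I_int, of "exp B" k]
    by (simp only: Bochner_Integration.integral_add integral_mult_right_zero)
  \<comment> \<open>One factor \<open>exp B\<close> is the loss inside the window, the other the
    bound on the total cost of \<open>\<tau>\<close>.\<close>
  also have "\<dots> \<le> J x g G \<tau> + exp B * (exp B / real n)"
    using k(2) by (intro add_left_mono mult_left_mono) auto
  also have "\<dots> = J x g G \<tau> + exp (2 * B) / real n" by (simp flip: exp_add)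
  finally show ?thesis using k(1) by blast
qed

text \<open>The horizon \<open>n * S\<close> depends on neither \<open>x\<close> nor the data beyond
  \<open>c\<close> and \<open>B\<close>. It is a natural number so that the cut-off stays in the
  class \<open>T\<close> also for dyadic stopping times.\<close>

lemma near_optimal_bounded:
  assumes cb: "cost_bounds c C B g G" and T: "T \<subseteq> st x" "(\<lambda>_. 0) \<in> T"
    and T_min: "\<And>\<tau> N. \<tau> \<in> T \<Longrightarrow> (\<lambda>\<omega>. min (\<tau> \<omega>) (real N)) \<in> T"
    and S: "B \<le> c * real S" and n: "0 < n" and v: "stopping_value (P x) T X g G < v"
  shows "\<exists>\<tau>\<in>T. (\<forall>\<omega>\<in>space (P x). \<tau> \<omega> \<le> real (n * S)) \<and> J x g G \<tau> < v + exp (2 * B) / real n"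
proof -
  note D = cost_boundsD[OF cb]
  let ?V = "INF \<tau>\<in>T. stopped_expectation (P x) (cost g G) \<tau>"
  have "?V < \<infinity>" by (rule INF_exp_cost_finite[OF prob T(2) D(9)])
  then have "?V = ennreal (stopping_value (P x) T X g G)" unfolding stopping_value_def by simp
  also have "\<dots> < ennreal v" using v by (intro ennreal_lessI) (auto simp: stopping_value_def intro: le_less_trans[OF enn2real_nonneg])
  finally obtain \<rho> where \<rho>: "\<rho> \<in> T" "stopped_expectation (P x) (cost g G) \<rho> < ennreal v"
    by (auto simp: INF_less_iff)
  \<comment> \<open>A lower limit below \<open>v\<close> forces some member of the sequence below
    \<open>v\<close>, which is the cost of a bounded stopping time.\<close>
  have "\<exists>N. (\<integral>\<^sup>+\<omega>. ennreal (cost g G (min (\<rho> \<omega>) (real N)) \<omega>) \<partial>P x) < ennreal v"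
  proof (rule ccontr)
    assume "\<not> ?thesis"
    then have "ennreal v \<le> stopped_expectation (P x) (cost g G) \<rho>"
      unfolding stopped_expectation_def by (intro Liminf_bounded always_eventually) (auto simp: not_less)
    then show False using \<rho>(2) by simp
  qed
  then obtain N where N: "(\<integral>\<^sup>+\<omega>. ennreal (cost g G (min (\<rho> \<omega>) (real N)) \<omega>) \<partial>P x) < ennreal v" by blast
  define \<tau> where "\<tau> \<omega> = min (\<rho> \<omega>) (real N)" for \<omega>
  have \<tau>T: "\<tau> \<in> T" unfolding \<tau>_def[abs_def] by (rule T_min[OF \<rho>(1)])
  then have \<tau>: "\<tau> \<in> st x" using T(1) by blast
  have \<tau>N: "\<forall>\<omega>\<in>space (P x). \<tau> \<omega> \<le> real N" by (simp add: \<tau>_def)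
  have "ennreal (J x g G \<tau>) < ennreal v"
    using N nn_integral_cost[OF cb \<tau> \<tau>N] by (simp add: \<tau>_def[abs_def])
  then have Jv: "J x g G \<tau> < v" using J_nonneg by (simp add: ennreal_less_iff)
  have pos: "0 < exp (2 * B) / real n" using n by simp
  show ?thesis
  proof (cases "J x g G \<tau> \<le> exp B")
    case True
    from truncate_stopping_time[OF cb \<tau> \<tau>N S n True] obtain k where
      k: "k < n" "J x g G (\<lambda>\<omega>. min (\<tau> \<omega>) (real (k * S))) \<le> J x g G \<tau> + exp (2 * B) / real n" by blast
    have "real (k * S) \<le> real (n * S)" using k(1) by (intro of_nat_mono mult_le_mono1) simp
    then show ?thesis using k(2) Jv T_min[OF \<tau>T, of "k * S"]
      by (intro bexI[of _ "\<lambda>\<omega>. min (\<tau> \<omega>) (real (k * S))"]) (auto simp: min_le_iff_disj)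
  next
    case False
    \<comment> \<open>Here stopping at once is cheaper than \<open>\<tau>\<close>, since it costs at
      most \<open>exp B\<close>.\<close>
    then show ?thesis using J_zero_le[OF cb, of x] Jv pos T(2)
      by (intro bexI[of _ "\<lambda>_. 0"]) auto
  qed
qed

section \<open>Stability of the cost under changes of the data and of the stopping time\<close>

lemma J_terminal_le:
  assumes cb: "cost_bounds c C B g G" "cost_bounds c C B g H" and \<tau>: "\<tau> \<in> st x" "\<forall>\<omega>\<in>space (P x). \<tau> \<omega> \<le> T"
    and le: "\<And>y. H y \<le> G y + \<eta>"
  shows "J x g H \<tau> \<le> exp \<eta> * J x g G \<tau>"
proof -
  have "J x g H \<tau> \<le> (\<integral>\<omega>. exp \<eta> * cost g G (\<tau> \<omega>) \<omega> \<partial>P x)"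
    unfolding J_def using le
    by (intro integral_mono integrable_mult_right cost_integrable[OF cb(1) \<tau>] cost_integrable[OF cb(2) \<tau>])
      (auto simp: cost_eq algebra_simps simp flip: exp_add)
  then show ?thesis by (simp add: J_def)
qed

lemma J_running_mono:
  assumes cb: "cost_bounds c C B g G" "cost_bounds c C B h G" and \<tau>: "\<tau> \<in> st x" "\<forall>\<omega>\<in>space (P x). \<tau> \<omega> \<le> T"
    and le: "\<And>y. h y \<le> g y"
  shows "J x h G \<tau> \<le> J x g G \<tau>"
  unfolding J_def
proof (rule integral_mono[OF cost_integrable[OF cb(2) \<tau>] cost_integrable[OF cb(1) \<tau>]])
  fix \<omega> assume \<omega>: "\<omega> \<in> space (P x)"
  have "run h (\<tau> \<omega>) \<omega> \<le> run g (\<tau> \<omega>) \<omega>"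
    unfolding run_lborel using le cost_boundsD(1)[OF cb(1)] cost_boundsD(1)[OF cb(2)]
    by (intro integral_mono run_integrable[OF _ \<omega>] mult_left_mono) auto
  then show "cost h G (\<tau> \<omega>) \<omega> \<le> cost g G (\<tau> \<omega>) \<omega>" by (simp add: cost_eq)
qed

text \<open>By convexity of \<open>exp\<close> the cost difference is at most the larger cost,
  bounded by \<open>exp (C * T + B)\<close>, times the difference of running costs. As
  \<open>g - h\<close> is nonnegative, its integral may be extended to \<open>T\<close>, which
  removes \<open>\<tau>\<close> from the error.\<close>

lemma J_running_le:
  assumes cb: "cost_bounds c C B g G" "cost_bounds c C B h G" and \<tau>: "\<tau> \<in> st x" "\<forall>\<omega>\<in>space (P x). \<tau> \<omega> \<le> T"
    and le: "\<And>y. h y \<le> g y"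
  shows "J x g G \<tau> \<le> J x h G \<tau> + exp (C * T + B) * U T (\<lambda>y. g y - h y) x"
proof -
  note g = cost_boundsD(1)[OF cb(1)] and h = cost_boundsD(1)[OF cb(2)]
  have d: "(\<lambda>y. g y - h y) \<in> bcontfun" by (rule minus_cont[OF g h])
  obtain \<omega>0 where "\<omega>0 \<in> space (P x)" using prob_space.not_empty[OF prob[of x]] by blast
  then have T: "0 \<le> T" using \<tau>(2) st_nonneg[OF \<tau>(1)] order_trans by blast
  let ?R = "\<lambda>\<omega>. run (\<lambda>y. g y - h y) T \<omega>"
  have R_bound: "\<bar>?R \<omega>\<bar> \<le> C * T" if \<omega>: "\<omega> \<in> space (P x)" for \<omega>
  proof -
    have lo: "0 \<le> g y - h y" and hi: "g y - h y \<le> C" for y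
      using le[of y] cost_boundsD(7)[OF cb(1), of y] cost_boundsD(10)[OF cb(2), of y] by linarith+
    show ?thesis using run_increment[OF d lo hi \<omega> order_refl T] by (simp add: run_0)
  qed
  have R_int: "integrable (P x) ?R"
    by (rule integrable_bounded_finite[OF fin run_measurable[OF d st_const[OF T]] R_bound])
  have "J x g G \<tau> \<le> (\<integral>\<omega>. cost h G (\<tau> \<omega>) \<omega> + exp (C * T + B) * ?R \<omega> \<partial>P x)"
    unfolding J_def
  proof (rule integral_mono[OF cost_integrable[OF cb(1) \<tau>]])
    show "integrable (P x) (\<lambda>\<omega>. cost h G (\<tau> \<omega>) \<omega> + exp (C * T + B) * ?R \<omega>)"
      by (intro Bochner_Integration.integrable_add cost_integrable[OF cb(2) \<tau>] integrable_mult_right R_int)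
    fix \<omega> assume \<omega>: "\<omega> \<in> space (P x)"
    have "run g (\<tau> \<omega>) \<omega> - run h (\<tau> \<omega>) \<omega> = run (\<lambda>y. g y - h y) (\<tau> \<omega>) \<omega>"
      unfolding run_lborel
      by (subst Bochner_Integration.integral_diff[symmetric]) (auto intro: run_integrable[OF _ \<omega>] g h simp: algebra_simps)
    also have "\<dots> \<le> ?R \<omega>"
      unfolding run_lborel using le \<tau>(2) \<omega>
      by (intro integral_mono run_integrable[OF d \<omega>]) (force simp: indicator_def)
    finally have diff: "run g (\<tau> \<omega>) \<omega> - run h (\<tau> \<omega>) \<omega> \<le> ?R \<omega>" .
    have "0 * (T - 0) \<le> ?R \<omega> - run (\<lambda>y. g y - h y) 0 \<omega>"
      using le cost_boundsD(7)[OF cb(1)] cost_boundsD(10)[OF cb(2)]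
      by (intro run_increment(1)[OF d _ _ \<omega> order_refl T, of _ "C"]) (auto simp: algebra_simps intro: order_trans add_increasing2)
    then have R0: "0 \<le> ?R \<omega>" by (simp add: run_0)
    have "cost g G (\<tau> \<omega>) \<omega> - cost h G (\<tau> \<omega>) \<omega> \<le> cost g G (\<tau> \<omega>) \<omega> * (run g (\<tau> \<omega>) \<omega> - run h (\<tau> \<omega>) \<omega>)"
      unfolding cost_eq by (rule order_trans[OF exp_diff_le]) simp
    also have "\<dots> \<le> cost g G (\<tau> \<omega>) \<omega> * ?R \<omega>"
      using diff cost_pos[of g G "\<tau> \<omega>" \<omega>] by (intro mult_left_mono) auto
    also have "\<dots> \<le> exp (C * T + B) * ?R \<omega>"
      using \<tau>(2) \<omega> R0 by (intro mult_right_mono cost_le[OF cb(1) \<omega> st_nonneg[OF \<tau>(1) \<omega>]]) auto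
    finally show "cost g G (\<tau> \<omega>) \<omega> \<le> cost h G (\<tau> \<omega>) \<omega> + exp (C * T + B) * ?R \<omega>" by simp
  qed
  also have "\<dots> = J x h G \<tau> + exp (C * T + B) * (\<integral>\<omega>. ?R \<omega> \<partial>P x)"
    unfolding J_def using cost_integrable[OF cb(2) \<tau>] integrable_mult_right[OF R_int, of "exp (C * T + B)"]
    by (simp only: Bochner_Integration.integral_add integral_mult_right_zero)
  also have "(\<integral>\<omega>. ?R \<omega> \<partial>P x) = U T (\<lambda>y. g y - h y) x" using U_path[OF d] by (simp add: run_lebI)
  finally show ?thesis .
qed

text \<open>Waiting adds at most \<open>C * \<delta>\<close> to the running cost, whence the outer
  factor. The change of terminal cost is weighted by the running cost up to \<open>\<tau>\<close>
  and left as a first moment, the form controlled by \<open>nearby_stopping_times\<close>.\<close>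

lemma J_later_le:
  assumes cb: "cost_bounds c C B g G" and \<tau>: "\<tau> \<in> st x" and \<sigma>: "\<sigma> \<in> st x"
    and le: "\<forall>\<omega>\<in>space (P x). \<tau> \<omega> \<le> \<sigma> \<omega> \<and> \<sigma> \<omega> \<le> \<tau> \<omega> + \<delta> \<and> \<sigma> \<omega> \<le> T"
  shows "J x g G \<sigma> \<le> exp (C * \<delta>) * (J x g G \<tau> +
    exp (C * T) * (\<integral>\<omega>. \<bar>exp (G (X (\<sigma> \<omega>) \<omega>)) - exp (G (X (\<tau> \<omega>) \<omega>))\<bar> \<partial>P x))"
proof -
  note D = cost_boundsD[OF cb]
  have \<tau>T: "\<forall>\<omega>\<in>space (P x). \<tau> \<omega> \<le> T" and \<sigma>T: "\<forall>\<omega>\<in>space (P x). \<sigma> \<omega> \<le> T" using le by force+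
  let ?d = "\<lambda>\<omega>. \<bar>exp (G (X (\<sigma> \<omega>) \<omega>)) - exp (G (X (\<tau> \<omega>) \<omega>))\<bar>"
  have eG: "(\<lambda>y. exp (G y)) \<in> bcontfun"
    by (rule bcontfun_exp[OF D(2,9)])
  have d_int: "integrable (P x) ?d"
    by (intro integrable_abs Bochner_Integration.integrable_diff fX_st_integrable[OF \<tau> eG] fX_st_integrable[OF \<sigma> eG])
  have "J x g G \<sigma> \<le> (\<integral>\<omega>. exp (C * \<delta>) * (cost g G (\<tau> \<omega>) \<omega> + exp (C * T) * ?d \<omega>) \<partial>P x)"
    unfolding J_def
  proof (rule integral_mono[OF cost_integrable[OF cb \<sigma> \<sigma>T]])
    show "integrable (P x) (\<lambda>\<omega>. exp (C * \<delta>) * (cost g G (\<tau> \<omega>) \<omega> + exp (C * T) * ?d \<omega>))"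
      by (intro integrable_mult_right Bochner_Integration.integrable_add cost_integrable[OF cb \<tau> \<tau>T] d_int)
    fix \<omega> assume \<omega>: "\<omega> \<in> space (P x)"
    have \<tau>0: "0 \<le> \<tau> \<omega>" by (rule st_nonneg[OF \<tau> \<omega>])
    have "run g (\<sigma> \<omega>) \<omega> - run g (\<tau> \<omega>) \<omega> \<le> C * (\<sigma> \<omega> - \<tau> \<omega>)"
      using le \<omega> by (intro run_increment(2)[OF D(1,6,7) \<omega> \<tau>0]) auto
    also have "\<dots> \<le> C * \<delta>" using le \<omega> D(5) by (intro mult_left_mono) (auto simp: algebra_simps)
    finally have r1: "run g (\<sigma> \<omega>) \<omega> \<le> C * \<delta> + run g (\<tau> \<omega>) \<omega>" by simp
    have "run g (\<tau> \<omega>) \<omega> \<le> C * \<tau> \<omega>" using run_increment(2)[OF D(1,6,7) \<omega> order_refl \<tau>0] by (simp add: run_0)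
    also have "\<dots> \<le> C * T" using \<tau>T \<omega> D(5) by (intro mult_left_mono) auto
    finally have r2: "run g (\<tau> \<omega>) \<omega> \<le> C * T" .
    have "cost g G (\<sigma> \<omega>) \<omega> = exp (run g (\<sigma> \<omega>) \<omega>) * exp (G (X (\<sigma> \<omega>) \<omega>))" by (simp add: cost_eq exp_add)
    also have "\<dots> \<le> exp (C * \<delta> + run g (\<tau> \<omega>) \<omega>) * (exp (G (X (\<tau> \<omega>) \<omega>)) + ?d \<omega>)"
      using r1 by (intro mult_mono) auto
    also have "\<dots> = exp (C * \<delta>) * (cost g G (\<tau> \<omega>) \<omega> + exp (run g (\<tau> \<omega>) \<omega>) * ?d \<omega>)"
      by (simp add: cost_eq exp_add algebra_simps)
    also have "\<dots> \<le> exp (C * \<delta>) * (cost g G (\<tau> \<omega>) \<omega> + exp (C * T) * ?d \<omega>)"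
      using r2 by (intro mult_left_mono add_left_mono mult_right_mono) auto
    finally show "cost g G (\<sigma> \<omega>) \<omega> \<le> exp (C * \<delta>) * (cost g G (\<tau> \<omega>) \<omega> + exp (C * T) * ?d \<omega>)" .
  qed
  also have "\<dots> = exp (C * \<delta>) * (J x g G \<tau> + exp (C * T) * (\<integral>\<omega>. ?d \<omega> \<partial>P x))"
    unfolding J_def using cost_integrable[OF cb \<tau> \<tau>T] integrable_mult_right[OF d_int, of "exp (C * T)"]
    by (simp only: Bochner_Integration.integral_add integral_mult_right_zero)
  finally show ?thesis .
qed

section \<open>Truncation and rounding on the dyadic grid\<close>

lemma dyadic_subset: "dyadic_stopping_times m (P x) (F x) \<subseteq> st x"
  by (auto simp: dyadic_stopping_times_def)

lemma dyadic_min_nat: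
  assumes "\<tau> \<in> dyadic_stopping_times m (P x) (F x)"
  shows "(\<lambda>\<omega>. min (\<tau> \<omega>) (real N)) \<in> dyadic_stopping_times m (P x) (F x)"
proof -
  have "real N = real (N * 2 ^ m) * (1/2) ^ m" by (simp add: power_one_over)
  then have "\<exists>k. real N = real k * (1/2) ^ m" by blast
  then have "\<exists>k::nat. min (\<tau> \<omega>) (real N) = real k * (1/2) ^ m" if "\<omega> \<in> space (P x)" for \<omega>
    using assms that by (auto simp: dyadic_stopping_times_def min_def)
  then show ?thesis using assms st_min_const[of \<tau> x "real N"] by (auto simp: dyadic_stopping_times_def)
qed

lemma dyadic_round_up:
  assumes \<tau>: "\<tau> \<in> st x" and N: "\<forall>\<omega>\<in>space (P x). \<tau> \<omega> \<le> real N"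
  shows "\<exists>\<sigma>\<in>dyadic_stopping_times m (P x) (F x).
    \<forall>\<omega>\<in>space (P x). \<tau> \<omega> \<le> \<sigma> \<omega> \<and> \<sigma> \<omega> \<le> \<tau> \<omega> + (1/2) ^ m \<and> \<sigma> \<omega> \<le> real N"
proof -
  define \<sigma> where "\<sigma> \<omega> = of_int \<lceil>\<tau> \<omega> * 2 ^ m\<rceil> * (1/2::real) ^ m" for \<omega>
  have p: "(1/2::real) ^ m = 1 / 2 ^ m" by (simp add: power_one_over)
  \<comment> \<open>The rounded-up time is at most \<open>t\<close> exactly when
    \<open>\<tau>\<close> is at most the largest grid point not exceeding \<open>t\<close>; this
    event is known at time \<open>t\<close>.\<close>
  have iff: "\<sigma> \<omega> \<le> t \<longleftrightarrow> \<tau> \<omega> \<le> of_int \<lfloor>t * 2 ^ m\<rfloor> / 2 ^ m" for \<omega> t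
  proof -
    have "\<sigma> \<omega> \<le> t \<longleftrightarrow> of_int \<lceil>\<tau> \<omega> * 2 ^ m\<rceil> \<le> t * 2 ^ m" by (simp add: \<sigma>_def p pos_divide_le_eq)
    also have "\<dots> \<longleftrightarrow> \<tau> \<omega> * 2 ^ m \<le> of_int \<lfloor>t * 2 ^ m\<rfloor>" by (simp add: le_floor_iff ceiling_le_iff flip: le_floor_iff)
    also have "\<dots> \<longleftrightarrow> \<tau> \<omega> \<le> of_int \<lfloor>t * 2 ^ m\<rfloor> / 2 ^ m" by (simp add: pos_le_divide_eq)
    finally show ?thesis .
  qed
  have "stopping_time (F x) \<sigma>"
    unfolding stopping_time_def iff
  proof
    fix t :: real
    have "of_int \<lfloor>t * 2 ^ m\<rfloor> / 2 ^ m \<le> t" by (simp add: pos_divide_le_eq)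
    then show "Measurable.pred (F x t) (\<lambda>\<omega>. \<tau> \<omega> \<le> of_int \<lfloor>t * 2 ^ m\<rfloor> / 2 ^ m)"
      by (rule filtration.stopping_time_le_const[OF filt st_stopping[OF \<tau>]])
  qed
  moreover have ge: "\<tau> \<omega> \<le> \<sigma> \<omega>" for \<omega>
    by (simp add: \<sigma>_def p pos_le_divide_eq)
  moreover have "\<exists>k::nat. \<sigma> \<omega> = real k * (1/2) ^ m" if "\<omega> \<in> space (P x)" for \<omega>
  proof -
    have "0 \<le> \<lceil>\<tau> \<omega> * 2 ^ m\<rceil>" using st_nonneg[OF \<tau> that] by (simp add: order_less_le_trans[of _ 0])
    then show ?thesis unfolding \<sigma>_def by (intro exI[of _ "nat \<lceil>\<tau> \<omega> * 2 ^ m\<rceil>"]) simp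
  qed
  moreover have "0 \<le> \<sigma> \<omega>" if "\<omega> \<in> space (P x)" for \<omega>
    by (rule order_trans[OF st_nonneg[OF \<tau> that] ge])
  ultimately have "\<sigma> \<in> dyadic_stopping_times m (P x) (F x)"
    by (simp add: dyadic_stopping_times_def stopping_times_def)
  moreover have "\<sigma> \<omega> \<le> \<tau> \<omega> + (1/2) ^ m" for \<omega>
  proof -
    have "of_int \<lceil>\<tau> \<omega> * 2 ^ m\<rceil> \<le> \<tau> \<omega> * 2 ^ m + 1" by linarith
    then show ?thesis by (simp add: \<sigma>_def p pos_divide_le_eq algebra_simps)
  qed
  moreover have "\<sigma> \<omega> \<le> real N" if "\<omega> \<in> space (P x)" for \<omega>
  proof -
    \<comment> \<open>\<open>N\<close> is itself a grid point, so rounding up does not leave the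
      horizon.\<close>
    have "\<lfloor>real N * 2 ^ m\<rfloor> = int (N * 2 ^ m)" by (metis floor_of_nat of_nat_mult of_nat_numeral of_nat_power)
    then show ?thesis using N that by (simp add: iff)
  qed
  ultimately show ?thesis using ge by blast
qed

end

section \<open>Convergence of the values\<close>

theorem theorem5p1:
  fixes P :: "'e::{metric_space, second_countable_topology} \<Rightarrow> 'a measure"
    and F :: "'e \<Rightarrow> real \<Rightarrow> 'a measure"
    and X :: "real \<Rightarrow> 'a \<Rightarrow> 'e"
    and g G :: "'e \<Rightarrow> real"
    and gs Gs :: "nat \<Rightarrow> 'e \<Rightarrow> real"
    and w :: "'e \<Rightarrow> real" and ws :: "nat \<Rightarrow> 'e \<Rightarrow> real"
    and c c0 :: real
  assumes "locally_compact_space (euclidean :: 'e topology)"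
    and "standard_markov_process P F X"
    and "C0_feller P X"
    and "g \<in> bcontfun" and "c > 0" and "\<And>x. g x \<ge> c"
    and "G \<in> bcontfun" and "\<And>x. G x \<ge> 0"
    and "\<And>m. gs m \<in> bcontfun" and "\<And>m. Gs m \<in> bcontfun"
    and "\<And>x. incseq (\<lambda>m. gs m x)" and "\<And>x. (\<lambda>m. gs m x) \<longlonglongrightarrow> g x"
    and "c0 > 0" and "\<And>x. gs 0 x \<ge> c0"
    and "uniform_limit UNIV Gs G sequentially" and "\<And>m x. Gs m x \<ge> 0"
    and w: "\<And>x. w x = stopping_value (P x) (stopping_times (P x) (F x)) X g G"
    and ws: "\<And>m x. ws m x =
      stopping_value (P x) (dyadic_stopping_times m (P x) (F x)) X (gs m) (Gs m)"
  shows "\<forall>K. compact K \<longrightarrow> uniform_limit K ws w sequentially"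
proof (intro allI impI)
  fix K :: "'e set" assume K: "compact K"
  note g_bc = assms(4) and G_bc = assms(7) and G_nonneg = assms(8) and gs_bc = assms(9)
    and Gs_bc = assms(10) and gs_inc = assms(11) and gs_lim = assms(12) and c0 = assms(13)
    and Gs_lim = assms(15) and Gs_nonneg = assms(16)
  obtain \<phi> :: "nat \<Rightarrow> 'e \<Rightarrow> real" where "cutoff \<phi>" using locally_compact_cutoff[OF assms(1)] by blast
  then interpret feller_process P F X \<phi>
    by (intro feller_process.intro feller_process_axioms.intro assms(2,3))
  obtain C where C: "C > 0" "\<And>y. \<bar>g y\<bar> \<le> C" using bcontfun_bound[OF g_bc] by metis
  obtain B' where B': "B' > 0" "\<And>y. \<bar>G y\<bar> \<le> B'" using bcontfun_bound[OF G_bc] by metis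
  \<comment> \<open>The extra 1 leaves room for \<open>Gs m\<close>, which lies below
    \<open>G + 1\<close> for large \<open>m\<close>.\<close>
  define B where "B = B' + 1"
  have B: "B > 0" using B'(1) by (simp add: B_def)
  have gs_le: "gs m y \<le> g y" for m y by (rule incseq_le[OF gs_inc gs_lim])
  have gs_ge: "c0 \<le> gs m y" for m y
    using assms(14)[of y] incseqD[OF gs_inc[of y], of 0 m] by simp
  have cb: "cost_bounds c0 C B h H"
    if "h \<in> bcontfun" "H \<in> bcontfun" "\<And>y. gs 0 y \<le> h y" "\<And>y. h y \<le> g y" "\<And>y. 0 \<le> H y" "\<And>y. H y \<le> G y + 1" for h H
    unfolding cost_bounds_def
  proof (intro conjI allI that c0 B)
    fix y
    show "c0 \<le> h y" using that(3)[of y] gs_ge[of 0 y] by linarith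
    show "h y \<le> C" using that(4)[of y] C(2)[of y] by linarith
    show "H y \<le> B" using that(6)[of y] B'(2)[of y] by (simp add: B_def)
  qed
  have gs_0: "gs 0 y \<le> gs m y" for m y using gs_inc[of y] by (simp add: incseq_def)
  have cb_gG: "cost_bounds c0 C B g G" by (rule cb[OF g_bc G_bc]) (use gs_le G_nonneg in auto)
  show "uniform_limit K ws w sequentially"
  proof (rule uniform_limitI)
    fix \<epsilon> :: real assume \<epsilon>: "\<epsilon> > 0"
    \<comment> \<open>Both one-sided estimates below have error \<open>4 * e\<close>, strictly less
      than \<open>\<epsilon>\<close>.\<close>
    define e where "e = \<epsilon> / 5"
    have e: "e > 0" using \<epsilon> by (simp add: e_def)
    obtain S :: nat where "B / c0 \<le> real S" using real_arch_simple by blast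
    then have S: "B \<le> c0 * real S" using c0 by (simp add: pos_divide_le_eq mult.commute)
    obtain n :: nat where "exp (2 * B) / e < real n" using reals_Archimedean2 by blast
    moreover from this have n: "0 < n" using e by (cases n) (auto simp: divide_less_0_iff not_less[symmetric])
    ultimately have n_small: "exp (2 * B) / real n < e" using e by (simp add: field_simps)
    define N where "N = n * S"
    define T where "T = real N"
    have T: "0 \<le> T" by (simp add: T_def)
    have "e / exp (C * T) > 0" using e by simp
    from nearby_stopping_times[OF bcontfun_exp[OF G_bc cost_boundsD(9)[OF cb_gG]] K T this]
    obtain d where d: "d > 0" and near: "\<forall>x\<in>K. \<forall>\<tau>\<in>st x. \<forall>\<sigma>\<in>st x.
      (\<forall>\<omega>\<in>space (P x). \<tau> \<omega> \<le> \<sigma> \<omega> \<and> \<sigma> \<omega> \<le> \<tau> \<omega> + d \<and> \<sigma> \<omega> \<le> T) \<longrightarrow>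
      (\<integral>\<omega>. \<bar>exp (G (X (\<sigma> \<omega>) \<omega>)) - exp (G (X (\<tau> \<omega>) \<omega>))\<bar> \<partial>P x) \<le> e / exp (C * T)"
      by (elim exE conjE)
    \<comment> \<open>Changing the terminal cost produces multiplicative errors. This factor is
      close enough to 1 to cost only one further \<open>e\<close> for every value up to
      \<open>exp B\<close>, a bound valid for \<open>w\<close> and \<open>ws m\<close>.\<close>
    define \<theta> where "\<theta> = 1 + e / (exp B + 3 * e)"
    have den: "exp B + 3 * e > 0" using e by (intro add_pos_pos) auto
    have \<theta>: "\<theta> > 1" using e den by (simp add: \<theta>_def)
    \<comment> \<open>Half the logarithm, since the upper estimate uses two factors
      \<open>exp \<eta>\<close>: one for replacing \<open>Gs m\<close> by \<open>G\<close>, one for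
      the running cost added by rounding.\<close>
    define \<eta> where "\<eta> = ln \<theta> / 2"
    have \<eta>: "\<eta> > 0" using \<theta> by (simp add: \<eta>_def)
    have \<eta>\<theta>: "exp \<eta> * exp \<eta> = \<theta>" using \<theta> by (simp add: \<eta>_def flip: exp_add)
    have \<theta>_le: "\<theta> * (v + 3 * e) \<le> v + 4 * e" if "v \<le> exp B" for v
    proof -
      have "e / (exp B + 3 * e) * (v + 3 * e) \<le> e / (exp B + 3 * e) * (exp B + 3 * e)"
        using that e den by (intro mult_left_mono) auto
      then show ?thesis using den by (simp add: \<theta>_def distrib_right)
    qed
    have "uniform_limit K (\<lambda>m. U T (\<lambda>y. g y - gs m y)) (\<lambda>_. 0) sequentially"
    proof (rule dini_decreasing[OF K])
      have bc: "(\<lambda>y. g y - gs m y) \<in> bcontfun" for m by (rule minus_cont[OF g_bc gs_bc])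
      show "continuous_on K (U T (\<lambda>y. g y - gs m y))" for m
        by (rule continuous_on_subset[OF U_continuous[OF bc]]) simp
      show "decseq (\<lambda>m. U T (\<lambda>y. g y - gs m y) x)" for x
        unfolding decseq_def using gs_inc by (intro allI impI U_mono bc) (auto simp: incseq_def)
      have "\<bar>g y - gs m y\<bar> \<le> C" for m y
        using gs_le[of m y] gs_ge[of m y] C(2)[of y] c0 by linarith
      moreover have "(\<lambda>m. g y - gs m y) \<longlonglongrightarrow> 0" for y
        using tendsto_diff[OF tendsto_const gs_lim[of y], of "g y"] by simp
      ultimately have lim: "(\<lambda>m. U T (\<lambda>y. g y - gs m y) x) \<longlonglongrightarrow> U T (\<lambda>_. 0) x" for x
        by (intro U_tendsto[where B = C] bc const_bcontfun)
      then show "(\<lambda>m. U T (\<lambda>y. g y - gs m y) x) \<longlonglongrightarrow> 0" for x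
        using lim[of x] U_const[OF T, of 0 x] by simp
    qed
    then have ev_U: "\<forall>\<^sub>F m in sequentially. \<forall>x\<in>K. dist (U T (\<lambda>y. g y - gs m y) x) 0 < e / exp (C * T + B)"
      using e by (intro uniform_limitD) auto
    \<comment> \<open>The bound 1 secures the common cost bound \<open>B\<close>; the bound
      \<open>\<eta>\<close> gives the multiplicative estimate.\<close>
    have ev_G: "\<forall>\<^sub>F m in sequentially. \<forall>y\<in>UNIV. dist (Gs m y) (G y) < min 1 \<eta>"
      using \<eta> by (intro uniform_limitD[OF Gs_lim]) auto
    have "(\<lambda>m. (1/2::real) ^ m) \<longlonglongrightarrow> 0" by (rule LIMSEQ_realpow_zero) auto
    \<comment> \<open>The mesh must be below \<open>d\<close> for the terminal cost and below
      \<open>\<eta> / C\<close> for the running cost gained by rounding up.\<close>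
    then have ev_\<delta>: "\<forall>\<^sub>F m in sequentially. (1/2::real) ^ m < min d (\<eta> / C)"
      using d \<eta> C(1) by (intro order_tendstoD(2)) auto
    show "\<forall>\<^sub>F m in sequentially. \<forall>x\<in>K. dist (ws m x) (w x) < \<epsilon>"
      using ev_U ev_G ev_\<delta>
    proof eventually_elim
      case (elim m)
      have Gs_close: "Gs m y \<le> G y + \<eta>" "G y \<le> Gs m y + \<eta>" "Gs m y \<le> G y + 1" for y
        using elim(2)[rule_format, of y] by (auto simp: dist_real_def)
      have cb_gGs: "cost_bounds c0 C B g (Gs m)"
        by (rule cb[OF g_bc Gs_bc]) (use gs_le Gs_nonneg Gs_close in auto)
      have cb_gsGs: "cost_bounds c0 C B (gs m) (Gs m)"
        by (rule cb[OF gs_bc Gs_bc]) (use gs_le gs_0 Gs_nonneg Gs_close in auto)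
      have C\<delta>: "C * (1/2) ^ m \<le> \<eta>" using elim(3) C(1) by (simp add: field_simps)
      show ?case
      proof
        fix x assume x: "x \<in> K"
        let ?D = "dyadic_stopping_times m (P x) (F x)"
        have w_le: "w x \<le> exp B"
          using stopping_value_le[OF cb_gG subset_refl zero_in_stopping_times, of x 0] J_zero_le[OF cb_gG, of x]
          by (simp add: w)
        have ws_le: "ws m x \<le> exp B"
          using stopping_value_le[OF cb_gsGs dyadic_subset[of m x] zero_in_dyadic_stopping_times, of 0] J_zero_le[OF cb_gsGs, of x]
          by (simp add: ws)
        \<comment> \<open>A near-optimal bounded \<open>\<tau>\<close> for \<open>w\<close> is
          rounded up to the grid, and \<open>gs m \<le> g\<close> helps. The \<open>3 * e\<close>
          consist of near-optimality, truncation to the horizon, and the change of terminal cost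
          between \<open>\<tau>\<close> and \<open>\<sigma>\<close>.\<close>
        have upper: "ws m x \<le> w x + 4 * e"
        proof -
          have "stopping_value (P x) (st x) X g G < w x + e" using e by (simp add: w)
          from near_optimal_bounded[OF cb_gG subset_refl zero_in_stopping_times st_min_const S n this]
          obtain \<tau> where \<tau>: "\<tau> \<in> st x" "\<forall>\<omega>\<in>space (P x). \<tau> \<omega> \<le> real N" "J x g G \<tau> < w x + e + exp (2 * B) / real n"
            by (auto simp: N_def)
          from dyadic_round_up[OF \<tau>(1,2), of m] obtain \<sigma> where \<sigma>: "\<sigma> \<in> ?D"
            "\<forall>\<omega>\<in>space (P x). \<tau> \<omega> \<le> \<sigma> \<omega> \<and> \<sigma> \<omega> \<le> \<tau> \<omega> + (1/2) ^ m \<and> \<sigma> \<omega> \<le> T"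
            by (auto simp: T_def)
          have \<sigma>_st: "\<sigma> \<in> st x" using \<sigma>(1) dyadic_subset by blast
          have \<sigma>T: "\<forall>\<omega>\<in>space (P x). \<sigma> \<omega> \<le> T" and \<sigma>N: "\<forall>\<omega>\<in>space (P x). \<sigma> \<omega> \<le> real N"
            using \<sigma>(2) by (auto simp: T_def)
          have \<sigma>d: "\<forall>\<omega>\<in>space (P x). \<tau> \<omega> \<le> \<sigma> \<omega> \<and> \<sigma> \<omega> \<le> \<tau> \<omega> + d \<and> \<sigma> \<omega> \<le> T"
          proof
            fix \<omega> assume "\<omega> \<in> space (P x)"
            then show "\<tau> \<omega> \<le> \<sigma> \<omega> \<and> \<sigma> \<omega> \<le> \<tau> \<omega> + d \<and> \<sigma> \<omega> \<le> T" using \<sigma>(2) elim(3) by fastforce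
          qed
          let ?I = "\<integral>\<omega>. \<bar>exp (G (X (\<sigma> \<omega>) \<omega>)) - exp (G (X (\<tau> \<omega>) \<omega>))\<bar> \<partial>P x"
          have "?I \<le> e / exp (C * T)"
            by (rule near[THEN bspec, OF x, THEN bspec, OF \<tau>(1), THEN bspec, OF \<sigma>_st, THEN mp, OF \<sigma>d])
          then have "exp (C * T) * ?I \<le> exp (C * T) * (e / exp (C * T))" by (intro mult_left_mono) auto
          then have I: "exp (C * T) * ?I \<le> e" by simp
          have "ws m x \<le> J x (gs m) (Gs m) \<sigma>"
            unfolding ws by (rule stopping_value_le[OF cb_gsGs dyadic_subset \<sigma>(1) \<sigma>N])
          also have "\<dots> \<le> J x g (Gs m) \<sigma>"
            by (rule J_running_mono[OF cb_gGs cb_gsGs \<sigma>_st \<sigma>T gs_le])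
          also have "\<dots> \<le> exp \<eta> * J x g G \<sigma>"
            by (rule J_terminal_le[OF cb_gG cb_gGs \<sigma>_st \<sigma>T Gs_close(1)])
          also have "\<dots> \<le> exp \<eta> * (exp (C * (1/2) ^ m) * (J x g G \<tau> + exp (C * T) * ?I))"
            by (intro mult_left_mono J_later_le[OF cb_gG \<tau>(1) \<sigma>_st \<sigma>(2)]) auto
          also have "\<dots> \<le> exp \<eta> * (exp \<eta> * (w x + 3 * e))"
          proof (intro mult_left_mono mult_mono)
            show "J x g G \<tau> + exp (C * T) * ?I \<le> w x + 3 * e" using \<tau>(3) n_small I by linarith
            show "0 \<le> J x g G \<tau> + exp (C * T) * ?I" using J_nonneg by (intro add_nonneg_nonneg) auto
          qed (use C\<delta> in auto)
          also have "\<dots> = \<theta> * (w x + 3 * e)" using \<eta>\<theta> by (simp add: mult.assoc[symmetric])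
          also have "\<dots> \<le> w x + 4 * e" by (rule \<theta>_le[OF w_le])
          finally show ?thesis .
        qed
        \<comment> \<open>A dyadic stopping time is admissible for \<open>w\<close> as it stands.
          The third \<open>e\<close> now pays for replacing \<open>gs m\<close> by \<open>g\<close>
          up to time \<open>T\<close>.\<close>
        have lower: "w x \<le> ws m x + 4 * e"
        proof -
          have "stopping_value (P x) ?D X (gs m) (Gs m) < ws m x + e" using e by (simp add: ws)
          from near_optimal_bounded[OF cb_gsGs dyadic_subset zero_in_dyadic_stopping_times dyadic_min_nat S n this]
          obtain \<tau> where \<tau>: "\<tau> \<in> ?D" "\<forall>\<omega>\<in>space (P x). \<tau> \<omega> \<le> real N"
            "J x (gs m) (Gs m) \<tau> < ws m x + e + exp (2 * B) / real n"
            by (auto simp: N_def)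
          have \<tau>_st: "\<tau> \<in> st x" using \<tau>(1) dyadic_subset by blast
          have \<tau>T: "\<forall>\<omega>\<in>space (P x). \<tau> \<omega> \<le> T" using \<tau>(2) by (simp add: T_def)
          have "U T (\<lambda>y. g y - gs m y) x \<le> e / exp (C * T + B)"
            using elim(1)[rule_format, OF x] by (simp add: dist_real_def)
          then have "exp (C * T + B) * U T (\<lambda>y. g y - gs m y) x \<le> exp (C * T + B) * (e / exp (C * T + B))"
            by (intro mult_left_mono) auto
          then have Ue: "exp (C * T + B) * U T (\<lambda>y. g y - gs m y) x \<le> e" by simp
          have "w x \<le> J x g G \<tau>"
            unfolding w by (rule stopping_value_le[OF cb_gG subset_refl \<tau>_st \<tau>(2)])
          also have "\<dots> \<le> exp \<eta> * J x g (Gs m) \<tau>"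
            by (rule J_terminal_le[OF cb_gGs cb_gG \<tau>_st \<tau>T Gs_close(2)])
          also have "\<dots> \<le> \<theta> * (ws m x + 3 * e)"
          proof (intro mult_mono)
            \<comment> \<open>Without rounding only one factor \<open>exp \<eta>\<close>
              occurs.\<close>
            show "exp \<eta> \<le> \<theta>" using \<eta> by (simp flip: \<eta>\<theta>)
            show "J x g (Gs m) \<tau> \<le> ws m x + 3 * e"
              using J_running_le[OF cb_gGs cb_gsGs \<tau>_st \<tau>T gs_le] \<tau>(3) n_small Ue by linarith
          qed (use \<theta> J_nonneg in auto)
          also have "\<dots> \<le> ws m x + 4 * e" by (rule \<theta>_le[OF ws_le])
          finally show ?thesis .
        qed
        show "dist (ws m x) (w x) < \<epsilon>"
          using upper lower e unfolding dist_real_def e_def by linarith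
      qed
    qed
  qed
qed

end
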